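(* Let $d\ge1$ and let $(\eta,p)\in\Lambda$. There exists a constant $c>0$ such that for all integers $0<N<m$, all $\tau>0$, all $v\in\mathcal V^m$, all $a\in\mathcal A^m$, all $\varepsilon\in\mathbf R$ and all $f\in\operatorname{Lip}_1(W_{\eta,p})$, writing $f_N=f\circ\pi^N$, $$\left|\left\langle\nabla^{(2)}P_\tau^m f_N(v+\varepsilon h_a^m)-\nabla^{(2)}P_\tau^m f_N(v),\;h_a^m\otimes h_a^m\right\rangle\right|\le c\,\frac{e^{-5\tau/2}}{\beta_{\tau/2}^2}\,|\varepsilon|\,N^{\eta-\frac12}\sqrt{\frac{N^3}{m^3}},$$ where $\beta_{\tau}=\sqrt{1-e^{-2\tau}}$.
   Context: $\Lambda=\{(\eta,p)\in\mathbf R^+\times\mathbf R^+:\ 0<\eta-1/p<1/2\}\cup\{(0,\infty)\}$, where for finite $p$ one takes $\eta\in(0,1]$, the range for which the spaces below are defined. For $\eta\in(0,1)$ and $1\le p<\infty$, $W_{\eta,p}$ is the Banach space of $\mathbf R^d$-valued functions on $[0,1]$ obtained as the closure of the $\mathcal C^1$ functions for the norm $\|f\|_{\eta,p}^p=\int_0^1|f(t)|^p\,dt+\iint_{[0,1]^2}\frac{|f(t)-f(s)|^p}{|t-s|^{1+p\eta}}\,dt\,ds$; $W_{1,p}$ is the completion of the $\mathcal C^1$ functions for $\|f\|_{1,p}^p=\int_0^1|f(t)|^p\,dt+\int_0^1|f'(t)|^p\,dt$; $W_{0,\infty}$ is the space of continuous $\mathbf R^d$-valued functions on $[0,1]$ with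 the uniform norm. $\operatorname{Lip}_1(W_{\eta,p})$ is the set of $f:W_{\eta,p}\to\mathbf R$ that are $1$-Lipschitz for this norm. $I_{1,2}^d$ is the Hilbert space of functions $f(t)=\int_0^t\dot f(s)\,ds$ with $\dot f\in L^2([0,1];\mathbf R^d)$ and $\langle f,g\rangle=\int_0^1\dot f\cdot\dot g\,ds$; it is contained in $W_{\eta,p}$. For $m\ge1$, $\mathcal A^m=\{1,\dots,d\}\times\{0,\dots,m-1\}$ and, for $a=(a_1,a_2)\in\mathcal A^m$, $h_a^m(t)=\sqrt m\,\Bigl(\int_0^t\mathbf 1_{[a_2/m,(a_2+1)/m)}(s)\,ds\Bigr)e_{a_1}$, with $(e_i)$ the canonical basis of $\mathbf R^d$. The family $(h_a^m)_{a\in\mathcal A^m}$ is orthonormal in $I_{1,2}^d$; $\mathcal V^m$ is its linear span and $\pi^m$ is the orthogonal projection of $I_{1,2}^d$ onto $\mathcal V^m$ (equivalently, affine interpolation on the grid $\{i/m\}_{0\le i\le m}$). $B$ is a standard $d$-dimensional Brownian motion started at $0$ and $B^m=\sum_{a\in\mathcal A^m}\sqrt m\,\bigl(B_{a_1}(\tfrac{a_2+1}{m})-B_{a_1}(\tfrac{a_2}{m})\bigr)h_a^m$ is its affine interpolation, a standard Gaussian vector of $\mathcal V^m$. For $g:\mathcal V^m\to\mathbf R$ Lipschitz, $P_\tau^m g(v)=\mathbf E[g(e^{-\tau}v+\beta_\tau B^m)]$, $v\in\mathcal V^m$. $\nabla^{(2)}$ is the second derivative on the Euclidean space $\mathcal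 V^m$ (inner product of $I_{1,2}^d$), so $\langle\nabla^{(2)}g(v),h\otimes h\rangle$ is the second directional derivative of $g$ at $v$ along $h\in\mathcal V^m$. *)

theory Defs
  imports "HOL-Probability.Probability"
begin

text \<open>
  Functions on \<open>[0,1]\<close> are represented by total functions on \<open>real\<close>; every norm and inner
  product below only reads their values on \<open>[0,1]\<close>. The dimension \<open>d\<close> is \<open>CARD('d)\<close>.
\<close>

type_synonym 'd path = "real \<Rightarrow> real^'d"

abbreviation leb01 :: "real measure" where
  "leb01 \<equiv> lebesgue_on {0..1}"

definition Lambda :: "(real \<times> ereal) set" where
  "Lambda = {(\<eta>, ereal q) | \<eta> q. 0 < \<eta> \<and> \<eta> \<le> 1 \<and> 0 < q \<and> 0 < \<eta> - 1/q \<and> \<eta> - 1/q < 1/2}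
            \<union> {(0, \<infinity>)}"

definition has_path_deriv :: "'d::finite path \<Rightarrow> 'd path \<Rightarrow> bool" where
  "has_path_deriv f g \<longleftrightarrow> integrable leb01 g \<and>
     (\<forall>t\<in>{0..1}. f t = f 0 + (LINT s|lebesgue_on {0..t}. g s))"

text \<open>The derivative of an absolutely continuous path; it is unique up to a null set of \<open>[0,1]\<close>.\<close>

definition path_deriv :: "'d::finite path \<Rightarrow> 'd path" where
  "path_deriv f = (SOME g. has_path_deriv f g)"

text \<open>
  The \<open>q\<close>-th power of the norm of \<open>Wspace\<close> with finite exponent \<open>q\<close>. On the diagonal the integrand
  of the double integral is \<open>0 / 0 = 0\<close>. For \<open>\<eta> = 1\<close> the elements of the completion are taken to be
  absolutely continuous functions, and the energy of any other function is infinite.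
\<close>

definition W_energy :: "real \<Rightarrow> real \<Rightarrow> 'd::finite path \<Rightarrow> ennreal" where
  "W_energy \<eta> q f =
     (\<integral>\<^sup>+ t. ennreal (norm (f t) powr q) \<partial>leb01) +
     (if \<eta> < 1 then
        \<integral>\<^sup>+ (t, s). ennreal (norm (f t - f s) powr q / \<bar>t - s\<bar> powr (1 + q * \<eta>))
           \<partial>(leb01 \<Otimes>\<^sub>M leb01)
      else if \<exists>g. has_path_deriv f g then
        \<integral>\<^sup>+ t. ennreal (norm (path_deriv f t) powr q) \<partial>leb01
      else \<infinity>)"

definition W_norm :: "real \<Rightarrow> ereal \<Rightarrow> 'd::finite path \<Rightarrow> real" where
  "W_norm \<eta> p f =
     (if p = \<infinity> then (SUP t\<in>{0..1}. norm (f t))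
      else enn2real (W_energy \<eta> (real_of_ereal p) f) powr (1 / real_of_ereal p))"

text \<open>
  For finite \<open>p\<close>, the closure of the continuously differentiable functions: convergence in norm is
  convergence to \<open>0\<close> of the energy of the difference, and it forces the energy of \<open>f\<close> to be
  finite. The two-sided differentiability at \<open>0\<close> and \<open>1\<close> asked by \<open>C1_differentiable_on\<close> is
  harmless, since the values outside \<open>[0,1]\<close> are irrelevant. Members are functions rather than
  classes, so for finite \<open>p\<close> the norm is a seminorm on them; a function that is Lipschitz
  for it does not distinguish members of the same class.
\<close>

definition Wspace :: "real \<Rightarrow> ereal \<Rightarrow> 'd::finite path set" where
  "Wspace \<eta> p =
     (if p = \<infinity> then {f. continuous_on {0..1} f}
      else {f \<in> borel_measurable leb01. \<forall>e>0. \<exists>g. g C1_differentiable_on {0..1} \<and>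
              W_energy \<eta> (real_of_ereal p) (\<lambda>t. f t - g t) < ennreal e})"

definition Lip1 :: "real \<Rightarrow> ereal \<Rightarrow> ('d::finite path \<Rightarrow> real) set" where
  "Lip1 \<eta> p = {F. \<forall>u\<in>Wspace \<eta> p. \<forall>w\<in>Wspace \<eta> p. \<bar>F u - F w\<bar> \<le> W_norm \<eta> p (\<lambda>t. u t - w t)}"

definition I12 :: "'d::finite path set" where
  "I12 = {f. f 0 = 0 \<and> (\<exists>g. has_path_deriv f g \<and> integrable leb01 (\<lambda>s. (norm (g s))\<^sup>2))}"

definition ip :: "'d::finite path \<Rightarrow> 'd path \<Rightarrow> real" where
  "ip f g = (LINT s|leb01. path_deriv f s \<bullet> path_deriv g s)"

definition I_norm :: "'d::finite path \<Rightarrow> real" where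
  "I_norm f = sqrt (ip f f)"

definition Aset :: "nat \<Rightarrow> ('d::finite \<times> nat) set" where
  "Aset m = UNIV \<times> {..<m}"

definition hb :: "nat \<Rightarrow> 'd::finite \<times> nat \<Rightarrow> 'd path" where
  "hb m a t =
     (sqrt (real m) * (LINT s|lebesgue_on {0..t}.
        indicat_real {real (snd a) / real m ..< (real (snd a) + 1) / real m} s)) *\<^sub>R axis (fst a) 1"

lemma hb_in_I12: "hb m a \<in> I12"
proof -
  let ?J = "{real (snd a) / real m ..< (real (snd a) + 1) / real m}"
  let ?g = "\<lambda>s. (sqrt (real m) * indicat_real ?J s) *\<^sub>R axis (fst a) (1::real)"
  have fin: "finite_measure (lebesgue_on {0..t})" for t :: real
    by (intro finite_measure_lebesgue_on) auto
  have meas: "?J \<in> sets lebesgue" by simp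
  have bm: "indicat_real ?J \<in> borel_measurable (lebesgue_on {0..t})" for t :: real
    by (intro measurable_restrict_space1 borel_measurable_indicator meas)
  have ind: "integrable (lebesgue_on {0..t}) (indicat_real ?J)" for t :: real
    by (rule finite_measure.integrable_const_bound[OF fin, of _ 1]) (simp_all add: bm)
  have z: "(LINT s|lebesgue_on {0}. f s) = 0" for f :: "real \<Rightarrow> real"
  proof (rule integral_eq_zero_AE)
    have "AE x in lebesgue. x \<noteq> (0::real)"
      by (rule AE_I'[of "{0}"]) auto
    then show "AE x in lebesgue_on {0}. f x = 0"
      by (subst AE_restrict_space_iff) (simp, erule eventually_mono, simp)
  qed
  have "integrable (lebesgue_on {0..t}) ?g" for t :: real
    using ind[of t] by (intro integrable_scaleR_left integrable_mult_right) auto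
  moreover have "(LINT s|lebesgue_on {0..t}. ?g s) = hb m a t" for t
    unfolding hb_def using ind[of t]
    by (subst integral_scaleR_left) (auto simp del: integral_indicator)
  moreover have "hb m a 0 = 0"
    using z[of "indicat_real ?J"] by (auto simp: hb_def)
  ultimately have "has_path_deriv (hb m a) ?g"
    by (simp add: has_path_deriv_def)
  moreover have "integrable leb01 (\<lambda>s. (norm (?g s))\<^sup>2)"
  proof -
    have "(\<lambda>s. (norm (?g s))\<^sup>2) = (\<lambda>s. real m * indicat_real ?J s)"
      by (auto simp: indicator_def)
    with ind[of 1] show ?thesis by simp
  qed
  moreover have "hb m a 0 = 0"
    using z[of "indicat_real ?J"] by (auto simp: hb_def)
  ultimately show ?thesis unfolding I12_def by blast
qed

definition Vspan :: "nat \<Rightarrow> 'd::finite path set" where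
  "Vspan m = {v. \<exists>c. v = (\<lambda>t. \<Sum>a\<in>Aset m. c a *\<^sub>R hb m a t)}"

text \<open>Orthogonal projection of \<open>I12\<close> onto \<open>Vspan m\<close>; only meaningful on \<open>I12\<close>.\<close>

definition proj :: "nat \<Rightarrow> 'd::finite path \<Rightarrow> 'd path" where
  "proj m f = (THE w. w \<in> Vspan m \<and> (\<forall>u\<in>Vspan m. ip (\<lambda>t. f t - w t) u = 0))"

locale brownian_motion = prob_space M for M :: "'a measure" +
  fixes B :: "real \<Rightarrow> 'a \<Rightarrow> real^'d::finite"
  assumes B_measurable: "\<And>t. 0 \<le> t \<Longrightarrow> random_variable borel (B t)"
    and B_start: "AE \<omega> in M. B 0 \<omega> = 0"
    and B_continuous: "AE \<omega> in M. continuous_on {0..} (\<lambda>t. B t \<omega>)"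
    and B_indep_increments: "\<And>(t :: nat \<Rightarrow> real) n. 0 \<le> t 0 \<Longrightarrow> mono t \<Longrightarrow>
          indep_vars (\<lambda>_. borel) (\<lambda>k \<omega>. B (t (Suc k)) \<omega> - B (t k) \<omega>) {..<n}"
    and B_indep_components: "\<And>s t. 0 \<le> s \<Longrightarrow> s < t \<Longrightarrow>
          indep_vars (\<lambda>_. borel) (\<lambda>i \<omega>. (B t \<omega> - B s \<omega>) $ i) UNIV"
    and B_normal: "\<And>s t i. 0 \<le> s \<Longrightarrow> s < t \<Longrightarrow>
          distributed M lborel (\<lambda>\<omega>. (B t \<omega> - B s \<omega>) $ i) (normal_density 0 (sqrt (t - s)))"

definition Bm :: "(real \<Rightarrow> 'a \<Rightarrow> real^'d::finite) \<Rightarrow> nat \<Rightarrow> 'a \<Rightarrow> 'd path" where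
  "Bm B m \<omega> t = (\<Sum>a\<in>Aset m. (sqrt (real m) *
      (B ((real (snd a) + 1) / real m) \<omega> $ fst a - B (real (snd a) / real m) \<omega> $ fst a))
        *\<^sub>R hb m a t)"

definition beta :: "real \<Rightarrow> real" where
  "beta \<tau> = sqrt (1 - exp (- 2 * \<tau>))"

definition Pm :: "'a measure \<Rightarrow> (real \<Rightarrow> 'a \<Rightarrow> real^'d::finite) \<Rightarrow> nat \<Rightarrow> real \<Rightarrow>
    ('d path \<Rightarrow> real) \<Rightarrow> 'd path \<Rightarrow> real" where
  "Pm M B m \<tau> g v = (LINT \<omega>|M. g (\<lambda>t. exp (- \<tau>) *\<^sub>R v t + beta \<tau> *\<^sub>R Bm B m \<omega> t))"

text \<open>
  First and second Frechet derivatives on the Euclidean space \<open>Vspan m\<close> with the inner product \<open>ip\<close>: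
  \<open>x\<close> is the gradient of \<open>g\<close> at \<open>v\<close>, and \<open>H\<close> is the derivative at \<open>v\<close> of the gradient field, which
  has to exist in a neighbourhood of \<open>v\<close> (\<open>G w\<close> is the gradient at \<open>v + w\<close>). The second
  derivative as a bilinear form is \<open>(h, k) \<mapsto> ip (H h) k\<close>.
\<close>

definition has_gradient ::
  "nat \<Rightarrow> ('d::finite path \<Rightarrow> real) \<Rightarrow> 'd path \<Rightarrow> 'd path \<Rightarrow> bool" where
  "has_gradient m g v x \<longleftrightarrow> x \<in> Vspan m \<and>
     (\<forall>e>0. \<exists>\<delta>>0. \<forall>w\<in>Vspan m. I_norm w < \<delta> \<longrightarrow>
        \<bar>g (\<lambda>t. v t + w t) - g v - ip x w\<bar> \<le> e * I_norm w)"

definition linear_on_Vspan :: "nat \<Rightarrow> ('d::finite path \<Rightarrow> 'd path) \<Rightarrow> bool" where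
  "linear_on_Vspan m H \<longleftrightarrow>
     (\<forall>x\<in>Vspan m. H x \<in> Vspan m) \<and>
     (\<forall>x\<in>Vspan m. \<forall>y\<in>Vspan m. H (\<lambda>t. x t + y t) = (\<lambda>t. H x t + H y t)) \<and>
     (\<forall>c. \<forall>x\<in>Vspan m. H (\<lambda>t. c *\<^sub>R x t) = (\<lambda>t. c *\<^sub>R H x t))"

definition has_hessian ::
  "nat \<Rightarrow> ('d::finite path \<Rightarrow> real) \<Rightarrow> 'd path \<Rightarrow> ('d path \<Rightarrow> 'd path) \<Rightarrow> bool" where
  "has_hessian m g v H \<longleftrightarrow> linear_on_Vspan m H \<and>
     (\<exists>G. (\<exists>r>0. \<forall>w\<in>Vspan m. I_norm w < r \<longrightarrow> has_gradient m g (\<lambda>t. v t + w t) (G w)) \<and>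
          (\<forall>e>0. \<exists>\<delta>>0. \<forall>w\<in>Vspan m. I_norm w < \<delta> \<longrightarrow>
             I_norm (\<lambda>t. G w t - G (\<lambda>_. 0) t - H w t) \<le> e * I_norm w))"

end

theory Submission
  imports Defs
begin

text \<open>
  In the orthonormal coordinates \<open>x\<close> of \<open>\<V>\<^sup>m\<close> given by the basis \<open>hb m a\<close>, the semigroup
  reads \<open>P g(x) = E[g(e\<^sup>-\<^sup>\<tau> x + \<beta> Z)]\<close> with a standard Gaussian vector \<open>Z\<close>. With
  \<open>\<psi>(z) = g(\<beta> z)\<close> and \<open>\<kappa> = e\<^sup>-\<^sup>\<tau> / \<beta>\<close> this is \<open>S(\<kappa> x)\<close>, where \<open>S(x) = E[\<psi>(Z + x)]\<close>. By the
  Cameron-Martin formula the point \<open>x\<close> can be moved into the Gaussian weight, so \<open>S\<close> is smooth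
  although \<open>\<psi>\<close> is only Lipschitz, with second derivative \<open>E[\<psi>(Z + x) (Z\<^sub>i Z\<^sub>j - \<delta>\<^sub>i\<^sub>j)]\<close>
  (\<open>smooth_expansion\<close>, \<open>grad_expansion\<close>).

  The three factors \<open>\<surd>(N/m)\<close> arise as follows. First, \<open>g = F \<circ> \<pi>\<^sup>N\<close> cannot distinguish the direction
  \<open>e = h\<^sub>a\<^sup>m\<close> from any \<open>w\<close> in \<open>\<V>\<^sup>m\<close> with \<open>\<pi>\<^sup>N w = \<pi>\<^sup>N e\<close>, so the second derivative of \<open>S\<close> takes the
  same value along \<open>e\<close> and along \<open>w\<close> (\<open>hess_exchange\<close>). There is such a \<open>w\<close> with
  \<open>\<parallel>w\<parallel>\<^sup>2 \<le> 3 N/m\<close>: the increment of \<open>e\<close> over an interval of the coarse grid is spread evenly over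
  the intervals of the fine grid that are contained in it (\<open>exchange_direction\<close>). Secondly, the
  increment of the second derivative under a shift \<open>y\<close> is
  \<open>E[(\<psi>(Z + x + y) - \<psi>(Z + x)) (\<langle>w, Z\<rangle>\<^sup>2 - \<parallel>w\<parallel>\<^sup>2)]\<close>, which is at most
  \<open>2 \<parallel>w\<parallel>\<^sup>2\<close> times the supremum of \<open>\<psi>(\<cdot> + y) - \<psi>\<close> (\<open>hess_increment_le\<close>). That supremum is
  controlled by the \<open>W\<close>-norm of \<open>\<pi>\<^sup>N e\<close>.

  The latter is of order \<open>N\<^sup>\<eta>\<^sup>-\<^sup>1\<^sup>/\<^sup>2 \<surd>(N/m)\<close>. Indeed the coefficients of \<open>\<pi>\<^sup>N e\<close> have sum at most
  \<open>\<surd>(N/m)\<close> (\<open>sum_gram_le\<close>), and a combination of the \<open>h\<^sub>b\<^sup>N\<close> whose coefficients have absolute sum \<open>Y\<close>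
  oscillates by at most \<open>Y N\<^sup>-\<^sup>1\<^sup>/\<^sup>2 min(1, N \<bar>t - s\<bar>)\<close>, which bounds its \<open>W\<close>-norm by a multiple of
  \<open>Y N\<^sup>\<eta>\<^sup>-\<^sup>1\<^sup>/\<^sup>2\<close> (\<open>W_energy_le\<close>, \<open>W_norm_comb_le\<close>). The Lipschitz property of \<open>F\<close> can be used
  because piecewise affine paths are limits of smooth ones (\<open>comb_in_Wspace\<close>).

  Altogether the increment is at most a constant times
  \<open>e\<^sup>-\<^sup>3\<^sup>\<tau> \<beta>\<^sub>\<tau>\<^sup>-\<^sup>2 \<bar>\<epsilon>\<bar> N\<^sup>\<eta>\<^sup>-\<^sup>1\<^sup>/\<^sup>2 (N/m)\<^sup>3\<^sup>/\<^sup>2\<close>, and the time factor is at most the one claimed (\<open>time_factor_le\<close>).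
\<close>

section \<open>Shifting a Gaussian product measure\<close>

definition std_gauss :: "real measure" where
  "std_gauss = density lborel (\<lambda>x. ennreal (std_normal_density x))"

abbreviation Gauss :: "'i set \<Rightarrow> ('i \<Rightarrow> real) measure" where
  "Gauss A \<equiv> PiM A (\<lambda>_. std_gauss)"

lemma sets_std_gauss [measurable_cong, simp]: "sets std_gauss = sets borel"
  by (simp add: std_gauss_def)

lemma space_std_gauss [simp]: "space std_gauss = UNIV"
  by (simp add: std_gauss_def)

lemma prob_space_std_gauss: "prob_space std_gauss"
  unfolding std_gauss_def by (rule prob_space_normal_density) simp

lemma prob_space_Gauss: "prob_space (Gauss A)"
  by (intro prob_space_PiM prob_space_std_gauss)

interpretation gauss: product_sigma_finite "\<lambda>_::'i. std_gauss"
  by unfold_locales (rule prob_space_imp_sigma_finite[OF prob_space_std_gauss,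
      unfolded sigma_finite_measure_def])

lemma std_gauss_shift:
  "distr std_gauss std_gauss (\<lambda>z. z + x) = density std_gauss (\<lambda>z. ennreal (exp (x * z - x\<^sup>2 / 2)))"
proof (rule measure_eqI)
  fix S assume "S \<in> sets (distr std_gauss std_gauss (\<lambda>z. z + x))"
  then have S [measurable]: "S \<in> sets borel" by simp
  have eq: "std_normal_density z * exp (x * z - x\<^sup>2 / 2) = std_normal_density (z - x)" for z
    by (simp add: std_normal_density_def exp_add [symmetric] field_simps power2_eq_square)
  have "emeasure (distr std_gauss std_gauss (\<lambda>z. z + x)) S
      = (\<integral>\<^sup>+z. indicator S z \<partial>distr std_gauss std_gauss (\<lambda>z. z + x))"
    by (subst nn_integral_indicator) auto
  also have "\<dots> = (\<integral>\<^sup>+z. indicator S (z + x) \<partial>std_gauss)"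
    by (subst nn_integral_distr) auto
  also have "\<dots> = (\<integral>\<^sup>+z. ennreal (std_normal_density z) * indicator S (z + x) \<partial>lborel)"
    unfolding std_gauss_def by (subst nn_integral_density) auto
  also have "\<dots> = (\<integral>\<^sup>+z. ennreal (std_normal_density (z - x)) * indicator S z \<partial>lborel)"
    by (subst nn_integral_real_affine[of _ 1 "x"]) (auto simp: add_ac)
  also have "\<dots> = (\<integral>\<^sup>+z. ennreal (exp (x * z - x\<^sup>2 / 2)) * indicator S z \<partial>std_gauss)"
    unfolding std_gauss_def
    by (subst nn_integral_density) (auto simp: eq [symmetric] ennreal_mult mult_ac)
  also have "\<dots> = emeasure (density std_gauss (\<lambda>z. ennreal (exp (x * z - x\<^sup>2 / 2)))) S"
    by (subst emeasure_density) auto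
  finally show "emeasure (distr std_gauss std_gauss (\<lambda>z. z + x)) S
      = emeasure (density std_gauss (\<lambda>z. ennreal (exp (x * z - x\<^sup>2 / 2)))) S" .
qed simp

lemma nn_integral_std_gauss_shift:
  assumes [measurable]: "f \<in> borel_measurable borel"
  shows "(\<integral>\<^sup>+z. f (z + x) \<partial>std_gauss) = (\<integral>\<^sup>+z. ennreal (exp (x * z - x\<^sup>2 / 2)) * f z \<partial>std_gauss)"
proof -
  have "(\<integral>\<^sup>+z. f (z + x) \<partial>std_gauss) = (\<integral>\<^sup>+z. f z \<partial>distr std_gauss std_gauss (\<lambda>z. z + x))"
    by (subst nn_integral_distr) auto
  then show ?thesis
    by (simp add: std_gauss_shift nn_integral_density)
qed

text \<open>
  The density of the law of \<open>Z + x\<close> with respect to the law of \<open>Z\<close>, for a standard Gaussian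
  vector \<open>Z\<close> indexed by \<open>A\<close>.
\<close>

definition gauss_density :: "'i set \<Rightarrow> ('i \<Rightarrow> real) \<Rightarrow> ('i \<Rightarrow> real) \<Rightarrow> real" where
  "gauss_density A x z = exp ((\<Sum>i\<in>A. x i * z i) - (\<Sum>i\<in>A. (x i)\<^sup>2) / 2)"

text \<open>
  The Cameron-Martin formula. Both sides are product measures, so it is enough to compare them
  coordinate by coordinate, where the claim is the completion of a square (\<open>std_gauss_shift\<close>).
\<close>

lemma Gauss_shift:
  assumes A: "finite A"
  shows "distr (Gauss A) (Gauss A) (\<lambda>z. \<lambda>i\<in>A. z i + x i) =
         density (Gauss A) (\<lambda>z. ennreal (gauss_density A x z))"
proof -
  define D where "D i = density std_gauss (\<lambda>z. ennreal (exp (x i * z - (x i)\<^sup>2 / 2)))" for i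
  have pD: "prob_space (D i)" for i
    unfolding D_def std_gauss_shift [symmetric]
    by (rule prob_space.prob_space_distr [OF prob_space_std_gauss]) simp
  interpret D: product_sigma_finite D
    by unfold_locales (rule prob_space_imp_sigma_finite[OF pD,
        unfolded sigma_finite_measure_def])
  have sD: "sets (PiM A D) = sets (Gauss A)"
    by (rule sets_PiM_cong) (auto simp: D_def)
  have 1: "distr (Gauss A) (Gauss A) (\<lambda>z. \<lambda>i\<in>A. z i + x i) = PiM A D"
  proof (rule D.PiM_eqI [OF A])
    show "sets (distr (Gauss A) (Gauss A) (\<lambda>z. \<lambda>i\<in>A. z i + x i)) = sets (PiM A D)"
      using sD by simp
  next
    fix S assume "\<And>i. i \<in> A \<Longrightarrow> S i \<in> sets (D i)"
    then have S: "\<And>i. i \<in> A \<Longrightarrow> S i \<in> sets borel" by (simp add: D_def)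
    have shS: "(\<lambda>z. z + x i) -` S i \<in> sets borel" if "i \<in> A" for i
      using measurable_sets[of "\<lambda>z. z + x i" borel borel "S i"] S[OF that] by auto
    have "emeasure (distr (Gauss A) (Gauss A) (\<lambda>z. \<lambda>i\<in>A. z i + x i)) (Pi\<^sub>E A S)
       = emeasure (Gauss A) (Pi\<^sub>E A (\<lambda>i. (\<lambda>z. z + x i) -` S i))"
      using S A
      by (subst emeasure_distr)
         (auto intro!: arg_cong[where f="emeasure _"] sets_PiM_I_finite simp: space_PiM PiE_iff)
    also have "\<dots> = (\<Prod>i\<in>A. emeasure std_gauss ((\<lambda>z. z + x i) -` S i))"
      using shS by (intro gauss.emeasure_PiM A) auto
    also have "\<dots> = (\<Prod>i\<in>A. emeasure (D i) (S i))"
      using S by (intro prod.cong refl)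
        (simp add: D_def std_gauss_shift [symmetric] emeasure_distr)
    finally show "emeasure (distr (Gauss A) (Gauss A) (\<lambda>z. \<lambda>i\<in>A. z i + x i)) (Pi\<^sub>E A S)
      = (\<Prod>i\<in>A. emeasure (D i) (S i))" .
  qed
  have 2: "density (Gauss A) (\<lambda>z. ennreal (gauss_density A x z)) = PiM A D"
  proof (rule D.PiM_eqI [OF A])
    show "sets (density (Gauss A) (\<lambda>z. ennreal (gauss_density A x z))) = sets (PiM A D)"
      using sD by simp
  next
    fix S assume "\<And>i. i \<in> A \<Longrightarrow> S i \<in> sets (D i)"
    then have S: "\<And>i. i \<in> A \<Longrightarrow> S i \<in> sets borel" by (simp add: D_def)
    have [measurable]: "Pi\<^sub>E A S \<in> sets (Gauss A)"
      using S A by (intro sets_PiM_I_finite) auto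
    have eq: "ennreal (gauss_density A x z) * indicator (Pi\<^sub>E A S) z =
       (\<Prod>i\<in>A. ennreal (exp (x i * z i - (x i)\<^sup>2 / 2)) * indicator (S i) (z i))"
      if "z \<in> space (Gauss A)" for z
    proof -
      have "indicator (Pi\<^sub>E A S) z = (\<Prod>i\<in>A. indicator (S i) (z i) :: ennreal)"
        using that A by (auto simp: space_PiM PiE_iff indicator_def)
      moreover have "gauss_density A x z = (\<Prod>i\<in>A. exp (x i * z i - (x i)\<^sup>2 / 2))"
        by (simp add: gauss_density_def exp_sum [OF A, symmetric] sum_subtractf sum_divide_distrib)
      ultimately show ?thesis
        by (simp add: prod_ennreal prod.distrib)
    qed
    have "emeasure (density (Gauss A) (\<lambda>z. ennreal (gauss_density A x z))) (Pi\<^sub>E A S)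
      = (\<integral>\<^sup>+z. ennreal (gauss_density A x z) * indicator (Pi\<^sub>E A S) z \<partial>Gauss A)"
      by (subst emeasure_density) (auto simp: gauss_density_def)
    also have "\<dots> = (\<integral>\<^sup>+z. (\<Prod>i\<in>A. ennreal (exp (x i * z i - (x i)\<^sup>2 / 2)) * indicator (S i) (z i)) \<partial>Gauss A)"
      by (intro nn_integral_cong eq)
    also have "\<dots> = (\<Prod>i\<in>A. \<integral>\<^sup>+z. ennreal (exp (x i * z - (x i)\<^sup>2 / 2)) * indicator (S i) z \<partial>std_gauss)"
      using S by (intro gauss.product_nn_integral_prod A) auto
    also have "\<dots> = (\<Prod>i\<in>A. emeasure (D i) (S i))"
      using S by (intro prod.cong refl) (simp add: D_def emeasure_density)
    finally show "emeasure (density (Gauss A) (\<lambda>z. ennreal (gauss_density A x z))) (Pi\<^sub>E A S)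
      = (\<Prod>i\<in>A. emeasure (D i) (S i))" .
  qed
  show ?thesis using 1 2 by simp
qed

text \<open>
  The shifted argument is restricted to \<open>A\<close> because the points of the product space are
  extensional functions.
\<close>

lemma Gauss_integral_shift:
  fixes f :: "('i \<Rightarrow> real) \<Rightarrow> real"
  assumes A: "finite A" and f [measurable]: "f \<in> borel_measurable (Gauss A)"
  shows "(\<integral>z. f (\<lambda>i\<in>A. z i + x i) \<partial>Gauss A) = (\<integral>z. gauss_density A x z * f z \<partial>Gauss A)"
    and "integrable (Gauss A) (\<lambda>z. f (\<lambda>i\<in>A. z i + x i)) \<longleftrightarrow>
         integrable (Gauss A) (\<lambda>z. gauss_density A x z * f z)"
proof -
  have [measurable]: "gauss_density A x \<in> borel_measurable (Gauss A)"
    unfolding gauss_density_def by measurable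
  have m: "(\<lambda>z. \<lambda>i\<in>A. z i + x i) \<in> measurable (Gauss A) (Gauss A)"
    by measurable
  show "(\<integral>z. f (\<lambda>i\<in>A. z i + x i) \<partial>Gauss A) = (\<integral>z. gauss_density A x z * f z \<partial>Gauss A)"
    using integral_distr [OF m f] Gauss_shift [OF A, of x]
    by (simp add: integral_real_density gauss_density_def)
  show "integrable (Gauss A) (\<lambda>z. f (\<lambda>i\<in>A. z i + x i)) \<longleftrightarrow>
         integrable (Gauss A) (\<lambda>z. gauss_density A x z * f z)"
    using integrable_distr_eq [OF m f] Gauss_shift [OF A, of x]
    by (simp add: integrable_real_density gauss_density_def)
qed

text \<open>
  The Cameron-Martin density has integral one, which gives the exponential moments.
\<close>

lemma integrable_std_gauss_exp_abs: "integrable std_gauss (\<lambda>z. exp (k * \<bar>z\<bar>))"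
proof (rule Bochner_Integration.integrable_bound)
  have *: "integrable std_gauss (\<lambda>z. exp (y * z))" for y
  proof -
    have "(\<integral>\<^sup>+z. ennreal (exp (y * z - y\<^sup>2 / 2)) * 1 \<partial>std_gauss) = (\<integral>\<^sup>+z. 1 \<partial>std_gauss)"
      by (subst nn_integral_std_gauss_shift [symmetric]) auto
    also have "\<dots> = 1"
      using prob_space.emeasure_space_1 [OF prob_space_std_gauss] by simp
    finally have "integrable std_gauss (\<lambda>z. exp (y * z - y\<^sup>2 / 2))"
      by (intro integrableI_bounded) auto
    then have "integrable std_gauss (\<lambda>z. exp (y\<^sup>2 / 2) * exp (y * z - y\<^sup>2 / 2))" by simp
    then show ?thesis by (simp add: exp_add [symmetric])
  qed
  show "integrable std_gauss (\<lambda>z. exp (k * z) + exp ((- k) * z))"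
    by (intro Bochner_Integration.integrable_add *)
  show "AE z in std_gauss. norm (exp (k * \<bar>z\<bar>)) \<le> norm (exp (k * z) + exp ((- k) * z))"
  proof (intro always_eventually allI)
    fix z
    have "0 < exp (k * z)" "0 < exp ((- k) * z)" by auto
    then show "norm (exp (k * \<bar>z\<bar>)) \<le> norm (exp (k * z) + exp ((- k) * z))"
      by (cases "z \<ge> 0") auto
  qed
qed simp

lemma integrable_Gauss_exp_abs:
  assumes A: "finite A"
  shows "integrable (Gauss A) (\<lambda>z. exp (k * (\<Sum>i\<in>A. \<bar>z i\<bar>)))"
proof -
  have "integrable (Gauss A) (\<lambda>z. \<Prod>i\<in>A. exp (k * \<bar>z i\<bar>))"
    by (intro gauss.product_integrable_prod A integrable_std_gauss_exp_abs)
  then show ?thesis by (simp add: exp_sum [OF A] sum_distrib_left)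
qed

section \<open>Gaussian smoothing of a rough function\<close>

definition l1 :: "'i set \<Rightarrow> ('i \<Rightarrow> real) \<Rightarrow> real" where
  "l1 A z = (\<Sum>i\<in>A. \<bar>z i\<bar>)"

lemma l1_nonneg [simp]: "0 \<le> l1 A z"
  by (simp add: l1_def sum_nonneg)

lemma l1_triangle: "l1 A (\<lambda>i. z i + x i) \<le> l1 A z + l1 A x"
  unfolding l1_def sum.distrib [symmetric] by (intro sum_mono abs_triangle_ineq)

lemma l1_scale: "l1 A (\<lambda>i. t * z i) = \<bar>t\<bar> * l1 A z"
  by (simp add: l1_def sum_distrib_left abs_mult)

lemma l1_component: "finite A \<Longrightarrow> i \<in> A \<Longrightarrow> \<bar>z i\<bar> \<le> l1 A z"
  unfolding l1_def by (intro member_le_sum) auto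

lemma measurable_l1 [measurable]: "l1 A \<in> borel_measurable (Gauss A)"
  unfolding l1_def by measurable

lemma gauss_density_measurable [measurable]: "gauss_density A x \<in> borel_measurable (Gauss A)"
  unfolding gauss_density_def by measurable

lemma abs_exp_minus_one_le: "\<bar>exp y - 1\<bar> \<le> \<bar>y\<bar> * exp \<bar>y\<bar>" for y :: real
proof (cases "y \<ge> 0")
  case True
  have "1 - y \<le> exp (- y)" using exp_ge_add_one_self[of "-y"] by simp
  then have "(1 - y) * exp y \<le> exp (-y) * exp y" by (intro mult_right_mono) auto
  then show ?thesis using True by (simp add: exp_minus algebra_simps)
next
  case False
  then have "\<bar>exp y - 1\<bar> \<le> \<bar>y\<bar>"
    using exp_ge_add_one_self[of y] by (simp add: abs_if del: exp_ge_add_one_self)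
  also have "\<dots> \<le> \<bar>y\<bar> * exp \<bar>y\<bar>" using mult_left_mono[of 1 "exp \<bar>y\<bar>" "\<bar>y\<bar>"] by simp
  finally show ?thesis .
qed

lemma exp_quadratic_remainder: "\<bar>exp y - 1 - y\<bar> \<le> y\<^sup>2 * exp \<bar>y\<bar>" for y :: real
proof -
  note * = abs_exp_minus_one_le
  show ?thesis
  proof (cases "y \<ge> 0")
    case True
    have "1 - y \<le> exp (- y)" using exp_ge_add_one_self[of "-y"] by simp
    then have "(1 - y) * exp y \<le> exp (-y) * exp y" by (intro mult_right_mono) auto
    then have "exp y - 1 \<le> y * exp y" by (simp add: exp_minus algebra_simps)
    then have "exp y - 1 - y \<le> y * (exp y - 1)" by (simp add: algebra_simps)
    also have "\<dots> \<le> y * (y * exp y)"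
      using * [of y] True by (intro mult_left_mono) auto
    finally have "exp y - 1 - y \<le> y\<^sup>2 * exp \<bar>y\<bar>"
      using True by (simp add: power2_eq_square mult_ac)
    moreover have "0 \<le> exp y - 1 - y" using exp_ge_add_one_self[of y] by linarith
    ultimately show ?thesis by linarith
  next
    case False
    then have y: "y < 0" by simp
    have "(1 - y) * exp y \<le> 1"
    proof -
      have "(1 - y) * exp y \<le> exp (-y) * exp y"
        using exp_ge_add_one_self[of "-y"] by (intro mult_right_mono) auto
      then show ?thesis by (simp add: exp_minus)
    qed
    then have "exp y - 1 - y \<le> y * (exp y - 1)" by (simp add: algebra_simps)
    also have "\<dots> = \<bar>y\<bar> * \<bar>exp y - 1\<bar>" using y by (simp add: algebra_simps)
    also have "\<dots> \<le> \<bar>y\<bar> * (\<bar>y\<bar> * exp \<bar>y\<bar>)" using * [of y] by (intro mult_left_mono) auto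
    finally have "exp y - 1 - y \<le> y\<^sup>2 * exp \<bar>y\<bar>"
      using y by (simp add: power2_eq_square mult_ac)
    moreover have "0 \<le> exp y - 1 - y" using exp_ge_add_one_self[of y] by linarith
    ultimately show ?thesis by linarith
  qed
qed

text \<open>
  The exponent is at most \<open>l1 u (l1 z + 1)\<close> in absolute value when \<open>l1 u \<le> 1\<close>. Powers of
  \<open>l1 z + 1\<close> are absorbed into the exponential, because integrability is all that matters
  afterwards.
\<close>

lemma gauss_density_taylor:
  assumes A: "finite A" and u: "l1 A u \<le> 1"
  shows "\<bar>gauss_density A u z - 1\<bar> \<le> l1 A u * exp (2 * (l1 A z + 1))"
    and "\<bar>gauss_density A u z - 1 - (\<Sum>i\<in>A. u i * z i)\<bar> \<le> (l1 A u)\<^sup>2 * (2 * exp (3 * (l1 A z + 1)))"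
proof -
  define r s a q where "r = l1 A u" and "s = l1 A z" and "a = (\<Sum>i\<in>A. u i * z i)"
    and "q = (\<Sum>i\<in>A. (u i)\<^sup>2) / 2"
  have r: "0 \<le> r" "r \<le> 1" and s: "0 \<le> s" using u by (auto simp: r_def s_def)
  have "\<bar>a\<bar> \<le> (\<Sum>i\<in>A. \<bar>u i\<bar> * s)"
    unfolding a_def s_def using l1_component[OF A, of _ z]
    by (intro order.trans[OF sum_abs] sum_mono) (auto simp: abs_mult intro: mult_left_mono)
  then have a: "\<bar>a\<bar> \<le> r * s" by (simp add: r_def l1_def sum_distrib_right)
  have "(\<Sum>i\<in>A. (u i)\<^sup>2) \<le> (\<Sum>i\<in>A. \<bar>u i\<bar> * r)"
  proof (intro sum_mono)
    fix i assume "i \<in> A"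
    have "\<bar>u i\<bar> * \<bar>u i\<bar> \<le> \<bar>u i\<bar> * r"
      unfolding r_def using l1_component[OF A \<open>i \<in> A\<close>, of u] by (intro mult_left_mono) auto
    then show "(u i)\<^sup>2 \<le> \<bar>u i\<bar> * r" by (simp add: power2_eq_square)
  qed
  then have q: "0 \<le> q" "q \<le> r\<^sup>2 / 2"
    by (auto simp: q_def r_def l1_def sum_distrib_right[symmetric] power2_eq_square sum_nonneg)
  define y where "y = a - q"
  have gd: "gauss_density A u z = exp y" by (simp add: gauss_density_def y_def a_def q_def)
  have "r\<^sup>2 \<le> r" using r by (simp add: power2_eq_square mult_left_le)
  then have "\<bar>y\<bar> \<le> r * s + r" using a q unfolding y_def by linarith
  then have y: "\<bar>y\<bar> \<le> r * (s + 1)" by (simp add: algebra_simps)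
  also have "\<dots> \<le> 1 * (s + 1)" using r s by (intro mult_right_mono) auto
  finally have y1: "\<bar>y\<bar> \<le> s + 1" by simp
  have s1: "s + 1 \<le> exp (s + 1)" using exp_ge_add_one_self[of "s+1"] by linarith
  have "\<bar>exp y - 1\<bar> \<le> \<bar>y\<bar> * exp \<bar>y\<bar>" by (rule abs_exp_minus_one_le)
  also have "\<dots> \<le> (r * (s + 1)) * exp (s + 1)" using y y1 r s by (intro mult_mono) auto
  also have "\<dots> \<le> (r * exp (s + 1)) * exp (s + 1)"
    using s1 r by (intro mult_right_mono mult_left_mono) auto
  also have "\<dots> = r * exp (2 * (s + 1))" by (simp add: exp_add[symmetric] algebra_simps mult_exp_exp)
  finally show "\<bar>gauss_density A u z - 1\<bar> \<le> l1 A u * exp (2 * (l1 A z + 1))"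
    by (simp add: gd r_def s_def)
  have "\<bar>exp y - 1 - y\<bar> \<le> y\<^sup>2 * exp \<bar>y\<bar>" by (rule exp_quadratic_remainder)
  also have "\<dots> = \<bar>y\<bar> * \<bar>y\<bar> * exp \<bar>y\<bar>" by (simp add: power2_eq_square)
  also have "\<dots> \<le> (r * (s + 1)) * (r * (s + 1)) * exp (s + 1)"
    using y y1 r s by (intro mult_mono) auto
  also have "\<dots> \<le> (r * exp (s + 1)) * (r * exp (s + 1)) * exp (s + 1)"
    using s1 r s by (intro mult_mono) auto
  also have "\<dots> = r\<^sup>2 * (exp (s + 1) * exp (s + 1) * exp (s + 1))"
    by (simp add: power2_eq_square mult_ac)
  also have "exp (s + 1) * exp (s + 1) * exp (s + 1) = exp (3 * (s + 1))"
    by (simp add: mult_exp_exp)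
  finally have "\<bar>exp y - 1 - y\<bar> \<le> r\<^sup>2 * exp (3 * (s + 1))" .
  moreover have "q \<le> r\<^sup>2 * exp (3 * (s + 1))"
  proof -
    have "r\<^sup>2 * 1 \<le> r\<^sup>2 * exp (3 * (s + 1))" using s by (intro mult_left_mono) auto
    moreover have "r\<^sup>2 / 2 \<le> r\<^sup>2" by simp
    ultimately show ?thesis using q by linarith
  qed
  ultimately have "\<bar>exp y - 1 - a\<bar> \<le> r\<^sup>2 * (2 * exp (3 * (s + 1)))"
    using q(1) unfolding y_def by (simp add: abs_le_iff)
  then show "\<bar>gauss_density A u z - 1 - (\<Sum>i\<in>A. u i * z i)\<bar> \<le> (l1 A u)\<^sup>2 * (2 * exp (3 * (l1 A z + 1)))"
    by (simp add: gd r_def s_def a_def)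
qed

text \<open>
  The Kronecker symbol; \<open>kron a\<close> is also the \<open>a\<close>-th coordinate vector.
\<close>

definition kron :: "'i \<Rightarrow> 'i \<Rightarrow> real" where "kron i j = (if i = j then 1 else 0)"

text \<open>
  The expansion that yields the second derivative: the factor \<open>z i\<close> is the integrand of the
  first derivative, and the shift turns it into \<open>z i - u i\<close>. The first-order term is the second
  Hermite polynomial.
\<close>

lemma gauss_density_taylor_component:
  assumes A: "finite A" and u: "l1 A u \<le> 1" and i: "i \<in> A"
  shows "\<bar>(z i - u i) * gauss_density A u z - z i - (\<Sum>j\<in>A. u j * (z i * z j - kron i j))\<bar>
    \<le> (l1 A u)\<^sup>2 * (3 * exp (4 * (l1 A z + 1)))"
proof -
  define r s a g where "r = l1 A u" and "s = l1 A z" and "a = (\<Sum>i\<in>A. u i * z i)"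
    and "g = gauss_density A u z"
  have r: "0 \<le> r" "r \<le> 1" and s: "0 \<le> s" using u by (auto simp: r_def s_def)
  have ui: "\<bar>u i\<bar> \<le> r" and zi: "\<bar>z i\<bar> \<le> s"
    using l1_component[OF A i] by (auto simp: r_def s_def)
  have s1: "s \<le> exp (s + 1)" using exp_ge_add_one_self[of "s+1"] by linarith
  have "(\<Sum>j\<in>A. u j * (z i * z j - kron i j)) = (\<Sum>j\<in>A. z i * (u j * z j)) - (\<Sum>j\<in>A. u j * kron i j)"
    by (simp add: sum_subtractf[symmetric] algebra_simps)
  also have "\<dots> = z i * a - u i"
    using A i by (simp add: a_def sum_distrib_left[symmetric] kron_def if_distrib[of "\<lambda>x. _ * x"] cong: if_cong)
  finally have "(z i - u i) * g - z i - (\<Sum>j\<in>A. u j * (z i * z j - kron i j))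
     = z i * (g - 1 - a) - u i * (g - 1)" by (simp add: algebra_simps)
  then have "\<bar>(z i - u i) * g - z i - (\<Sum>j\<in>A. u j * (z i * z j - kron i j))\<bar>
     \<le> \<bar>z i\<bar> * \<bar>g - 1 - a\<bar> + \<bar>u i\<bar> * \<bar>g - 1\<bar>"
    by (metis abs_mult abs_triangle_ineq4)
  also have "\<dots> \<le> exp (s + 1) * (r\<^sup>2 * (2 * exp (3 * (s + 1)))) + r * (r * exp (2 * (s + 1)))"
    using gauss_density_taylor[OF A u, of z] zi s1 ui r s
    by (intro add_mono mult_mono) (auto simp: r_def s_def a_def g_def)
  also have "\<dots> \<le> r\<^sup>2 * (2 * exp (4 * (s + 1))) + r\<^sup>2 * exp (4 * (s + 1))"
  proof -
    have "exp (2 * (s + 1)) \<le> exp (4 * (s + 1))" using s by simp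
    then have "r * (r * exp (2 * (s + 1))) \<le> r * (r * exp (4 * (s + 1)))"
      using r by (intro mult_left_mono)
    then show ?thesis by (simp add: power2_eq_square mult_ac mult_exp_exp algebra_simps)
  qed
  finally show ?thesis by (simp add: r_def s_def g_def algebra_simps)
qed

lemma abs_integral_le:
  fixes f g :: "'a \<Rightarrow> real"
  assumes "integrable M f" "integrable M g" "\<And>z. \<bar>f z\<bar> \<le> g z"
  shows "\<bar>integral\<^sup>L M f\<bar> \<le> integral\<^sup>L M g"
proof -
  have "\<bar>integral\<^sup>L M f\<bar> \<le> (\<integral>z. \<bar>f z\<bar> \<partial>M)" using integral_norm_bound[of M f] by simp
  also have "\<dots> \<le> integral\<^sup>L M g" using assms by (intro integral_mono) auto
  finally show ?thesis .
qed

locale exp_growth =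
  fixes A :: "'i set" and \<psi> :: "('i \<Rightarrow> real) \<Rightarrow> real" and C :: real and k :: real
  assumes fin: "finite A"
    and meas [measurable]: "\<psi> \<in> borel_measurable (Gauss A)"
    and local: "\<And>z. \<psi> (restrict z A) = \<psi> z"
    and growth: "\<And>z. \<bar>\<psi> z\<bar> \<le> C * exp (k * l1 A z)"
    and k: "0 \<le> k"
begin

lemma psi_cong: "(\<And>i. i \<in> A \<Longrightarrow> z i = z' i) \<Longrightarrow> \<psi> z = \<psi> z'"
  using local[of z] local[of z'] by (metis restrict_ext)

lemma C_nonneg: "0 \<le> C"
  using growth[of "\<lambda>_. 0"] by (auto simp: l1_def)

lemma meas_shift [measurable]: "(\<lambda>z. \<psi> (\<lambda>i. z i + x i)) \<in> borel_measurable (Gauss A)"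
proof -
  have "(\<lambda>z. \<psi> (\<lambda>i\<in>A. z i + x i)) \<in> borel_measurable (Gauss A)" by measurable
  also have "(\<lambda>z. \<psi> (\<lambda>i\<in>A. z i + x i)) = (\<lambda>z. \<psi> (\<lambda>i. z i + x i))"
    by (intro ext psi_cong) auto
  finally show ?thesis .
qed

lemma growth_shift: "\<bar>\<psi> (\<lambda>i. z i + x i)\<bar> \<le> C * exp (k * l1 A x) * exp (k * l1 A z)"
proof -
  have "\<bar>\<psi> (\<lambda>i. z i + x i)\<bar> \<le> C * exp (k * l1 A (\<lambda>i. z i + x i))" by (rule growth)
  also have "\<dots> \<le> C * exp (k * (l1 A z + l1 A x))"
    using C_nonneg k l1_triangle by (intro mult_left_mono) (auto intro: mult_left_mono)
  finally show ?thesis by (simp add: exp_add algebra_simps)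
qed

definition smooth :: "(('i \<Rightarrow> real) \<Rightarrow> real) \<Rightarrow> ('i \<Rightarrow> real) \<Rightarrow> real" where
  "smooth P x = (\<integral>z. \<psi> (\<lambda>i. z i + x i) * P z \<partial>Gauss A)"

lemma smooth_cong_point: "(\<And>i. i \<in> A \<Longrightarrow> x i = x' i) \<Longrightarrow> smooth P x = smooth P x'"
  unfolding smooth_def by (intro Bochner_Integration.integral_cong refl arg_cong2[where f="(*)"] psi_cong) auto

lemma product_bound:
  assumes "\<bar>P\<bar> \<le> K * exp (\<kappa> * l1 A z)"
  shows "\<bar>\<psi> (\<lambda>i. z i + x i) * P\<bar> \<le> (C * exp (k * l1 A x) * K) * exp ((k + \<kappa>) * l1 A z)"
proof -
  have "\<bar>\<psi> (\<lambda>i. z i + x i) * P\<bar> \<le> (C * exp (k * l1 A x) * exp (k * l1 A z)) * (K * exp (\<kappa> * l1 A z))"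
    unfolding abs_mult using C_nonneg by (intro mult_mono growth_shift assms) auto
  then show ?thesis by (simp add: exp_add algebra_simps)
qed

lemma integrable_exp_bound:
  assumes [measurable]: "Q \<in> borel_measurable (Gauss A)"
    and "\<And>z. \<bar>Q z\<bar> \<le> K * exp (\<kappa> * l1 A z)"
  shows "integrable (Gauss A) Q"
proof (rule Bochner_Integration.integrable_bound)
  show "integrable (Gauss A) (\<lambda>z. K * exp (\<kappa> * l1 A z))"
    using integrable_Gauss_exp_abs[OF fin, of \<kappa>] by (simp add: l1_def)
  show "AE z in Gauss A. norm (Q z) \<le> norm (K * exp (\<kappa> * l1 A z))"
    using assms(2) by (intro always_eventually allI) (simp add: order.trans[OF _ abs_ge_self])
qed measurable

lemma integrable_smooth:
  assumes [measurable]: "P \<in> borel_measurable (Gauss A)"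
    and "\<And>z. \<bar>P z\<bar> \<le> K * exp (\<kappa> * l1 A z)"
  shows "integrable (Gauss A) (\<lambda>z. \<psi> (\<lambda>i. z i + x i) * P z)"
  by (rule integrable_exp_bound[OF _ product_bound[OF assms(2)]]) measurable

text \<open>
  Differentiability of \<open>smooth P\<close> at \<open>x\<close>, with a quadratic remainder. Since
  \<open>\<psi>(Z + x + u)\<close> has under the Gaussian law the same expectation as \<open>\<psi>(Z + x)\<close> under the
  weight \<open>gauss_density A u\<close>, only the smooth weight and the polynomial \<open>P\<close> have to be expanded in
  \<open>u\<close>. The pointwise bound \<open>rem\<close> on this expansion is then integrated against \<open>\<psi>\<close>.
\<close>

lemma smooth_expansion:
  assumes P [measurable]: "P \<in> borel_measurable (Gauss A)"
    and Ploc: "\<And>z. P (restrict z A) = P z"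
    and PK: "\<And>z. \<bar>P z\<bar> \<le> K * exp (\<kappa> * l1 A z)"
    and Q [measurable]: "\<And>j. j \<in> A \<Longrightarrow> Q j \<in> borel_measurable (Gauss A)"
    and QK: "\<And>j z. j \<in> A \<Longrightarrow> \<bar>Q j z\<bar> \<le> K' * exp (\<kappa>' * l1 A z)"
    and L: "0 \<le> L"
    and rem: "\<And>u z. l1 A u \<le> 1 \<Longrightarrow>
       \<bar>P (\<lambda>i. z i - u i) * gauss_density A u z - P z - (\<Sum>j\<in>A. u j * Q j z)\<bar>
         \<le> (l1 A u)\<^sup>2 * (L * exp (\<mu> * l1 A z))"
  shows "\<exists>K0\<ge>0. \<forall>u. l1 A u \<le> 1 \<longrightarrow>
     \<bar>smooth P (\<lambda>i. x i + u i) - smooth P x - (\<Sum>j\<in>A. u j * smooth (Q j) x)\<bar> \<le> K0 * (l1 A u)\<^sup>2"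
proof -
  define K0 where "K0 = (\<integral>z. (C * exp (k * l1 A x) * L) * exp ((k + \<mu>) * l1 A z) \<partial>Gauss A)"
  have int: "integrable (Gauss A) (\<lambda>z. (C * exp (k * l1 A x) * L) * exp ((k + \<mu>) * l1 A z))"
    using integrable_Gauss_exp_abs[OF fin, of "k + \<mu>"] by (simp add: l1_def)
  show ?thesis
  proof (intro exI[of _ K0] conjI allI impI)
    show "0 \<le> K0" unfolding K0_def using C_nonneg L by (intro integral_nonneg_AE) auto
    fix u assume u: "l1 A u \<le> 1"
    let ?\<psi> = "\<lambda>z. \<psi> (\<lambda>i. z i + x i)"
    have Pu: "(\<lambda>z. P (\<lambda>i. z i - u i)) \<in> borel_measurable (Gauss A)"
    proof -
      have "(\<lambda>z. P (\<lambda>i\<in>A. z i - u i)) \<in> borel_measurable (Gauss A)" by measurable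
      also have "(\<lambda>z. P (\<lambda>i\<in>A. z i - u i)) = (\<lambda>z. P (\<lambda>i. z i - u i))"
        by (intro ext) (rule Ploc)
      finally show ?thesis .
    qed
    note [measurable] = Pu
    let ?f = "\<lambda>z. ?\<psi> z * P (\<lambda>i. z i - u i)"
    have fu: "?f (\<lambda>i\<in>A. z i + u i) = \<psi> (\<lambda>i. z i + (x i + u i)) * P z" for z
    proof -
      have "\<psi> (\<lambda>i. (\<lambda>i\<in>A. z i + u i) i + x i) = \<psi> (\<lambda>i. z i + (x i + u i))"
        by (intro psi_cong) auto
      moreover have "P (\<lambda>i. (\<lambda>i\<in>A. z i + u i) i - u i) = P z"
        by (subst (1 2) Ploc [symmetric]) (auto intro!: arg_cong[where f=P])
      ultimately show ?thesis by simp
    qed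
    have i1: "integrable (Gauss A) (\<lambda>z. \<psi> (\<lambda>i. z i + (x i + u i)) * P z)"
      by (rule integrable_smooth[OF P PK])
    have i2: "integrable (Gauss A) (\<lambda>z. gauss_density A u z * ?f z)"
      using Gauss_integral_shift(2)[OF fin, of ?f u] i1 fu by simp
    have i3: "integrable (Gauss A) (\<lambda>z. ?\<psi> z * P z)"
      by (rule integrable_smooth[OF P PK])
    have i4: "integrable (Gauss A) (\<lambda>z. ?\<psi> z * Q j z)" if "j \<in> A" for j
      by (rule integrable_smooth[OF Q[OF that] QK[OF that]])
    have "smooth P (\<lambda>i. x i + u i) = (\<integral>z. ?f (\<lambda>i\<in>A. z i + u i) \<partial>Gauss A)"
      unfolding smooth_def by (rule Bochner_Integration.integral_cong[OF refl]) (rule fu[symmetric])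
    also have "\<dots> = (\<integral>z. gauss_density A u z * ?f z \<partial>Gauss A)"
      by (rule Gauss_integral_shift(1)[OF fin]) measurable
    finally have s1: "smooth P (\<lambda>i. x i + u i) = (\<integral>z. gauss_density A u z * ?f z \<partial>Gauss A)" .
    have s2: "(\<Sum>j\<in>A. u j * smooth (Q j) x) = (\<integral>z. (\<Sum>j\<in>A. u j * (?\<psi> z * Q j z)) \<partial>Gauss A)"
      using i4 by (simp add: smooth_def)
    have "smooth P (\<lambda>i. x i + u i) - smooth P x - (\<Sum>j\<in>A. u j * smooth (Q j) x)
      = (\<integral>z. gauss_density A u z * ?f z - ?\<psi> z * P z - (\<Sum>j\<in>A. u j * (?\<psi> z * Q j z)) \<partial>Gauss A)"
      unfolding s1 s2 using i2 i3 i4 by (simp add: smooth_def)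
    also have "\<dots> = (\<integral>z. ?\<psi> z * (P (\<lambda>i. z i - u i) * gauss_density A u z - P z - (\<Sum>j\<in>A. u j * Q j z)) \<partial>Gauss A)"
      by (intro Bochner_Integration.integral_cong refl) (simp add: algebra_simps sum_distrib_left)
    finally have eq: "smooth P (\<lambda>i. x i + u i) - smooth P x - (\<Sum>j\<in>A. u j * smooth (Q j) x) = \<dots>" .
    have "\<bar>smooth P (\<lambda>i. x i + u i) - smooth P x - (\<Sum>j\<in>A. u j * smooth (Q j) x)\<bar>
      \<le> (\<integral>z. (l1 A u)\<^sup>2 * ((C * exp (k * l1 A x) * L) * exp ((k + \<mu>) * l1 A z)) \<partial>Gauss A)"
      unfolding eq
    proof (rule abs_integral_le)
      have b: "\<bar>?\<psi> z * (P (\<lambda>i. z i - u i) * gauss_density A u z - P z - (\<Sum>j\<in>A. u j * Q j z))\<bar>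
        \<le> (l1 A u)\<^sup>2 * ((C * exp (k * l1 A x) * L) * exp ((k + \<mu>) * l1 A z))" for z
      proof -
        have "\<bar>P (\<lambda>i. z i - u i) * gauss_density A u z - P z - (\<Sum>j\<in>A. u j * Q j z)\<bar>
          \<le> ((l1 A u)\<^sup>2 * L) * exp (\<mu> * l1 A z)" using rem[OF u] by (simp add: mult_ac)
        from product_bound[OF this, of x] show ?thesis by (simp add: mult_ac)
      qed
      then show "\<And>z. \<bar>?\<psi> z * (P (\<lambda>i. z i - u i) * gauss_density A u z - P z - (\<Sum>j\<in>A. u j * Q j z))\<bar>
        \<le> (l1 A u)\<^sup>2 * ((C * exp (k * l1 A x) * L) * exp ((k + \<mu>) * l1 A z))" by blast
      show "integrable (Gauss A) (\<lambda>z. (l1 A u)\<^sup>2 * ((C * exp (k * l1 A x) * L) * exp ((k + \<mu>) * l1 A z)))"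
        by (rule integrable_mult_right[OF int])
      have "integrable (Gauss A) (\<lambda>z. gauss_density A u z * ?f z - ?\<psi> z * P z - (\<Sum>j\<in>A. u j * (?\<psi> z * Q j z)))"
        by (rule Bochner_Integration.integrable_diff[OF Bochner_Integration.integrable_diff[OF i2 i3]
              Bochner_Integration.integrable_sum[OF integrable_mult_right[OF i4]]])
      moreover have "(\<lambda>z. gauss_density A u z * ?f z - ?\<psi> z * P z - (\<Sum>j\<in>A. u j * (?\<psi> z * Q j z)))
        = (\<lambda>z. ?\<psi> z * (P (\<lambda>i. z i - u i) * gauss_density A u z - P z - (\<Sum>j\<in>A. u j * Q j z)))"
        by (intro ext) (simp add: algebra_simps sum_distrib_left)
      ultimately show "integrable (Gauss A) (\<lambda>z. ?\<psi> z * (P (\<lambda>i. z i - u i) * gauss_density A u z - P z - (\<Sum>j\<in>A. u j * Q j z)))"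
        by (simp only:)
    qed
    also have "\<dots> = K0 * (l1 A u)\<^sup>2" by (simp add: K0_def)
    finally show "\<bar>smooth P (\<lambda>i. x i + u i) - smooth P x - (\<Sum>j\<in>A. u j * smooth (Q j) x)\<bar> \<le> K0 * (l1 A u)\<^sup>2" .
  qed
qed

definition grad :: "'i \<Rightarrow> ('i \<Rightarrow> real) \<Rightarrow> real" where
  "grad i = smooth (\<lambda>z. z i)"

definition hess :: "'i \<Rightarrow> 'i \<Rightarrow> ('i \<Rightarrow> real) \<Rightarrow> real" where
  "hess i j = smooth (\<lambda>z. z i * z j - kron i j)"

lemma abs_le_exp_l1: "i \<in> A \<Longrightarrow> \<bar>z i\<bar> \<le> 1 * exp (1 * l1 A z)"
  using l1_component[OF fin, of i z] exp_ge_add_one_self[of "l1 A z"]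
  by (simp del: exp_ge_add_one_self)

lemma hermite2_le_exp_l1:
  assumes "i \<in> A" "j \<in> A"
  shows "\<bar>z i * z j - kron i j\<bar> \<le> 2 * exp (2 * l1 A z)"
proof -
  have "\<bar>z i * z j\<bar> \<le> exp (l1 A z) * exp (l1 A z)"
    unfolding abs_mult using abs_le_exp_l1[of _ z] assms by (intro mult_mono) auto
  also have "\<dots> = exp (2 * l1 A z)" by (simp add: mult_exp_exp)
  finally have "\<bar>z i * z j\<bar> \<le> exp (2 * l1 A z)" .
  moreover have "\<bar>kron i j\<bar> \<le> 1" by (simp add: kron_def)
  moreover have "1 \<le> exp (2 * l1 A z)" by simp
  ultimately show ?thesis by linarith
qed

lemma smooth_one_expansion:
  "\<exists>K0\<ge>0. \<forall>u. l1 A u \<le> 1 \<longrightarrow>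
     \<bar>smooth (\<lambda>_. 1) (\<lambda>i. x i + u i) - smooth (\<lambda>_. 1) x - (\<Sum>j\<in>A. u j * grad j x)\<bar> \<le> K0 * (l1 A u)\<^sup>2"
  unfolding grad_def
proof (rule smooth_expansion[where K = 1 and \<kappa> = 0 and K' = 1 and \<kappa>' = 1 and L = "2 * exp 3" and \<mu> = 3])
  show "\<And>j z. j \<in> A \<Longrightarrow> \<bar>z j\<bar> \<le> 1 * exp (1 * l1 A z)" by (rule abs_le_exp_l1)
  fix u z assume "l1 A u \<le> 1"
  from gauss_density_taylor(2)[OF fin this, of z]
  show "\<bar>1 * gauss_density A u z - 1 - (\<Sum>j\<in>A. u j * z j)\<bar> \<le> (l1 A u)\<^sup>2 * (2 * exp 3 * exp (3 * l1 A z))"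
    by (simp add: algebra_simps exp_add)
qed auto

lemma grad_expansion:
  assumes i: "i \<in> A"
  shows "\<exists>K0\<ge>0. \<forall>u. l1 A u \<le> 1 \<longrightarrow>
     \<bar>grad i (\<lambda>i. x i + u i) - grad i x - (\<Sum>j\<in>A. u j * hess i j x)\<bar> \<le> K0 * (l1 A u)\<^sup>2"
  unfolding grad_def hess_def
proof (rule smooth_expansion[where K = 1 and \<kappa> = 1 and K' = 2 and \<kappa>' = 2 and L = "3 * exp 4" and \<mu> = 4])
  show "\<And>z. \<bar>z i\<bar> \<le> 1 * exp (1 * l1 A z)" by (rule abs_le_exp_l1[OF i])
  show "\<And>j z. j \<in> A \<Longrightarrow> \<bar>z i * z j - kron i j\<bar> \<le> 2 * exp (2 * l1 A z)"
    by (rule hermite2_le_exp_l1[OF i])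
  fix u z assume "l1 A u \<le> 1"
  from gauss_density_taylor_component[OF fin this i, of z]
  show "\<bar>(z i - u i) * gauss_density A u z - z i - (\<Sum>j\<in>A. u j * (z i * z j - kron i j))\<bar>
     \<le> (l1 A u)\<^sup>2 * (3 * exp 4 * exp (4 * l1 A z))"
    by (simp add: algebra_simps exp_add)
qed (use i in auto)

lemma eq_zero_if_quadratic_bound:
  assumes b: "\<And>t::real. 0 < t \<Longrightarrow> t \<le> \<delta> \<Longrightarrow> \<bar>t * a\<bar> \<le> K * t\<^sup>2" and \<delta>: "0 < \<delta>"
  shows "a = 0"
proof (rule ccontr)
  assume a: "a \<noteq> 0"
  define t where "t = min \<delta> (\<bar>a\<bar> / (2 * (\<bar>K\<bar> + 1)))"
  have t: "0 < t" "t \<le> \<delta>" using \<delta> a by (auto simp: t_def)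
  have "t * \<bar>a\<bar> \<le> K * t\<^sup>2" using b[OF t] t by (simp add: abs_mult)
  then have "\<bar>a\<bar> \<le> K * t" using t by (simp add: power2_eq_square mult_ac)
  also have "\<dots> \<le> (\<bar>K\<bar> + 1) * t" using t by (intro mult_right_mono) auto
  also have "\<dots> \<le> (\<bar>K\<bar> + 1) * (\<bar>a\<bar> / (2 * (\<bar>K\<bar> + 1)))" by (intro mult_left_mono) (auto simp: t_def)
  also have "\<dots> = \<bar>a\<bar> / 2" by (simp add: field_simps)
  finally show False using a by simp
qed

text \<open>
  A first-order expansion with quadratic remainder determines the derivative along a line from the
  values on that line.
\<close>

lemma linear_coeff_unique:
  assumes 1: "\<exists>K0\<ge>0. \<forall>u. l1 A u \<le> 1 \<longrightarrow> \<bar>F (\<lambda>i. x i + u i) - F x - (\<Sum>j\<in>A. u j * D j)\<bar> \<le> K0 * (l1 A u)\<^sup>2"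
    and 2: "\<exists>K0\<ge>0. \<forall>u. l1 A u \<le> 1 \<longrightarrow> \<bar>F' (\<lambda>i. x i + u i) - F' x - (\<Sum>j\<in>A. u j * D' j)\<bar> \<le> K0 * (l1 A u)\<^sup>2"
    and eq: "\<And>t. F (\<lambda>i. x i + t * e i) = F' (\<lambda>i. x i + t * w i)"
  shows "(\<Sum>j\<in>A. e j * D j) = (\<Sum>j\<in>A. w j * D' j)"
proof -
  from 1 obtain K1 where K1: "K1 \<ge> 0"
    "\<And>u. l1 A u \<le> 1 \<Longrightarrow> \<bar>F (\<lambda>i. x i + u i) - F x - (\<Sum>j\<in>A. u j * D j)\<bar> \<le> K1 * (l1 A u)\<^sup>2" by blast
  from 2 obtain K2 where K2: "K2 \<ge> 0"
    "\<And>u. l1 A u \<le> 1 \<Longrightarrow> \<bar>F' (\<lambda>i. x i + u i) - F' x - (\<Sum>j\<in>A. u j * D' j)\<bar> \<le> K2 * (l1 A u)\<^sup>2" by blast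
  define \<delta> where "\<delta> = 1 / (1 + l1 A e + l1 A w)"
  have pos: "0 < 1 + l1 A e + l1 A w" using l1_nonneg[of A e] l1_nonneg[of A w] by linarith
  have "(\<Sum>j\<in>A. e j * D j) - (\<Sum>j\<in>A. w j * D' j) = 0"
  proof (rule eq_zero_if_quadratic_bound)
    show "0 < \<delta>" using pos by (simp add: \<delta>_def)
    fix t :: real assume t: "0 < t" "t \<le> \<delta>"
    have t': "t * (1 + l1 A e + l1 A w) \<le> 1" using t(2) pos by (simp add: \<delta>_def field_simps)
    have le: "l1 A (\<lambda>i. t * e i) \<le> 1" "l1 A (\<lambda>i. t * w i) \<le> 1"
    proof -
      have "0 \<le> t * l1 A e" "0 \<le> t * l1 A w" using t(1) by auto
      moreover have "t + t * l1 A e + t * l1 A w \<le> 1" using t' by (simp add: algebra_simps)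
      ultimately have "t * l1 A e \<le> 1" "t * l1 A w \<le> 1" using t(1) by linarith+
      then show "l1 A (\<lambda>i. t * e i) \<le> 1" "l1 A (\<lambda>i. t * w i) \<le> 1" using t(1) by (simp_all add: l1_scale)
    qed
    have "F x = F' x" using eq[of 0] by simp
    then have "\<bar>t * ((\<Sum>j\<in>A. e j * D j) - (\<Sum>j\<in>A. w j * D' j))\<bar>
       \<le> K1 * (l1 A (\<lambda>i. t * e i))\<^sup>2 + K2 * (l1 A (\<lambda>i. t * w i))\<^sup>2"
      using K1(2)[OF le(1)] K2(2)[OF le(2)] eq[of t]
      by (simp add: mult.assoc sum_distrib_left[symmetric] right_diff_distrib)
    also have "\<dots> = (K1 * (l1 A e)\<^sup>2 + K2 * (l1 A w)\<^sup>2) * t\<^sup>2"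
      by (simp add: l1_scale power_mult_distrib algebra_simps)
    finally show "\<bar>t * ((\<Sum>j\<in>A. e j * D j) - (\<Sum>j\<in>A. w j * D' j))\<bar>
       \<le> (K1 * (l1 A e)\<^sup>2 + K2 * (l1 A w)\<^sup>2) * t\<^sup>2" .
  qed
  then show ?thesis by simp
qed

text \<open>
  If \<open>\<psi>\<close> has the same values along \<open>e\<close> and \<open>w\<close>, so has every function \<open>smooth P\<close>. Differentiating
  once gives equality of the first derivatives along \<open>e\<close> and \<open>w\<close> at every point, and
  differentiating that equality again gives the claim.
\<close>

lemma hess_exchange:
  assumes inv: "\<And>z t. \<psi> (\<lambda>i. z i + t * e i) = \<psi> (\<lambda>i. z i + t * w i)"
  shows "(\<Sum>i\<in>A. \<Sum>j\<in>A. e i * e j * hess i j x) = (\<Sum>i\<in>A. \<Sum>j\<in>A. w i * w j * hess i j x)"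
proof -
  have sm: "smooth P (\<lambda>i. y i + t * e i) = smooth P (\<lambda>i. y i + t * w i)" for P y t
    unfolding smooth_def using inv[of "\<lambda>i. _ i + y i" t]
    by (intro Bochner_Integration.integral_cong refl arg_cong2[where f="(*)"]) (simp add: add.assoc)
  have g1: "(\<Sum>i\<in>A. e i * grad i y) = (\<Sum>i\<in>A. w i * grad i y)" for y
    using smooth_one_expansion[of y] smooth_one_expansion[of y] sm by (rule linear_coeff_unique)
  have exp2: "\<exists>K0\<ge>0. \<forall>u. l1 A u \<le> 1 \<longrightarrow>
     \<bar>(\<Sum>i\<in>A. v i * grad i (\<lambda>i. x i + u i)) - (\<Sum>i\<in>A. v i * grad i x) -
        (\<Sum>j\<in>A. u j * (\<Sum>i\<in>A. v i * hess i j x))\<bar> \<le> K0 * (l1 A u)\<^sup>2" for v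
  proof -
    from grad_expansion[of _ x] obtain K where
      K: "\<And>i. i \<in> A \<Longrightarrow> 0 \<le> K i" "\<And>i u. i \<in> A \<Longrightarrow> l1 A u \<le> 1 \<Longrightarrow>
      \<bar>grad i (\<lambda>i. x i + u i) - grad i x - (\<Sum>j\<in>A. u j * hess i j x)\<bar> \<le> K i * (l1 A u)\<^sup>2" by metis
    show ?thesis
    proof (intro exI[of _ "\<Sum>i\<in>A. \<bar>v i\<bar> * K i"] conjI allI impI)
      show "0 \<le> (\<Sum>i\<in>A. \<bar>v i\<bar> * K i)" using K(1) by (intro sum_nonneg) auto
      fix u assume u: "l1 A u \<le> 1"
      have "(\<Sum>j\<in>A. u j * (\<Sum>i\<in>A. v i * hess i j x)) = (\<Sum>i\<in>A. v i * (\<Sum>j\<in>A. u j * hess i j x))"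
        unfolding sum_distrib_left by (subst sum.swap) (simp add: mult_ac)
      then have eq: "(\<Sum>i\<in>A. v i * grad i (\<lambda>i. x i + u i)) - (\<Sum>i\<in>A. v i * grad i x) -
        (\<Sum>j\<in>A. u j * (\<Sum>i\<in>A. v i * hess i j x))
        = (\<Sum>i\<in>A. v i * (grad i (\<lambda>i. x i + u i) - grad i x - (\<Sum>j\<in>A. u j * hess i j x)))"
        by (simp add: right_diff_distrib sum_subtractf)
      have "\<bar>(\<Sum>i\<in>A. v i * grad i (\<lambda>i. x i + u i)) - (\<Sum>i\<in>A. v i * grad i x) -
        (\<Sum>j\<in>A. u j * (\<Sum>i\<in>A. v i * hess i j x))\<bar> \<le> (\<Sum>i\<in>A. \<bar>v i\<bar> * (K i * (l1 A u)\<^sup>2))"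
        unfolding eq using K(2)[OF _ u] by (intro order.trans[OF sum_abs] sum_mono) (auto simp: abs_mult intro: mult_left_mono)
      then show "\<bar>(\<Sum>i\<in>A. v i * grad i (\<lambda>i. x i + u i)) - (\<Sum>i\<in>A. v i * grad i x) -
        (\<Sum>j\<in>A. u j * (\<Sum>i\<in>A. v i * hess i j x))\<bar> \<le> (\<Sum>i\<in>A. \<bar>v i\<bar> * K i) * (l1 A u)\<^sup>2"
        by (simp add: sum_distrib_right mult.assoc)
    qed
  qed
  have "(\<Sum>j\<in>A. e j * (\<Sum>i\<in>A. e i * hess i j x)) = (\<Sum>j\<in>A. w j * (\<Sum>i\<in>A. w i * hess i j x))"
  proof (rule linear_coeff_unique[OF exp2[of e] exp2[of w]])
    show "(\<Sum>i\<in>A. e i * grad i (\<lambda>i. x i + t * e i)) = (\<Sum>i\<in>A. w i * grad i (\<lambda>i. x i + t * w i))" for t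
    proof -
      have "grad i (\<lambda>i. x i + t * e i) = grad i (\<lambda>i. x i + t * w i)" for i
        unfolding grad_def by (rule sm)
      then show ?thesis using g1[of "\<lambda>i. x i + t * w i"] by simp
    qed
  qed
  moreover have "(\<Sum>j\<in>A. v j * (\<Sum>i\<in>A. v i * hess i j x)) = (\<Sum>i\<in>A. \<Sum>j\<in>A. v i * v j * hess i j x)" for v
    unfolding sum_distrib_left by (subst sum.swap) (simp add: mult_ac)
  ultimately show ?thesis by simp
qed

end

text \<open>
  For \<open>\<psi> = 1\<close> the smoothed function is constant, so its second derivative vanishes; that second
  derivative is the expectation in question.
\<close>

lemma Gauss_covariance:
  assumes A: "finite A" and i: "i \<in> A" and j: "j \<in> A"
  shows "(\<integral>z. z i * z j - kron i j \<partial>Gauss A) = 0"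
proof -
  interpret exp_growth A "\<lambda>_. 1" 1 0 by unfold_locales (use A in auto)
  have "(\<Sum>l\<in>A. kron j l * hess i l (\<lambda>_. 0)) = (\<Sum>l\<in>A. 0 * hess i l (\<lambda>_. 0))"
    by (rule linear_coeff_unique[OF grad_expansion[OF i] grad_expansion[OF i]])
       (simp add: grad_def smooth_def)
  then show ?thesis
    using A j by (simp add: kron_def hess_def smooth_def if_distrib[of "\<lambda>x. x * _"] cong: if_cong)
qed

text \<open>
  The form is \<open>\<langle>w, z\<rangle>\<^sup>2 - \<parallel>w\<parallel>\<^sup>2\<close>. It has mean zero and is bounded below by \<open>- \<parallel>w\<parallel>\<^sup>2\<close>, hence
  its absolute value is at most the form itself plus \<open>2 \<parallel>w\<parallel>\<^sup>2\<close>.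
\<close>

lemma Gauss_quadratic_form_le:
  assumes A: "finite A"
  shows "integrable (Gauss A) (\<lambda>z. \<Sum>i\<in>A. \<Sum>j\<in>A. w i * w j * (z i * z j - kron i j))"
    and "(\<integral>z. \<bar>\<Sum>i\<in>A. \<Sum>j\<in>A. w i * w j * (z i * z j - kron i j)\<bar> \<partial>Gauss A) \<le> 2 * (\<Sum>i\<in>A. (w i)\<^sup>2)"
proof -
  interpret exp_growth A "\<lambda>_. 1" 1 0 by unfold_locales (use A in auto)
  interpret prob_space "Gauss A" by (rule prob_space_Gauss)
  define q where "q z = (\<Sum>i\<in>A. \<Sum>j\<in>A. w i * w j * (z i * z j - kron i j))" for z
  have ij: "integrable (Gauss A) (\<lambda>z. z i * z j - kron i j)" if "i \<in> A" "j \<in> A" for i j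
    using that by (intro integrable_exp_bound[OF _ hermite2_le_exp_l1]) auto
  have int: "integrable (Gauss A) q"
    unfolding q_def using ij by (intro Bochner_Integration.integrable_sum integrable_mult_right)
  then show "integrable (Gauss A) (\<lambda>z. \<Sum>i\<in>A. \<Sum>j\<in>A. w i * w j * (z i * z j - kron i j))"
    by (simp add: q_def[abs_def])
  have 0: "(\<integral>z. q z \<partial>Gauss A) = 0"
    unfolding q_def using ij Gauss_covariance[OF A] by simp
  have k: "(\<Sum>i\<in>A. \<Sum>j\<in>A. w i * w j * kron i j) = (\<Sum>i\<in>A. (w i)\<^sup>2)"
    using A by (simp add: kron_def if_distrib[of "\<lambda>x. _ * x"] power2_eq_square cong: if_cong)
  have "\<bar>q z\<bar> \<le> q z + 2 * (\<Sum>i\<in>A. (w i)\<^sup>2)" for z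
  proof -
    have "q z = (\<Sum>i\<in>A. \<Sum>j\<in>A. (w i * z i) * (w j * z j)) - (\<Sum>i\<in>A. (w i)\<^sup>2)"
      unfolding q_def k[symmetric] by (simp add: right_diff_distrib sum_subtractf mult_ac)
    also have "(\<Sum>i\<in>A. \<Sum>j\<in>A. (w i * z i) * (w j * z j)) = (\<Sum>i\<in>A. w i * z i)\<^sup>2"
      by (simp add: power2_eq_square sum_product)
    finally have "q z + (\<Sum>i\<in>A. (w i)\<^sup>2) \<ge> 0" by simp
    moreover have "0 \<le> (\<Sum>i\<in>A. (w i)\<^sup>2)" by (intro sum_nonneg) auto
    ultimately show ?thesis by linarith
  qed
  then have "(\<integral>z. \<bar>q z\<bar> \<partial>Gauss A) \<le> (\<integral>z. q z + 2 * (\<Sum>i\<in>A. (w i)\<^sup>2) \<partial>Gauss A)"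
    using int by (intro integral_mono) auto
  also have "\<dots> = 2 * (\<Sum>i\<in>A. (w i)\<^sup>2)" using int 0 by (simp add: prob_space)
  finally show "(\<integral>z. \<bar>\<Sum>i\<in>A. \<Sum>j\<in>A. w i * w j * (z i * z j - kron i j)\<bar> \<partial>Gauss A) \<le> 2 * (\<Sum>i\<in>A. (w i)\<^sup>2)"
    by (simp add: q_def)
qed

context exp_growth begin

text \<open>
  The second derivative along \<open>e\<close> is computed along \<open>w\<close> instead. Its increment is the expectation of
  the increment of \<open>\<psi>\<close> times the quadratic form of \<open>w\<close>.
\<close>

lemma hess_increment_le:
  assumes inv: "\<And>z t. \<psi> (\<lambda>i. z i + t * e i) = \<psi> (\<lambda>i. z i + t * w i)"
    and lip: "\<And>z. \<bar>\<psi> (\<lambda>i. z i + y i) - \<psi> z\<bar> \<le> b"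
  shows "\<bar>(\<Sum>i\<in>A. \<Sum>j\<in>A. e i * e j * hess i j (\<lambda>i. x i + y i)) -
          (\<Sum>i\<in>A. \<Sum>j\<in>A. e i * e j * hess i j x)\<bar> \<le> b * (2 * (\<Sum>i\<in>A. (w i)\<^sup>2))"
proof -
  define q where "q z = (\<Sum>i\<in>A. \<Sum>j\<in>A. w i * w j * (z i * z j - kron i j))" for z
  have b: "0 \<le> b" using lip[of "\<lambda>_. 0"] by linarith
  have [measurable]: "q \<in> borel_measurable (Gauss A)" unfolding q_def by measurable
  have i: "integrable (Gauss A) (\<lambda>z. \<psi> (\<lambda>i. z i + x i) * (z i * z j - kron i j))" if "i \<in> A" "j \<in> A" for x i j
    using that by (intro integrable_smooth[OF _ hermite2_le_exp_l1]) auto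
  have eq: "(\<lambda>z. \<psi> (\<lambda>i. z i + x i) * q z) =
     (\<lambda>z. \<Sum>i\<in>A. \<Sum>j\<in>A. (w i * w j) * (\<psi> (\<lambda>i. z i + x i) * (z i * z j - kron i j)))" for x
    by (intro ext) (simp add: q_def sum_distrib_left mult_ac)
  have iq: "integrable (Gauss A) (\<lambda>z. \<psi> (\<lambda>i. z i + x i) * q z)" for x
    unfolding eq using i by (intro Bochner_Integration.integrable_sum integrable_mult_right)
  have h: "(\<Sum>i\<in>A. \<Sum>j\<in>A. e i * e j * hess i j x) = (\<integral>z. \<psi> (\<lambda>i. z i + x i) * q z \<partial>Gauss A)" for x
    unfolding hess_exchange[OF inv] unfolding hess_def smooth_def eq
    using i by (simp add: Bochner_Integration.integral_sum)
  have eq2: "(\<Sum>i\<in>A. \<Sum>j\<in>A. e i * e j * hess i j (\<lambda>i. x i + y i)) -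
          (\<Sum>i\<in>A. \<Sum>j\<in>A. e i * e j * hess i j x)
     = (\<integral>z. \<psi> (\<lambda>i. z i + (x i + y i)) * q z - \<psi> (\<lambda>i. z i + x i) * q z \<partial>Gauss A)"
    unfolding h using iq by simp
  have le: "\<bar>(\<Sum>i\<in>A. \<Sum>j\<in>A. e i * e j * hess i j (\<lambda>i. x i + y i)) -
          (\<Sum>i\<in>A. \<Sum>j\<in>A. e i * e j * hess i j x)\<bar> \<le> (\<integral>z. b * \<bar>q z\<bar> \<partial>Gauss A)"
    unfolding eq2
  proof (rule abs_integral_le)
    show "integrable (Gauss A) (\<lambda>z. \<psi> (\<lambda>i. z i + (x i + y i)) * q z - \<psi> (\<lambda>i. z i + x i) * q z)"
      using iq by simp
    show "integrable (Gauss A) (\<lambda>z. b * \<bar>q z\<bar>)"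
      using Gauss_quadratic_form_le(1)[OF fin, of w] by (simp add: q_def)
    show "\<bar>\<psi> (\<lambda>i. z i + (x i + y i)) * q z - \<psi> (\<lambda>i. z i + x i) * q z\<bar> \<le> b * \<bar>q z\<bar>" for z
    proof -
      have "\<bar>(\<psi> (\<lambda>i. (z i + x i) + y i) - \<psi> (\<lambda>i. z i + x i)) * q z\<bar> \<le> b * \<bar>q z\<bar>"
        unfolding abs_mult by (rule mult_right_mono[OF lip]) simp
      then show ?thesis by (simp only: left_diff_distrib add.assoc)
    qed
  qed
  have "(\<integral>z. \<bar>q z\<bar> \<partial>Gauss A) \<le> 2 * (\<Sum>i\<in>A. (w i)\<^sup>2)"
    using Gauss_quadratic_form_le(2)[OF fin, of w] by (simp add: q_def)
  from mult_left_mono[OF this b] show ?thesis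
    using le unfolding integral_mult_right_zero by (rule order.trans[rotated])
qed

end

section \<open>The law of the increments of Brownian motion\<close>

context brownian_motion begin

definition coord :: "nat \<Rightarrow> 'd \<times> nat \<Rightarrow> 'a \<Rightarrow> real" where
  "coord m a \<omega> = sqrt (real m) *
     (B ((real (snd a) + 1) / real m) \<omega> $ fst a - B (real (snd a) / real m) \<omega> $ fst a)"

lemma coord_measurable [measurable]: "coord m a \<in> borel_measurable M"
proof -
  have [measurable]: "B ((real (snd a) + 1) / real m) \<in> borel_measurable M"
     "B (real (snd a) / real m) \<in> borel_measurable M" by (intro B_measurable; simp)+
  have [measurable]: "(\<lambda>x::real^'d. x $ i) \<in> borel_measurable borel" for i
    by (intro borel_measurable_continuous_onI continuous_intros)
  show ?thesis unfolding coord_def by measurable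
qed

lemma distributed_coord:
  assumes m: "0 < m"
  shows "distr M std_gauss (coord m a) = std_gauss"
proof -
  let ?s = "real (snd a) / real m" and ?t = "(real (snd a) + 1) / real m"
  have st: "0 \<le> ?s" "?s < ?t" and d: "?t - ?s = 1 / real m"
    using m by (auto simp: divide_strict_right_mono add_divide_distrib)
  have "distributed M lborel (\<lambda>\<omega>. 0 + sqrt (real m) * ((B ?t \<omega> - B ?s \<omega>) $ fst a))
     (normal_density (0 + sqrt (real m) * 0) (\<bar>sqrt (real m)\<bar> * sqrt (?t - ?s)))"
    using m st by (intro normal_density_affine B_normal) auto
  moreover have "(\<lambda>\<omega>. 0 + sqrt (real m) * ((B ?t \<omega> - B ?s \<omega>) $ fst a)) = coord m a"
    by (simp add: coord_def fun_eq_iff)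
  moreover have "\<bar>sqrt (real m)\<bar> * sqrt (?t - ?s) = 1"
    unfolding d using m by (simp add: real_sqrt_mult[symmetric])
  ultimately have "distributed M lborel (coord m a) std_normal_density" by simp
  then have "distr M lborel (coord m a) = std_gauss"
    by (simp add: distributed_def std_gauss_def)
  then show ?thesis by (simp cong: distr_cong)
qed

text \<open>
  Increments over different intervals are independent as vectors, and the components of each of them
  are independent. Both kinds of independence are used on a measurable rectangle.
\<close>

lemma distr_coords:
  assumes m: "0 < m"
  shows "distr M (Gauss (Aset m)) (\<lambda>\<omega>. \<lambda>a\<in>Aset m. coord m a \<omega>) = Gauss (Aset m)"
proof (rule gauss.PiM_eqI)
  show fin: "finite (Aset m :: ('d \<times> nat) set)" by (simp add: Aset_def)
  fix S :: "'d \<times> nat \<Rightarrow> real set"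
  assume "\<And>a. a \<in> Aset m \<Longrightarrow> S a \<in> sets std_gauss"
  then have S: "\<And>a. a \<in> Aset m \<Longrightarrow> S a \<in> sets borel" by simp
  have S': "S (i, k) \<in> sets borel" if "k < m" for i k using S that by (simp add: Aset_def)
  let ?t = "\<lambda>k. real k / real m"
  let ?X = "\<lambda>k \<omega>. B (?t (Suc k)) \<omega> - B (?t k) \<omega>"
  let ?U = "\<lambda>i k. {x. sqrt (real m) * x \<in> S (i, k)}"
  let ?T = "\<lambda>k. {x::real^'d. \<forall>i. x $ i \<in> ?U i k}"
  have coord: "coord m (i, k) \<omega> = sqrt (real m) * (?X k \<omega> $ i)" for i k \<omega>
    by (simp add: coord_def add.commute)
  have U: "?U i k \<in> sets borel" if "k < m" for i k
    using measurable_sets[of "\<lambda>x. sqrt (real m) * x" borel borel "S (i, k)"] S'[OF that]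
    by (simp add: vimage_def)
  have T: "?T k \<in> sets borel" if "k < m" for k
  proof -
    have "?T k = (\<Inter>i. (\<lambda>x. x $ i) -` ?U i k)" by auto
    moreover have "(\<lambda>x::real^'d. x $ i) -` ?U i k \<in> sets borel" for i
      using measurable_sets[of "\<lambda>x::real^'d. x $ i" borel borel "?U i k"] U[OF that] by simp
    ultimately show ?thesis by (auto intro!: sets.finite_INT)
  qed
  have rvX: "random_variable borel (?X k)" for k
    by (intro borel_measurable_diff B_measurable) auto
  have ind1: "indep_vars (\<lambda>_. borel) ?X {..<m}"
    by (rule B_indep_increments) (auto simp: mono_def divide_right_mono)
  have ind2: "indep_vars (\<lambda>_. borel) (\<lambda>i \<omega>. ?X k \<omega> $ i) UNIV" for k
    using m by (intro B_indep_components) (auto simp: divide_strict_right_mono)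
  have [measurable]: "(\<lambda>\<omega>. \<lambda>a\<in>Aset m. coord m a \<omega>) \<in> measurable M (Gauss (Aset m))"
    by measurable
  have "(\<lambda>\<omega>. \<lambda>a\<in>Aset m. coord m a \<omega>) -` Pi\<^sub>E (Aset m) S \<inter> space M = (\<Inter>k\<in>{..<m}. ?X k -` ?T k \<inter> space M)"
    using m by (auto simp: PiE_iff Aset_def coord)
  then have "emeasure (distr M (Gauss (Aset m)) (\<lambda>\<omega>. \<lambda>a\<in>Aset m. coord m a \<omega>)) (Pi\<^sub>E (Aset m) S)
     = emeasure M (\<Inter>k\<in>{..<m}. ?X k -` ?T k \<inter> space M)"
    using S fin by (subst emeasure_distr) (auto intro!: sets_PiM_I_finite)
  also have "\<dots> = ennreal (prob (\<Inter>k\<in>{..<m}. ?X k -` ?T k \<inter> space M))"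
    by (simp add: emeasure_eq_measure)
  also have "prob (\<Inter>k\<in>{..<m}. ?X k -` ?T k \<inter> space M) = (\<Prod>k<m. prob (?X k -` ?T k \<inter> space M))"
    using m T by (intro indep_varsD_finite[OF ind1]) auto
  also have "\<dots> = (\<Prod>k<m. \<Prod>i\<in>UNIV. measure std_gauss (S (i, k)))"
  proof (intro prod.cong refl)
    fix k assume "k \<in> {..<m}"
    then have k: "k < m" by simp
    have "?X k -` ?T k \<inter> space M = (\<Inter>i\<in>UNIV. (\<lambda>\<omega>. ?X k \<omega> $ i) -` ?U i k \<inter> space M)" by auto
    then have "prob (?X k -` ?T k \<inter> space M) = (\<Prod>i\<in>UNIV. prob ((\<lambda>\<omega>. ?X k \<omega> $ i) -` ?U i k \<inter> space M))"
      using indep_varsD_finite[OF ind2[of k], of "\<lambda>i. ?U i k"] U[OF k] by simp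
    also have "\<dots> = (\<Prod>i\<in>UNIV. measure std_gauss (S (i, k)))"
    proof (intro prod.cong refl)
      fix i
      have "measure std_gauss (S (i, k)) = measure (distr M std_gauss (coord m (i, k))) (S (i, k))"
        by (simp add: distributed_coord[OF m])
      also have "\<dots> = prob (coord m (i, k) -` S (i, k) \<inter> space M)"
        using S'[OF k] by (subst measure_distr) auto
      also have "coord m (i, k) -` S (i, k) \<inter> space M = (\<lambda>\<omega>. ?X k \<omega> $ i) -` ?U i k \<inter> space M"
        by (auto simp: coord)
      finally show "prob ((\<lambda>\<omega>. ?X k \<omega> $ i) -` ?U i k \<inter> space M) = measure std_gauss (S (i, k))" by simp
    qed
    finally show "prob (?X k -` ?T k \<inter> space M) = (\<Prod>i\<in>UNIV. measure std_gauss (S (i, k)))" .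
  qed
  also have "\<dots> = (\<Prod>a\<in>Aset m. measure std_gauss (S a))"
    by (subst prod.swap) (simp add: Aset_def prod.cartesian_product case_prod_beta')
  also have "ennreal \<dots> = (\<Prod>a\<in>Aset m. emeasure std_gauss (S a))"
    using prob_space.finite_measure[OF prob_space_std_gauss]
    by (simp add: prod_ennreal finite_measure.emeasure_eq_measure)
  finally show "emeasure (distr M (Gauss (Aset m)) (\<lambda>\<omega>. \<lambda>a\<in>Aset m. coord m a \<omega>)) (Pi\<^sub>E (Aset m) S)
     = (\<Prod>a\<in>Aset m. emeasure std_gauss (S a))" .
qed simp

end

section \<open>Derivatives of absolutely continuous paths\<close>

text \<open>
  The sets over which \<open>g\<close> has integral zero form a Dynkin system, and the half-lines are stable under
  intersection and generate the Borel sets.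
\<close>

lemma set_integral_zero_all_borel:
  fixes g :: "real \<Rightarrow> 'b::{banach, second_countable_topology}"
  assumes int: "integrable lebesgue g"
    and zero: "\<And>t. (LINT x:{..t}|lebesgue. g x) = 0" and tot: "(LINT x|lebesgue. g x) = 0"
    and A: "A \<in> sets (borel :: real measure)"
  shows "(LINT x:A|lebesgue. g x) = 0"
proof -
  have sub: "set_integrable lebesgue A g" if "A \<in> sets borel" for A
    unfolding set_integrable_def using that by (intro integrable_mult_indicator int) auto
  have gen: "sets (borel :: real measure) = sigma_sets UNIV (range (\<lambda>a. {..a}))"
    by (subst borel_eq_atMost) (simp add: sets_measure_of)
  from A have mem: "A \<in> sigma_sets UNIV (range (\<lambda>a::real. {..a}))" by (simp only: gen)
  have stable: "Int_stable (range (\<lambda>a::real. {..a}))"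
  proof (rule Int_stableI)
    fix a b assume "a \<in> range (\<lambda>a::real. {..a})" "b \<in> range (\<lambda>a::real. {..a})"
    then obtain x y where "a = {..x}" "b = {..y}" by auto
    then have "a \<inter> b = {..min x y}" by auto
    then show "a \<inter> b \<in> range (\<lambda>a::real. {..a})" by blast
  qed
  show ?thesis
  proof (rule sigma_sets_induct_disjoint[OF stable _ mem])
    show "range (\<lambda>a::real. {..a}) \<subseteq> Pow UNIV" by simp
  next
    fix A assume "A \<in> range (\<lambda>a::real. {..a})" then show "(LINT x:A|lebesgue. g x) = 0" using zero by auto
  next
    fix A :: "real set" assume A: "A \<in> sigma_sets UNIV (range (\<lambda>a. {..a}))" and 0: "(LINT x:A|lebesgue. g x) = 0"
    have A': "A \<in> sets borel" using A by (simp only: gen)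
    have "(LINT x:A \<union> (UNIV - A)|lebesgue. g x) = (LINT x:A|lebesgue. g x) + (LINT x:UNIV - A|lebesgue. g x)"
      using A' by (intro set_integral_Un sub) auto
    moreover have "A \<union> (UNIV - A) = UNIV" by auto
    ultimately show "(LINT x:UNIV - A|lebesgue. g x) = 0"
      using 0 tot by (simp add: set_lebesgue_integral_def)
  next
    fix A :: "nat \<Rightarrow> real set" assume d: "disjoint_family A"
      and A: "range A \<subseteq> sigma_sets UNIV (range (\<lambda>a. {..a}))" and 0: "\<And>i. (LINT x:A i|lebesgue. g x) = 0"
    have A': "A i \<in> sets borel" for i using A by (auto simp only: gen)
    have "(LINT x:(\<Union>i. A i)|lebesgue. g x) = (\<Sum>i. (LINT x:A i|lebesgue. g x))"
      using A' d by (intro lebesgue_integral_countable_add sub)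
        (auto simp: disjoint_family_on_def)
    then show "(LINT x:(\<Union>i. A i)|lebesgue. g x) = 0" using 0 by simp
  qed (auto simp: set_lebesgue_integral_def)
qed

text \<open>
  A Lebesgue set differs from a Borel set by a null set, so Borel sets suffice.
\<close>

lemma AE_zero_if_integrals_zero:
  fixes f :: "real \<Rightarrow> 'b::{banach, second_countable_topology}"
  assumes int: "integrable leb01 f"
    and zero: "\<And>t. t \<in> {0..1} \<Longrightarrow> (LINT x|lebesgue_on {0..t}. f x) = 0"
  shows "AE x in leb01. f x = 0"
proof -
  define g where "g x = indicator {0..1} x *\<^sub>R f x" for x :: real
  have g: "integrable lebesgue g"
    using int unfolding g_def by (subst (asm) integrable_restrict_space) auto
  have on: "(LINT x|lebesgue_on {0..t}. f x) = (LINT x:{0..t}|lebesgue. f x)" for t :: real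
    unfolding set_lebesgue_integral_def by (rule integral_restrict_space) auto
  have z: "(LINT x:{..t}|lebesgue. g x) = 0" for t
  proof (cases "t < 0")
    case True
    then have "(\<lambda>x. indicator {..t} x *\<^sub>R g x) = (\<lambda>_. 0)" by (auto simp: g_def indicator_def)
    then show ?thesis by (simp only: set_lebesgue_integral_def integral_zero)
  next
    case False
    have "(\<lambda>x. indicator {..t} x *\<^sub>R g x) = (\<lambda>x. indicator {0..min t 1} x *\<^sub>R f x)"
      by (auto simp: g_def indicator_def)
    then have "(LINT x:{..t}|lebesgue. g x) = (LINT x:{0..min t 1}|lebesgue. f x)"
      by (simp only: set_lebesgue_integral_def)
    then show ?thesis using zero[of "min t 1"] False by (simp add: on)
  qed
  have tot: "(LINT x|lebesgue. g x) = 0"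
    using zero[of 1] unfolding on by (simp add: g_def set_lebesgue_integral_def)
  have fm: "finite_measure leb01" by (rule finite_measure_lebesgue_on) simp
  show ?thesis
  proof (rule sigma_finite_measure.density_zero[OF finite_measure.axioms(1)[OF fm] int])
    fix A :: "real set" assume "A \<in> sets leb01"
    then have A: "A \<in> sets lebesgue" by (auto simp: sets_restrict_space)
    then obtain S N N' where S: "A = S \<union> N" "N \<subseteq> N'" "N' \<in> null_sets lborel" "S \<in> sets lborel"
      by (rule sets_completionE)
    have "AE x in lborel. x \<notin> N'" using S(3) by (rule AE_not_in)
    then have "AE x in lebesgue. x \<notin> N'" by (rule AE_completion)
    then have "AE x in lebesgue. indicator A x *\<^sub>R g x = indicator S x *\<^sub>R g x"
      by eventually_elim (use S in \<open>auto simp: indicator_def\<close>)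
    moreover have "S \<in> sets lebesgue" using S(4) by auto
    ultimately have eq: "(LINT x:A|lebesgue. g x) = (LINT x:S|lebesgue. g x)"
      unfolding set_lebesgue_integral_def
      using borel_measurable_integrable[OF g] A
      by (intro integral_cong_AE) auto
    have "(LINT x:A|leb01. f x) = (LINT x|lebesgue. indicator {0..1} x *\<^sub>R (indicator A x *\<^sub>R f x))"
      unfolding set_lebesgue_integral_def by (rule integral_restrict_space) auto
    also have "\<dots> = (LINT x:A|lebesgue. g x)"
      unfolding set_lebesgue_integral_def g_def
      by (intro Bochner_Integration.integral_cong refl) (simp add: mult.commute)
    also have "\<dots> = 0"
      using set_integral_zero_all_borel[OF g z tot] S(4) by (simp add: eq)
    finally show "(LINT x:A|leb01. f x) = 0" .
  qed
qed

lemma integrable_sub_interval: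
  fixes g :: "real \<Rightarrow> 'b::euclidean_space"
  assumes "integrable leb01 g" "t \<in> {0..1}"
  shows "integrable (lebesgue_on {0..t}) g"
proof -
  have "set_integrable lebesgue {0..1} g"
    using assms(1) unfolding set_integrable_def by (subst (asm) integrable_restrict_space) auto
  then have "set_integrable lebesgue {0..t} g"
    by (rule set_integrable_subset) (use assms(2) in auto)
  then show ?thesis unfolding set_integrable_def by (subst integrable_restrict_space) auto
qed

lemma has_path_derivD:
  assumes "has_path_deriv f g"
  shows "integrable leb01 g"
    and "t \<in> {0..1} \<Longrightarrow> f t = f 0 + (LINT s|lebesgue_on {0..t}. g s)"
    and "t \<in> {0..1} \<Longrightarrow> integrable (lebesgue_on {0..t}) g"
  using assms integrable_sub_interval[of g t] unfolding has_path_deriv_def by blast+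

text \<open>
  The derivative chosen by \<open>path_deriv\<close> may therefore be replaced by any explicit one in
  integrals.
\<close>

lemma path_deriv_unique:
  assumes g: "has_path_deriv f g" and h: "has_path_deriv f h"
  shows "AE x in leb01. g x = h x"
proof -
  have "AE x in leb01. g x - h x = 0"
  proof (rule AE_zero_if_integrals_zero)
    show "integrable leb01 (\<lambda>x. g x - h x)" using g h by (intro Bochner_Integration.integrable_diff has_path_derivD(1))
    fix t :: real assume t: "t \<in> {0..1}"
    have i: "integrable (lebesgue_on {0..t}) g" "integrable (lebesgue_on {0..t}) h"
      using has_path_derivD(3)[OF g t] has_path_derivD(3)[OF h t] .
    have "f t = f 0 + (LINT s|lebesgue_on {0..t}. g s)" "f t = f 0 + (LINT s|lebesgue_on {0..t}. h s)"
      using g h t unfolding has_path_deriv_def by blast+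
    then have "(LINT s|lebesgue_on {0..t}. g s) = (LINT s|lebesgue_on {0..t}. h s)"
      by (metis add_left_cancel)
    then show "(LINT x|lebesgue_on {0..t}. g x - h x) = 0"
      by (simp add: Bochner_Integration.integral_diff[OF i])
  qed
  then show ?thesis by simp
qed

lemma path_deriv_AE:
  assumes "has_path_deriv f g"
  shows "AE x in leb01. path_deriv f x = g x" and "has_path_deriv f (path_deriv f)"
proof -
  show "has_path_deriv f (path_deriv f)" unfolding path_deriv_def by (rule someI[of _ g]) fact
  from path_deriv_unique[OF this assms] show "AE x in leb01. path_deriv f x = g x" .
qed

lemma ip_eq:
  assumes f: "has_path_deriv f g" and f': "has_path_deriv f' g'"
  shows "ip f f' = (LINT s|leb01. g s \<bullet> g' s)"
proof -
  have m: "has_path_deriv f g \<Longrightarrow> g \<in> borel_measurable leb01" for f g :: "'a path"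
    by (blast intro: borel_measurable_integrable has_path_derivD(1))
  note [measurable] = m[OF f] m[OF f'] m[OF path_deriv_AE(2)[OF f]] m[OF path_deriv_AE(2)[OF f']]
  show ?thesis unfolding ip_def
    using path_deriv_AE(1)[OF f] path_deriv_AE(1)[OF f']
    by (intro integral_cong_AE) (auto elim!: eventually_elim2)
qed

lemma has_path_deriv_zero: "has_path_deriv (\<lambda>_. 0) (\<lambda>_. 0)"
  by (simp add: has_path_deriv_def)

lemma has_path_deriv_add:
  assumes "has_path_deriv f g" "has_path_deriv f' g'"
  shows "has_path_deriv (\<lambda>t. f t + f' t) (\<lambda>t. g t + g' t)"
  unfolding has_path_deriv_def
proof (intro conjI ballI)
  show "integrable leb01 (\<lambda>t. g t + g' t)"
    using assms by (intro Bochner_Integration.integrable_add has_path_derivD(1))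
  fix t :: real assume t: "t \<in> {0..1}"
  have i: "integrable (lebesgue_on {0..t}) g" "integrable (lebesgue_on {0..t}) g'"
    using has_path_derivD(3)[OF assms(1) t] has_path_derivD(3)[OF assms(2) t] .
  have "f t = f 0 + (LINT s|lebesgue_on {0..t}. g s)" "f' t = f' 0 + (LINT s|lebesgue_on {0..t}. g' s)"
    using assms t unfolding has_path_deriv_def by blast+
  then have "f t + f' t = (f 0 + (LINT s|lebesgue_on {0..t}. g s)) + (f' 0 + (LINT s|lebesgue_on {0..t}. g' s))"
    by (rule arg_cong2)
  then show "f t + f' t = f 0 + f' 0 + (LINT s|lebesgue_on {0..t}. g s + g' s)"
    by (simp only: Bochner_Integration.integral_add[OF i] add_ac)
qed

lemma has_path_deriv_scaleR:
  assumes "has_path_deriv f g"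
  shows "has_path_deriv (\<lambda>t. c *\<^sub>R f t) (\<lambda>t. c *\<^sub>R g t)"
  unfolding has_path_deriv_def
proof (intro conjI ballI)
  show "integrable leb01 (\<lambda>t. c *\<^sub>R g t)"
    using has_path_derivD(1)[OF assms] by simp
  fix t :: real assume t: "t \<in> {0..1}"
  have "f t = f 0 + (LINT s|lebesgue_on {0..t}. g s)" using has_path_derivD(2)[OF assms t] .
  then have "c *\<^sub>R f t = c *\<^sub>R f 0 + c *\<^sub>R (LINT s|lebesgue_on {0..t}. g s)"
    by (simp only: scaleR_right_distrib)
  then show "c *\<^sub>R f t = c *\<^sub>R f 0 + (LINT s|lebesgue_on {0..t}. c *\<^sub>R g s)"
    by (simp only: integral_scaleR_right)
qed

lemma has_path_deriv_sum:
  assumes "finite A" "\<And>a. a \<in> A \<Longrightarrow> has_path_deriv (f a) (g a)"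
  shows "has_path_deriv (\<lambda>t. \<Sum>a\<in>A. f a t) (\<lambda>t. \<Sum>a\<in>A. g a t)"
  using assms by (induction A) (auto simp: has_path_deriv_zero intro: has_path_deriv_add)

section \<open>Piecewise affine paths and the projection\<close>

definition block :: "nat \<Rightarrow> nat \<Rightarrow> real set" where
  "block m k = {real k / real m ..< (real k + 1) / real m}"

definition hb_deriv :: "nat \<Rightarrow> 'd::finite \<times> nat \<Rightarrow> 'd path" where
  "hb_deriv m a s = (sqrt (real m) * indicat_real (block m (snd a)) s) *\<^sub>R axis (fst a) 1"

text \<open>
  The integral of the indicator of \<open>[\<alpha>, \<beta>)\<close> over \<open>[0, t]\<close>, when \<open>0 \<le> \<alpha> \<le> \<beta>\<close> and \<open>0 \<le> t\<close>.
\<close>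

definition ramp :: "real \<Rightarrow> real \<Rightarrow> real \<Rightarrow> real" where
  "ramp \<alpha> \<beta> t = max 0 (min t \<beta> - \<alpha>)"

lemma block_sets [measurable, simp]: "block m k \<in> sets borel" "block m k \<in> sets lebesgue"
  by (auto simp: block_def)

lemma finite_measure_interval: "finite_measure (lebesgue_on {0..t::real})"
  by (rule finite_measure_lebesgue_on) simp

lemma integrable_indicator_interval:
  fixes A :: "real set"
  assumes "A \<in> sets lebesgue"
  shows "integrable (lebesgue_on {0..t}) (indicat_real A)"
  by (rule finite_measure.integrable_const_bound[OF finite_measure_interval, where B=1])
     (use assms in \<open>simp_all add: measurable_restrict_space1\<close>)

lemma integral_indicator_Ico:
  assumes "0 \<le> \<alpha>" "\<alpha> \<le> \<beta>" "0 \<le> t"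
  shows "(LINT s|lebesgue_on {0..t}. indicat_real {\<alpha>..<\<beta>} s) = ramp \<alpha> \<beta> t"
proof -
  have "(LINT s|lebesgue_on {0..t}. indicat_real {\<alpha>..<\<beta>} s) = measure lebesgue ({\<alpha>..<\<beta>} \<inter> {0..t})"
    by (simp add: measure_restrict_space)
  also have "\<dots> = measure lborel ({\<alpha>..<\<beta>} \<inter> {0..t})" by simp
  also have "\<dots> = ramp \<alpha> \<beta> t"
  proof (cases "t < \<beta>")
    case True
    then have "{\<alpha>..<\<beta>} \<inter> {0..t} = {\<alpha>..t}" using assms by auto
    then show ?thesis using True by (simp add: ramp_def)
  next
    case False
    then have "{\<alpha>..<\<beta>} \<inter> {0..t} = {\<alpha>..<\<beta>}" using assms by auto
    then show ?thesis using False assms by (simp add: ramp_def)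
  qed
  finally show ?thesis .
qed

lemma block_bounds:
  assumes "0 < m" "k < m"
  shows "0 \<le> real k / real m" "real k / real m \<le> (real k + 1) / real m" "(real k + 1) / real m \<le> 1"
  using assms by (auto simp: divide_right_mono field_simps)

lemma hb_eq_ramp:
  assumes "0 < m" "0 \<le> t"
  shows "hb m a t = (sqrt (real m) * ramp (real (snd a) / real m) ((real (snd a) + 1) / real m) t) *\<^sub>R axis (fst a) 1"
  unfolding hb_def using assms by (subst integral_indicator_Ico) (auto simp: divide_right_mono)

lemma has_path_deriv_hb: "has_path_deriv (hb m a) (hb_deriv m a)"
proof -
  have i: "integrable (lebesgue_on {0..t}) (indicat_real (block m (snd a)))" for t
    by (rule integrable_indicator_interval) simp
  have eq: "hb m a t = (LINT s|lebesgue_on {0..t}. hb_deriv m a s)" for t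
    unfolding hb_def hb_deriv_def block_def[symmetric] using i[of t]
    by (subst integral_scaleR_left) (auto simp del: integral_indicator)
  have 0: "hb m a 0 = 0"
  proof (cases "m = 0")
    case False
    then show ?thesis by (subst hb_eq_ramp) (auto simp: ramp_def divide_right_mono)
  qed (simp add: hb_def)
  have "integrable leb01 (hb_deriv m a)"
    unfolding hb_deriv_def using i[of 1] by (intro integrable_scaleR_left integrable_mult_right) auto
  then show ?thesis unfolding has_path_deriv_def 0 using eq by simp
qed

definition overlap :: "nat \<Rightarrow> nat \<Rightarrow> nat \<Rightarrow> nat \<Rightarrow> real" where
  "overlap m k N l = (LINT s|leb01. indicat_real (block m k) s * indicat_real (block N l) s)"

lemma integrable_overlap:
  "integrable leb01 (\<lambda>s. indicat_real (block m k) s * indicat_real (block N l) s)"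
  unfolding indicator_inter_arith[symmetric] by (rule integrable_indicator_interval) simp

lemma overlap_nonneg: "0 \<le> overlap m k N l"
  unfolding overlap_def by (intro integral_nonneg_AE) auto

lemma integral_block:
  assumes "0 < m" "k < m"
  shows "(LINT s|leb01. indicat_real (block m k) s) = 1 / real m"
  unfolding block_def using block_bounds[OF assms]
  by (subst integral_indicator_Ico) (auto simp: ramp_def diff_divide_distrib[symmetric])

lemma block_disjoint:
  assumes "0 < N" "s \<in> block N l" "s \<in> block N l'"
  shows "l = l'"
proof -
  have "real l \<le> s * real N" "s * real N < real l + 1" "real l' \<le> s * real N" "s * real N < real l' + 1"
    using assms by (auto simp: block_def field_simps)
  then show ?thesis by linarith
qed

lemma overlap_subset:
  assumes "0 < m" "k < m" "0 < N" "block m k \<subseteq> block N l"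
  shows "overlap m k N l' = (if l = l' then 1 / real m else 0)"
proof -
  have "(\<lambda>s. indicat_real (block m k) s * indicat_real (block N l') s) =
      (if l = l' then indicat_real (block m k) else (\<lambda>_. 0))"
    using assms(4) block_disjoint[OF assms(3), of _ l l'] by (auto simp: indicator_def fun_eq_iff)
  then have "overlap m k N l' = (LINT s|leb01. (if l = l' then indicat_real (block m k) else (\<lambda>_. 0)) s)"
    by (simp only: overlap_def)
  then show ?thesis using integral_block[OF assms(1,2)] by (cases "l = l'") (simp_all del: integral_indicator)
qed

lemma sum_overlap_le:
  assumes "0 < m" "k < m" "0 < N"
  shows "(\<Sum>l<N. overlap m k N l) \<le> 1 / real m"
proof -
  have le: "(\<Sum>l<N. indicat_real (block m k) s * indicat_real (block N l) s) \<le> indicat_real (block m k) s" for s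
  proof -
    have "(\<Sum>l<N. indicat_real (block N l) s) \<le> 1"
    proof (cases "\<exists>l<N. s \<in> block N l")
      case True
      then obtain l where l: "l < N" "s \<in> block N l" by blast
      have "(\<Sum>l'<N. indicat_real (block N l') s) = (\<Sum>l'<N. if l' = l then 1 else 0)"
      proof (rule sum.cong[OF refl])
        fix l'
        have "s \<in> block N l' \<longleftrightarrow> l' = l" using block_disjoint[OF assms(3), of s l' l] l(2) by blast
        then show "indicat_real (block N l') s = (if l' = l then 1 else 0)" by (simp add: indicator_def)
      qed
      also have "\<dots> \<le> 1" using l(1) by simp
      finally show ?thesis .
    next
      case False
      then show ?thesis by (subst sum.neutral) auto
    qed
    then show ?thesis
      unfolding sum_distrib_left[symmetric]
      using mult_left_mono[of "\<Sum>l<N. indicat_real (block N l) s" 1 "indicat_real (block m k) s"] by simp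
  qed
  have "(\<Sum>l<N. overlap m k N l) = (LINT s|leb01. (\<Sum>l<N. indicat_real (block m k) s * indicat_real (block N l) s))"
    unfolding overlap_def by (rule Bochner_Integration.integral_sum[symmetric]) (rule integrable_overlap)
  also have "\<dots> \<le> (LINT s|leb01. indicat_real (block m k) s)"
    by (intro integral_mono le Bochner_Integration.integrable_sum integrable_overlap integrable_indicator_interval) auto
  finally show ?thesis by (simp only: integral_block[OF assms(1,2)])
qed

text \<open>
  The inner product of \<open>hb m a\<close> and \<open>hb N b\<close>: the two blocks contribute the length of their
  intersection.
\<close>

definition gram :: "nat \<Rightarrow> 'd \<times> nat \<Rightarrow> nat \<Rightarrow> 'd \<times> nat \<Rightarrow> real" where
  "gram m a N b = (if fst a = fst b then sqrt (real m) * sqrt (real N) * overlap m (snd a) N (snd b) else 0)"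

lemma hb_deriv_inner:
  "integrable leb01 (\<lambda>s. hb_deriv m a s \<bullet> hb_deriv N b s)"
  "(LINT s|leb01. hb_deriv m a s \<bullet> hb_deriv N b s) = gram m a N b"
proof -
  have eq: "(\<lambda>s. hb_deriv m a s \<bullet> hb_deriv N b s) =
    (\<lambda>s. (if fst a = fst b then sqrt (real m) * sqrt (real N) else 0) *
      (indicat_real (block m (snd a)) s * indicat_real (block N (snd b)) s))"
    by (auto simp: hb_deriv_def inner_axis_axis fun_eq_iff)
  show "integrable leb01 (\<lambda>s. hb_deriv m a s \<bullet> hb_deriv N b s)"
    unfolding eq by (intro integrable_mult_right integrable_overlap)
  show "(LINT s|leb01. hb_deriv m a s \<bullet> hb_deriv N b s) = gram m a N b"
    unfolding eq integral_mult_right_zero by (simp add: gram_def overlap_def)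
qed

lemma finite_Aset [simp]: "finite (Aset m)"
  by (simp add: Aset_def)

lemma gram_self:
  assumes "0 < m" "a \<in> Aset m" "b \<in> Aset m"
  shows "gram m a m b = kron a b"
  using assms overlap_subset[of m "snd a" m "snd a" "snd b"]
  by (auto simp: gram_def kron_def Aset_def prod_eq_iff)

definition comb :: "nat \<Rightarrow> ('d::finite \<times> nat \<Rightarrow> real) \<Rightarrow> 'd path" where
  "comb m x t = (\<Sum>a\<in>Aset m. x a *\<^sub>R hb m a t)"

definition comb_deriv :: "nat \<Rightarrow> ('d::finite \<times> nat \<Rightarrow> real) \<Rightarrow> 'd path" where
  "comb_deriv m x t = (\<Sum>a\<in>Aset m. x a *\<^sub>R hb_deriv m a t)"

lemma Vspan_eq: "Vspan m = range (comb m)"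
  by (auto simp: Vspan_def comb_def fun_eq_iff)

lemma comb_cong: "(\<And>a. a \<in> Aset m \<Longrightarrow> x a = y a) \<Longrightarrow> comb m x = comb m y"
  by (auto simp: comb_def fun_eq_iff intro: sum.cong)

lemma comb_add: "comb m x t + comb m y t = comb m (\<lambda>a. x a + y a) t"
  by (simp add: comb_def scaleR_left_distrib sum.distrib)

lemma comb_diff: "comb m x t - comb m y t = comb m (\<lambda>a. x a - y a) t"
  by (simp add: comb_def scaleR_left_diff_distrib sum_subtractf)

lemma comb_scale: "c *\<^sub>R comb m x t = comb m (\<lambda>a. c * x a) t"
  by (simp add: comb_def scaleR_sum_right)

lemma comb_kron: "a \<in> Aset m \<Longrightarrow> comb m (kron a) = hb m a"
  by (auto simp: comb_def fun_eq_iff kron_def if_distrib[of "\<lambda>c. c *\<^sub>R _"] cong: if_cong)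

lemma has_path_deriv_comb: "has_path_deriv (comb m x) (comb_deriv m x)"
  unfolding comb_def[abs_def] comb_deriv_def[abs_def]
  by (intro has_path_deriv_sum has_path_deriv_scaleR has_path_deriv_hb) simp

lemma comb_deriv_inner:
  "integrable leb01 (\<lambda>s. comb_deriv m x s \<bullet> comb_deriv N y s)"
  "(LINT s|leb01. comb_deriv m x s \<bullet> comb_deriv N y s) =
     (\<Sum>a\<in>Aset m. \<Sum>b\<in>Aset N. x a * y b * gram m a N b)"
proof -
  have eq: "(\<lambda>s. comb_deriv m x s \<bullet> comb_deriv N y s) =
     (\<lambda>s. \<Sum>a\<in>Aset m. \<Sum>b\<in>Aset N. (x a * y b) * (hb_deriv m a s \<bullet> hb_deriv N b s))"
    unfolding comb_deriv_def inner_sum_left unfolding inner_sum_right by (simp add: mult.assoc mult.left_commute)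
  show "integrable leb01 (\<lambda>s. comb_deriv m x s \<bullet> comb_deriv N y s)"
    unfolding eq by (intro Bochner_Integration.integrable_sum integrable_mult_right hb_deriv_inner)
  show "(LINT s|leb01. comb_deriv m x s \<bullet> comb_deriv N y s) =
     (\<Sum>a\<in>Aset m. \<Sum>b\<in>Aset N. x a * y b * gram m a N b)"
    unfolding eq
    by (simp add: Bochner_Integration.integral_sum Bochner_Integration.integrable_sum hb_deriv_inner)
qed

lemma ip_comb: "ip (comb m x) (comb N y) = (\<Sum>a\<in>Aset m. \<Sum>b\<in>Aset N. x a * y b * gram m a N b)"
  by (simp add: ip_eq[OF has_path_deriv_comb has_path_deriv_comb] comb_deriv_inner)

lemma ip_comb_same: "0 < m \<Longrightarrow> ip (comb m x) (comb m y) = (\<Sum>a\<in>Aset m. x a * y a)"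
  unfolding ip_comb by (intro sum.cong refl)
    (simp add: gram_self kron_def if_distrib[of "\<lambda>c. _ * c"] cong: if_cong)

lemma I_norm_comb: "0 < m \<Longrightarrow> I_norm (comb m x) = sqrt (\<Sum>a\<in>Aset m. (x a)\<^sup>2)"
  by (simp add: I_norm_def ip_comb_same power2_eq_square)

text \<open>
  The residual is orthogonal to every \<open>hb N b\<close> exactly when the coefficients are the inner products
  with the orthonormal family \<open>hb N b\<close>.
\<close>

lemma proj_comb:
  fixes x :: "'d::finite \<times> nat \<Rightarrow> real"
  assumes N: "0 < N"
  shows "proj N (comb m x) = comb N (\<lambda>b. \<Sum>a\<in>Aset m. x a * gram m a N b)" (is "_ = comb N ?c")
proof -
  have ip: "ip (\<lambda>t. comb m x t - comb N y t) (comb N z) = (\<Sum>b\<in>Aset N. z b * (?c b - y b))"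
    for y z :: "'d \<times> nat \<Rightarrow> real"
  proof -
    have "has_path_deriv (\<lambda>t. comb m x t + (-1) *\<^sub>R comb N y t) (\<lambda>t. comb_deriv m x t + (-1) *\<^sub>R comb_deriv N y t)"
      by (intro has_path_deriv_add has_path_deriv_scaleR has_path_deriv_comb)
    then have d: "has_path_deriv (\<lambda>t. comb m x t - comb N y t) (\<lambda>t. comb_deriv m x t - comb_deriv N y t)" by simp
    have "ip (\<lambda>t. comb m x t - comb N y t) (comb N z)
       = (LINT s|leb01. comb_deriv m x s \<bullet> comb_deriv N z s - comb_deriv N y s \<bullet> comb_deriv N z s)"
      unfolding ip_eq[OF d has_path_deriv_comb] by (simp add: inner_diff_left)
    also have "\<dots> = ip (comb m x) (comb N z) - ip (comb N y) (comb N z)"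
      by (simp add: comb_deriv_inner ip_comb)
    also have "\<dots> = (\<Sum>b\<in>Aset N. z b * ?c b) - (\<Sum>b\<in>Aset N. z b * y b)"
      unfolding ip_comb_same[OF N] unfolding ip_comb
      by (subst sum.swap) (simp add: sum_distrib_left mult_ac)
    finally show ?thesis by (simp add: right_diff_distrib sum_subtractf)
  qed
  show ?thesis unfolding proj_def
  proof (rule the_equality)
    show "comb N ?c \<in> Vspan N \<and> (\<forall>u\<in>Vspan N. ip (\<lambda>t. comb m x t - comb N ?c t) u = 0)"
      by (auto simp: Vspan_eq ip)
    fix w assume w: "w \<in> Vspan N \<and> (\<forall>u\<in>Vspan N. ip (\<lambda>t. comb m x t - w t) u = 0)"
    then obtain y where y: "w = comb N y" by (auto simp: Vspan_eq)
    have "?c b = y b" if "b \<in> Aset N" for b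
    proof -
      have "(\<Sum>b'\<in>Aset N. kron b b' * (?c b' - y b')) = 0"
        using w unfolding y ip[symmetric] by (auto simp: Vspan_eq)
      then show ?thesis using that by (simp add: kron_def if_distrib[of "\<lambda>c. c * _"] cong: if_cong)
    qed
    then show "w = comb N ?c" unfolding y by (intro comb_cong) simp
  qed
qed

lemma gram_nonneg: "0 \<le> gram m a N b"
  by (simp add: gram_def overlap_nonneg)

text \<open>
  The blocks of the coarse grid are disjoint, so the overlaps with one block of the fine grid add up
  to at most its length \<open>1/m\<close>.
\<close>

lemma sum_gram_le:
  assumes m: "0 < m" and N: "0 < N" and a: "a \<in> Aset m"
  shows "(\<Sum>b\<in>Aset N. gram m a N b) \<le> sqrt (real N / real m)"
proof -
  have "(\<Sum>b\<in>Aset N. gram m a N b) = (\<Sum>i\<in>UNIV. \<Sum>l<N. gram m a N (i, l))"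
    by (simp add: Aset_def sum.cartesian_product)
  also have "\<dots> = (\<Sum>i\<in>UNIV. if i = fst a then sqrt (real m) * sqrt (real N) * (\<Sum>l<N. overlap m (snd a) N l) else 0)"
    by (intro sum.cong refl) (auto simp: gram_def sum_distrib_left)
  also have "\<dots> = sqrt (real m) * sqrt (real N) * (\<Sum>l<N. overlap m (snd a) N l)" by simp
  also have "\<dots> \<le> sqrt (real m) * sqrt (real N) * (1 / real m)"
    using a m N by (intro mult_left_mono sum_overlap_le) (auto simp: Aset_def)
  also have "\<dots> = sqrt (real N / real m)"
    using m by (simp add: real_sqrt_divide field_simps)
  finally show ?thesis .
qed

definition inner_blocks :: "nat \<Rightarrow> nat \<Rightarrow> nat \<Rightarrow> nat set" where
  "inner_blocks m N l = {k. k < m \<and> block m k \<subseteq> block N l}"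

text \<open>
  The fine blocks inside the coarse block \<open>l\<close> are those with index between \<open>l m / N\<close> and
  \<open>(l + 1) m / N - 1\<close>. Their number is at least \<open>m/N - 2\<close>, hence at least \<open>m/(3N)\<close> as
  soon as \<open>m/N \<ge> 3\<close>.
\<close>

lemma card_inner_blocks:
  assumes N: "0 < N" and m: "3 * N \<le> m" and l: "l < N"
  shows "real m / (3 * real N) \<le> real (card (inner_blocks m N l))"
proof -
  define lo hi where "lo = (l * m + (N - 1)) div N" and "hi = ((l + 1) * m) div N"
  have m0: "0 < m" using N m by linarith
  have "{lo..<hi} \<subseteq> inner_blocks m N l"
  proof
    fix k assume "k \<in> {lo..<hi}"
    then have k: "lo \<le> k" "k + 1 \<le> hi" by auto
    have "l * m + (N - 1) < (lo + 1) * N"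
      using N by (simp add: lo_def dividend_less_div_times)
    also have "\<dots> \<le> (k + 1) * N" using k(1) by simp
    finally have 1: "l * m \<le> k * N" using N by simp
    have "(k + 1) * N \<le> hi * N" using k(2) by (intro mult_right_mono) auto
    also have "\<dots> \<le> (l + 1) * m" by (simp add: hi_def)
    finally have 2: "(k + 1) * N \<le> (l + 1) * m" .
    also have "\<dots> \<le> N * m" using l by (intro mult_right_mono) auto
    finally have "(k + 1) * N \<le> m * N" by (simp only: mult.commute)
    then have km: "k < m" using N by (simp only: mult_le_cancel2) simp
    have "real l / real N \<le> real k / real m"
    proof -
      have "real (l * m) \<le> real (k * N)" using 1 by (simp only: of_nat_le_iff)
      then show ?thesis using N m0 by (simp add: field_simps)
    qed
    moreover have "(real k + 1) / real m \<le> (real l + 1) / real N"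
    proof -
      have "real ((k + 1) * N) \<le> real ((l + 1) * m)" using 2 by (simp only: of_nat_le_iff)
      then show ?thesis using N m0 by (simp add: field_simps)
    qed
    ultimately have "block m k \<subseteq> block N l" by (auto simp: block_def)
    then show "k \<in> inner_blocks m N l" using km by (simp add: inner_blocks_def)
  qed
  then have "card {lo..<hi} \<le> card (inner_blocks m N l)"
    by (intro card_mono) (auto simp: inner_blocks_def)
  then have "real hi - real lo \<le> real (card (inner_blocks m N l))" by simp
  moreover have "real lo \<le> real l * real m / real N + 1"
  proof -
    have "real lo * real N \<le> real (l * m + (N - 1))"
      unfolding lo_def of_nat_mult[symmetric] of_nat_le_iff by simp
    also have "\<dots> \<le> real l * real m + real N" using N by simp
    finally show ?thesis using N by (simp add: field_simps)
  qed
  moreover have "(real l + 1) * real m / real N - 1 \<le> real hi"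
  proof -
    have "(l + 1) * m < (hi + 1) * N" unfolding hi_def using N by (simp add: dividend_less_div_times)
    then have "real ((l + 1) * m) \<le> real ((hi + 1) * N)" by (simp only: of_nat_le_iff less_imp_le)
    then show ?thesis using N by (simp add: field_simps)
  qed
  moreover have "(real l + 1) * real m / real N = real l * real m / real N + real m / real N"
    by (simp add: distrib_right add_divide_distrib)
  moreover have "3 \<le> real m / real N"
  proof -
    have "real (3 * N) \<le> real m" using m by (simp only: of_nat_le_iff)
    then show ?thesis using N by (simp add: field_simps)
  qed
  moreover have "real m / (3 * real N) = (real m / real N) / 3" by simp
  ultimately show ?thesis by linarith
qed

lemma inner_blocks_disjoint:
  assumes "0 < m" "0 < N" "k \<in> inner_blocks m N l" "k \<in> inner_blocks m N l'"
  shows "l = l'"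
proof -
  have "real k / real m \<in> block m k" using assms(1) by (simp add: block_def divide_strict_right_mono)
  then show ?thesis using assms block_disjoint[OF assms(2), of "real k / real m" l l']
    by (auto simp: inner_blocks_def)
qed

text \<open>
  A direction \<open>w\<close> with the same projection onto \<open>\<V>\<^sup>N\<close> as \<open>hb m a\<close> but with squared norm of order
  \<open>N/m\<close>. If \<open>m < 3 N\<close>, then \<open>hb m a\<close> itself will do, as it has norm one. Otherwise the share of
  the mass of \<open>hb m a\<close> that falls into the coarse block \<open>l\<close> is distributed evenly over the
  \<open>n l \<ge> m/(3N)\<close> fine blocks inside that coarse block. These fine blocks meet no other coarse
  block, so the projection is unchanged, and the even distribution divides the squared norm by \<open>n l\<close>.
\<close>

lemma exchange_direction:
  fixes a :: "'d::finite \<times> nat"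
  assumes N: "0 < N" and Nm: "N < m" and a: "a \<in> Aset m"
  shows "\<exists>w. (\<forall>b\<in>Aset N. (\<Sum>a'\<in>Aset m. w a' * gram m a' N b) = gram m a N b) \<and>
      (\<Sum>a'\<in>Aset m. (w a')\<^sup>2) \<le> 3 * (real N / real m)"
proof (cases "m < 3 * N")
  case True
  have "(\<Sum>a'\<in>Aset m. kron a a' * gram m a' N b) = gram m a N b" for b
    using a by (simp add: kron_def if_distrib[of "\<lambda>c. c * _"] cong: if_cong)
  moreover have "(\<Sum>a'\<in>Aset m. (kron a a')\<^sup>2) = 1"
    using a by (simp add: kron_def if_distrib[of "\<lambda>c. c\<^sup>2"] cong: if_cong)
  moreover have "1 \<le> 3 * (real N / real m)" using True Nm by (simp add: field_simps)
  ultimately show ?thesis by (intro exI[of _ "kron a"]) auto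
next
  case False
  then have mN: "3 * N \<le> m" and m: "0 < m" using Nm by auto
  \<comment> \<open>\<open>\<mu> l\<close> is the fraction of the block of \<open>a\<close> lying in the coarse block \<open>l\<close>, and \<open>v k\<close> is the value
    assigned to the fine block \<open>k\<close>.\<close>
  define \<mu> where "\<mu> l = real m * overlap m (snd a) N l" for l
  define I where "I = inner_blocks m N"
  define n where "n l = real (card (I l))" for l
  have am: "snd a < m" using a by (auto simp: Aset_def)
  have n: "real m / (3 * real N) \<le> n l" "0 < n l" if "l < N" for l
  proof -
    show 1: "real m / (3 * real N) \<le> n l" unfolding n_def I_def by (rule card_inner_blocks[OF N mN that])
    have "0 < real m / (3 * real N)" using m N by simp
    with 1 show "0 < n l" by linarith
  qed
  have \<mu>0: "0 \<le> \<mu> l" for l by (simp add: \<mu>_def overlap_nonneg)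
  have \<mu>s: "(\<Sum>l<N. \<mu> l) \<le> 1"
    using mult_left_mono[OF sum_overlap_le[OF m am N], of "real m"] m by (simp add: \<mu>_def sum_distrib_left)
  have \<mu>1: "\<mu> l \<le> 1" if "l < N" for l
    using member_le_sum[of l "{..<N}" \<mu>] that \<mu>0 \<mu>s by auto
  have finI: "finite (I l)" "I l \<subseteq> {..<m}" for l by (auto simp: I_def inner_blocks_def)
  define v where "v k = (\<Sum>l<N. if k \<in> I l then \<mu> l / n l else 0)" for k
  define w where "w a' = (if fst a' = fst a then v (snd a') else 0)" for a' :: "'d \<times> nat"
  have sumAset: "(\<Sum>a'\<in>Aset m. if fst a' = fst a then g (snd a') else 0) = (\<Sum>k<m. g k)" for g :: "nat \<Rightarrow> real"
  proof -
    have "(\<Sum>a'\<in>Aset m. if fst a' = fst a then g (snd a') else 0)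
       = (\<Sum>i\<in>UNIV. \<Sum>k<m. if i = fst a then g k else 0)"
      by (simp add: Aset_def sum.cartesian_product case_prod_beta')
    also have "\<dots> = (\<Sum>i\<in>UNIV. if i = fst a then (\<Sum>k<m. g k) else 0)"
      by (intro sum.cong refl) auto
    finally show ?thesis by simp
  qed
  have ov: "(\<Sum>k<m. v k * overlap m k N l) = overlap m (snd a) N l" if l: "l < N" for l
  proof -
    have "(\<Sum>k<m. v k * overlap m k N l) = (\<Sum>l'<N. \<Sum>k<m. if k \<in> I l' then \<mu> l' / n l' * overlap m k N l else 0)"
      unfolding v_def sum_distrib_right by (subst sum.swap) (intro sum.cong refl, simp)
    also have "\<dots> = (\<Sum>l'<N. \<Sum>k\<in>I l'. \<mu> l' / n l' * overlap m k N l)"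
    proof (rule sum.cong[OF refl])
      fix l'
      have "(\<Sum>k<m. if k \<in> I l' then \<mu> l' / n l' * overlap m k N l else 0) =
        (\<Sum>k\<in>{k \<in> {..<m}. k \<in> I l'}. \<mu> l' / n l' * overlap m k N l)"
        by (subst sum.inter_filter) auto
      also have "{k \<in> {..<m}. k \<in> I l'} = I l'" using finI by auto
      finally show "(\<Sum>k<m. if k \<in> I l' then \<mu> l' / n l' * overlap m k N l else 0) =
        (\<Sum>k\<in>I l'. \<mu> l' / n l' * overlap m k N l)" .
    qed
    also have "\<dots> = (\<Sum>l'<N. if l' = l then \<mu> l / real m else 0)"
    proof (rule sum.cong[OF refl])
      fix l' assume l': "l' \<in> {..<N}"
      have "(\<Sum>k\<in>I l'. \<mu> l' / n l' * overlap m k N l) = (\<Sum>k\<in>I l'. \<mu> l' / n l' * (if l' = l then 1 / real m else 0))"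
        using m N by (intro sum.cong refl) (auto simp: I_def inner_blocks_def overlap_subset)
      also have "\<dots> = n l' * (\<mu> l' / n l' * (if l' = l then 1 / real m else 0))" by (simp add: n_def)
      also have "\<dots> = (if l' = l then \<mu> l / real m else 0)" using n(2)[of l'] l' by simp
      finally show "(\<Sum>k\<in>I l'. \<mu> l' / n l' * overlap m k N l) = (if l' = l then \<mu> l / real m else 0)" .
    qed
    also have "\<dots> = overlap m (snd a) N l" using l m by (simp add: \<mu>_def)
    finally show ?thesis .
  qed
  have "(\<Sum>a'\<in>Aset m. w a' * gram m a' N b) = gram m a N b" if b: "b \<in> Aset N" for b
  proof -
    have "(\<Sum>a'\<in>Aset m. w a' * gram m a' N b) = (\<Sum>a'\<in>Aset m. if fst a' = fst a then
        (if fst a = fst b then sqrt (real m) * sqrt (real N) * (v (snd a') * overlap m (snd a') N (snd b)) else 0) else 0)"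
      by (intro sum.cong refl) (auto simp: w_def gram_def)
    also have "\<dots> = (\<Sum>k<m. if fst a = fst b then sqrt (real m) * sqrt (real N) * (v k * overlap m k N (snd b)) else 0)"
      by (rule sumAset)
    also have "\<dots> = gram m a N b"
      using ov[of "snd b"] b by (auto simp: gram_def Aset_def sum_distrib_left[symmetric])
    finally show ?thesis .
  qed
  moreover have "(\<Sum>a'\<in>Aset m. (w a')\<^sup>2) \<le> 3 * (real N / real m)"
  proof -
    have "(\<Sum>a'\<in>Aset m. (w a')\<^sup>2) = (\<Sum>a'\<in>Aset m. if fst a' = fst a then (v (snd a'))\<^sup>2 else 0)"
      by (intro sum.cong refl) (auto simp: w_def)
    also have "\<dots> = (\<Sum>k<m. (v k)\<^sup>2)" by (rule sumAset)
    also have "\<dots> = (\<Sum>k<m. \<Sum>l<N. if k \<in> I l then (\<mu> l / n l)\<^sup>2 else 0)"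
    proof (rule sum.cong[OF refl])
      fix k
      show "(v k)\<^sup>2 = (\<Sum>l<N. if k \<in> I l then (\<mu> l / n l)\<^sup>2 else 0)"
      proof (cases "\<exists>l<N. k \<in> I l")
        case True
        then obtain l where l: "l < N" "k \<in> I l" by blast
        have *: "k \<in> I l' \<longleftrightarrow> l' = l" for l'
          using inner_blocks_disjoint[OF m N, of k l l'] l(2) by (auto simp: I_def)
        show ?thesis using l(1) unfolding v_def * by simp
      next
        case False
        then have "v k = 0" "(\<Sum>l<N. if k \<in> I l then (\<mu> l / n l)\<^sup>2 else 0) = 0"
          by (auto simp: v_def intro!: sum.neutral)
        then show ?thesis by simp
      qed
    qed
    also have "\<dots> = (\<Sum>l<N. \<Sum>k<m. if k \<in> I l then (\<mu> l / n l)\<^sup>2 else 0)" by (rule sum.swap)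
    also have "\<dots> = (\<Sum>l<N. n l * (\<mu> l / n l)\<^sup>2)"
    proof (rule sum.cong[OF refl])
      fix l
      have "(\<Sum>k<m. if k \<in> I l then (\<mu> l / n l)\<^sup>2 else 0) = (\<Sum>k\<in>{k \<in> {..<m}. k \<in> I l}. (\<mu> l / n l)\<^sup>2)"
        by (subst sum.inter_filter) auto
      also have "{k \<in> {..<m}. k \<in> I l} = I l" using finI by auto
      finally show "(\<Sum>k<m. if k \<in> I l then (\<mu> l / n l)\<^sup>2 else 0) = n l * (\<mu> l / n l)\<^sup>2" by (simp add: n_def)
    qed
    also have "\<dots> \<le> (\<Sum>l<N. 3 * (real N / real m) * \<mu> l)"
    proof (intro sum_mono)
      fix l assume "l \<in> {..<N}"
      then have l: "l < N" by simp
      have "n l * (\<mu> l / n l)\<^sup>2 = \<mu> l * \<mu> l * (1 / n l)" using n(2)[OF l] by (simp add: power2_eq_square)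
      also have "\<dots> \<le> \<mu> l * 1 * (3 * (real N / real m))"
      proof (intro mult_mono)
        have "1 / n l \<le> 1 / (real m / (3 * real N))" using n[OF l] m N by (intro divide_left_mono) auto
        then show "1 / n l \<le> 3 * (real N / real m)" by simp
      qed (use \<mu>0 \<mu>1[OF l] n(2)[OF l] in auto)
      finally show "n l * (\<mu> l / n l)\<^sup>2 \<le> 3 * (real N / real m) * \<mu> l" by (simp add: mult_ac)
    qed
    also have "\<dots> = 3 * (real N / real m) * (\<Sum>l<N. \<mu> l)" by (simp add: sum_distrib_left)
    also have "\<dots> \<le> 3 * (real N / real m) * 1" using \<mu>s by (intro mult_left_mono) auto
    finally show ?thesis by simp
  qed
  ultimately show ?thesis by (intro exI[of _ w]) auto
qed

section \<open>Norms of piecewise affine paths\<close>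

definition kernel_const :: "real \<Rightarrow> real \<Rightarrow> real" where
  "kernel_const \<eta> q = 1 / (q - q * \<eta>) + 1 / (q * \<eta>)"

text \<open>
  The integrand of the fractional seminorm for a path with increments \<open>min 1 (K u)\<close> at distance
  \<open>u\<close>.
\<close>

definition kernel :: "real \<Rightarrow> real \<Rightarrow> real \<Rightarrow> real \<Rightarrow> real" where
  "kernel \<eta> q K u = (min 1 (K * u)) powr q / u powr (1 + q * \<eta>)"

lemma kernel_measurable [measurable]: "kernel \<eta> q K \<in> borel_measurable borel"
  unfolding kernel_def by measurable

text \<open>
  At distances below \<open>1/K\<close> the kernel is \<open>K\<^sup>q u\<^sup>q\<^sup>-\<^sup>1\<^sup>-\<^sup>q\<^sup>\<eta>\<close>, integrable at zero since
  \<open>\<eta> < 1\<close>; beyond \<open>1/K\<close> it is \<open>u\<^sup>-\<^sup>1\<^sup>-\<^sup>q\<^sup>\<eta>\<close>, integrable at infinity since \<open>\<eta> > 0\<close>. Both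
  pieces scale like \<open>K\<^sup>q\<^sup>\<eta>\<close>.
\<close>

lemma kernel_half_line:
  assumes \<eta>: "0 < \<eta>" "\<eta> < 1" and q: "0 < q" and K: "0 < K"
  shows "(\<integral>\<^sup>+u. ennreal (kernel \<eta> q K u) * indicator {0..} u \<partial>lborel)
     \<le> ennreal (kernel_const \<eta> q * K powr (q * \<eta>))"
proof -
  have q\<eta>: "0 < q * \<eta>" "q * \<eta> < q" using assms by auto
  let ?a = "q - 1 - q * \<eta>" and ?e = "- (1 + q * \<eta>)"
  let ?f = "\<lambda>u. K powr q * u powr ?a" and ?g = "\<lambda>u. u powr ?e"
  have i1: "(?f has_integral (K powr q * ((1 / K) powr (?a + 1) / (?a + 1)))) {0..1 / K}"
    using q\<eta> K by (intro has_integral_mult_right has_integral_powr_from_0) auto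
  have i2: "(?g has_integral (- ((1 / K) powr (?e + 1)) / (?e + 1))) {1 / K..}"
    using q\<eta> K by (intro has_integral_powr_to_inf) auto
  have n1: "(\<integral>\<^sup>+u. ennreal (?f u) * indicator {0..1 / K} u \<partial>lborel) = ennreal (K powr (q * \<eta>) / (q - q * \<eta>))"
  proof -
    have eq: "K powr q * ((1 / K) powr (?a + 1) / (?a + 1)) = K powr (q * \<eta>) / (q - q * \<eta>)"
    proof -
      have "K powr q * ((1 / K) powr (?a + 1) / (?a + 1)) = (K powr q * (1 / K) powr (q - q * \<eta>)) / (q - q * \<eta>)"
        by simp
      also have "K powr q * (1 / K) powr (q - q * \<eta>) = K powr (q * \<eta>)"
        using K by (simp add: powr_divide powr_diff)
      finally show ?thesis .
    qed
    show ?thesis unfolding eq[symmetric]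
      by (rule nn_integral_has_integral_lebesgue'[OF _ i1]) simp
  qed
  have n2: "(\<integral>\<^sup>+u. ennreal (?g u) * indicator {1 / K..} u \<partial>lborel) = ennreal (K powr (q * \<eta>) / (q * \<eta>))"
  proof -
    have eq: "- ((1 / K) powr (?e + 1)) / (?e + 1) = K powr (q * \<eta>) / (q * \<eta>)"
      using K q\<eta> by (simp add: powr_divide powr_minus field_simps)
    show ?thesis unfolding eq[symmetric]
      by (rule nn_integral_has_integral_lebesgue'[OF _ i2]) simp
  qed
  have "(\<integral>\<^sup>+u. ennreal (kernel \<eta> q K u) * indicator {0..} u \<partial>lborel)
    \<le> (\<integral>\<^sup>+u. ennreal (?f u) * indicator {0..1 / K} u + ennreal (?g u) * indicator {1 / K..} u \<partial>lborel)"
  proof (rule nn_integral_mono)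
    fix u :: real
    consider "u < 0" | "u = 0" | "0 < u" "u \<le> 1 / K" | "1 / K < u" "0 < u" using K by (meson linorder_neqE_linordered_idom not_le)
    then show "ennreal (kernel \<eta> q K u) * indicator {0..} u
      \<le> ennreal (?f u) * indicator {0..1 / K} u + ennreal (?g u) * indicator {1 / K..} u"
    proof cases
      case 3
      then have "K * u \<le> 1" using K by (simp add: field_simps)
      then have "kernel \<eta> q K u = ?f u"
        using 3 K by (simp add: kernel_def powr_mult powr_diff powr_add min_def field_simps)
      then have "ennreal (kernel \<eta> q K u) * indicator {0..} u = ennreal (?f u) * indicator {0..1 / K} u"
        using 3 by simp
      then show ?thesis by (simp only: add_increasing2[OF zero_le order.refl])
    next
      case 4
      then have "1 \<le> K * u" using K by (simp add: field_simps)
      then have "kernel \<eta> q K u = ?g u"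
        using 4 by (simp only: kernel_def min_absorb1 powr_one_eq_one powr_minus_divide)
      then have "ennreal (kernel \<eta> q K u) * indicator {0..} u = ennreal (?g u) * indicator {1 / K..} u"
        using 4 by simp
      then show ?thesis by (simp only: add_increasing[OF zero_le order.refl])
    qed (auto simp: kernel_def)
  qed
  also have "\<dots> = ennreal (K powr (q * \<eta>) / (q - q * \<eta>)) + ennreal (K powr (q * \<eta>) / (q * \<eta>))"
    unfolding n1[symmetric] n2[symmetric] by (rule nn_integral_add) auto
  also have "\<dots> = ennreal (kernel_const \<eta> q * K powr (q * \<eta>))"
    using q\<eta> by (subst ennreal_plus[symmetric]) (use \<eta> in \<open>auto simp: kernel_const_def distrib_right intro!: divide_nonneg_nonneg\<close>)
  finally show ?thesis .
qed

lemma nn_integral_leb01_le_lborel: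
  fixes f :: "real \<Rightarrow> ennreal"
  assumes [measurable]: "f \<in> borel_measurable borel"
  shows "(\<integral>\<^sup>+s. f s \<partial>leb01) \<le> (\<integral>\<^sup>+s. f s \<partial>lborel)"
proof -
  have "(\<integral>\<^sup>+s. f s \<partial>leb01) = (\<integral>\<^sup>+s. f s * indicator {0..1} s \<partial>lebesgue)"
    by (rule nn_integral_restrict_space) simp
  also have "\<dots> = (\<integral>\<^sup>+s. f s * indicator {0..1} s \<partial>lborel)"
    by (rule nn_integral_completion) 
  also have "\<dots> \<le> (\<integral>\<^sup>+s. f s \<partial>lborel)"
    by (intro nn_integral_mono) (auto simp: indicator_def)
  finally show ?thesis .
qed

lemma kernel_centered:
  assumes "0 < \<eta>" "\<eta> < 1" "0 < q" "0 < K"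
  shows "(\<integral>\<^sup>+s. ennreal (kernel \<eta> q K \<bar>t - s\<bar>) \<partial>leb01)
     \<le> ennreal (2 * kernel_const \<eta> q * K powr (q * \<eta>))"
proof -
  let ?k = "\<lambda>u. ennreal (kernel \<eta> q K u) * indicator {0..} u"
  have "(\<integral>\<^sup>+s. ennreal (kernel \<eta> q K \<bar>t - s\<bar>) \<partial>leb01) \<le> (\<integral>\<^sup>+s. ennreal (kernel \<eta> q K \<bar>t - s\<bar>) \<partial>lborel)"
    by (rule nn_integral_leb01_le_lborel) measurable
  also have "\<dots> \<le> (\<integral>\<^sup>+s. ?k (t + (-1) * s) + ?k (- t + 1 * s) \<partial>lborel)"
    by (intro nn_integral_mono) (auto simp: abs_if indicator_def)
  also have "\<dots> = (\<integral>\<^sup>+s. ?k (t + (-1) * s) \<partial>lborel) + (\<integral>\<^sup>+s. ?k (- t + 1 * s) \<partial>lborel)"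
    by (rule nn_integral_add) measurable
  also have "(\<integral>\<^sup>+s. ?k (t + (-1) * s) \<partial>lborel) = (\<integral>\<^sup>+s. ?k s \<partial>lborel)"
    using nn_integral_real_affine[of ?k "-1" t] by simp
  also have "(\<integral>\<^sup>+s. ?k (- t + 1 * s) \<partial>lborel) = (\<integral>\<^sup>+s. ?k s \<partial>lborel)"
    using nn_integral_real_affine[of ?k 1 "-t"] by simp
  also have "(\<integral>\<^sup>+s. ?k s \<partial>lborel) + (\<integral>\<^sup>+s. ?k s \<partial>lborel) \<le>
     ennreal (kernel_const \<eta> q * K powr (q * \<eta>)) + ennreal (kernel_const \<eta> q * K powr (q * \<eta>))"
    by (intro add_mono kernel_half_line assms)
  also have "\<dots> = ennreal (2 * kernel_const \<eta> q * K powr (q * \<eta>))"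
    using assms by (subst ennreal_plus[symmetric]) (auto simp: kernel_const_def)
  finally show ?thesis .
qed

lemma emeasure_leb01 [simp]: "emeasure leb01 {0..1} = 1"
  by (simp add: emeasure_restrict_space)

lemma kernel_pair_measurable:
  "(\<lambda>x. ennreal (kernel \<eta> q K \<bar>fst x - snd x\<bar>)) \<in> borel_measurable (leb01 \<Otimes>\<^sub>M leb01)"
proof -
  have id: "(\<lambda>x::real. x) \<in> measurable leb01 borel"
    by (intro measurable_restrict_space1 measurable_completion) simp
  have [measurable]: "fst \<in> measurable (leb01 \<Otimes>\<^sub>M leb01) (borel :: real measure)"
    using measurable_compose[OF measurable_fst[of leb01 leb01] id] by simp
  have [measurable]: "snd \<in> measurable (leb01 \<Otimes>\<^sub>M leb01) (borel :: real measure)"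
    using measurable_compose[OF measurable_snd[of leb01 leb01] id] by simp
  show ?thesis by measurable
qed

lemma kernel_double:
  assumes "0 < \<eta>" "\<eta> < 1" "0 < q" "0 < K"
  shows "(\<integral>\<^sup>+(t, s). ennreal (kernel \<eta> q K \<bar>t - s\<bar>) \<partial>(leb01 \<Otimes>\<^sub>M leb01))
     \<le> ennreal (2 * kernel_const \<eta> q * K powr (q * \<eta>))"
proof -
  interpret sigma_finite_measure leb01
    using finite_measure_interval by (rule finite_measure.axioms(1))
  from nn_integral_fst[OF kernel_pair_measurable]
  have "(\<integral>\<^sup>+(t, s). ennreal (kernel \<eta> q K \<bar>t - s\<bar>) \<partial>(leb01 \<Otimes>\<^sub>M leb01))
     = (\<integral>\<^sup>+t. (\<integral>\<^sup>+s. ennreal (kernel \<eta> q K \<bar>t - s\<bar>) \<partial>leb01) \<partial>leb01)"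
    by (simp add: case_prod_beta')
  also have "\<dots> \<le> (\<integral>\<^sup>+t. ennreal (2 * kernel_const \<eta> q * K powr (q * \<eta>)) \<partial>leb01)"
    by (intro nn_integral_mono kernel_centered assms)
  also have "\<dots> = ennreal (2 * kernel_const \<eta> q * K powr (q * \<eta>))" by simp
  finally show ?thesis .
qed

definition energy_const :: "real \<Rightarrow> real \<Rightarrow> real" where
  "energy_const \<eta> q = (if \<eta> < 1 then 1 + 2 * kernel_const \<eta> q else 2)"

lemma energy_const_ge_1: "0 < \<eta> \<Longrightarrow> \<eta> \<le> 1 \<Longrightarrow> 0 < q \<Longrightarrow> 1 \<le> energy_const \<eta> q"
  by (auto simp: energy_const_def kernel_const_def)

lemma W_energy_sobolev:
  assumes "has_path_deriv f g"
  shows "W_energy 1 q f = (\<integral>\<^sup>+ t. ennreal (norm (f t) powr q) \<partial>leb01) +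
     (\<integral>\<^sup>+ t. ennreal (norm (g t) powr q) \<partial>leb01)"
proof -
  have "(\<integral>\<^sup>+ t. ennreal (norm (path_deriv f t) powr q) \<partial>leb01) = (\<integral>\<^sup>+ t. ennreal (norm (g t) powr q) \<partial>leb01)"
    using path_deriv_AE(1)[OF assms] by (intro nn_integral_cong_AE) auto
  then show ?thesis using assms by (auto simp: W_energy_def)
qed

lemma nn_integral_leb01_le_const:
  assumes "\<And>t. t \<in> {0..1} \<Longrightarrow> F t \<le> ennreal c"
  shows "(\<integral>\<^sup>+ t. F t \<partial>leb01) \<le> ennreal c"
proof -
  have "(\<integral>\<^sup>+ t. F t \<partial>leb01) \<le> (\<integral>\<^sup>+ t. ennreal c \<partial>leb01)"
    using assms by (intro nn_integral_mono) auto
  then show ?thesis by simp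
qed

text \<open>
  Paths of amplitude \<open>A\<close> that vary at scale \<open>1/K\<close> have norm of order \<open>A K\<^sup>\<eta>\<close>. The lemma serves
  twice: with \<open>K = N\<close> for the norm of paths in \<open>\<V>\<^sup>N\<close>, and with \<open>K = 1/\<delta>\<close> for the error of
  a smooth approximation at scale \<open>\<delta>\<close>.
\<close>

lemma W_energy_le:
  assumes \<eta>: "0 < \<eta>" "\<eta> \<le> 1" and q: "0 < q" and K: "1 \<le> K" and A: "0 \<le> A"
    and bd: "\<And>t. t \<in> {0..1} \<Longrightarrow> norm (f t) \<le> A"
    and inc: "\<And>t s. t \<in> {0..1} \<Longrightarrow> s \<in> {0..1} \<Longrightarrow> norm (f t - f s) \<le> A * min 1 (K * \<bar>t - s\<bar>)"
    and der: "\<eta> = 1 \<Longrightarrow> has_path_deriv f g" "\<And>t. \<eta> = 1 \<Longrightarrow> norm (g t) \<le> A * K"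
  shows "W_energy \<eta> q f \<le> ennreal (energy_const \<eta> q * (A * K powr \<eta>) powr q)"
proof -
  have AK: "(A * K powr \<eta>) powr q = A powr q * K powr (q * \<eta>)"
    using A K by (simp add: powr_mult powr_powr mult.commute)
  have K1: "1 \<le> K powr (q * \<eta>)" using K \<eta> q by (intro ge_one_powr_ge_zero) auto
  have I1: "(\<integral>\<^sup>+ t. ennreal (norm (f t) powr q) \<partial>leb01) \<le> ennreal (A powr q * K powr (q * \<eta>))"
  proof (rule nn_integral_leb01_le_const, rule ennreal_leI)
    fix t :: real assume "t \<in> {0..1}"
    then have "norm (f t) powr q \<le> A powr q * 1" using bd q by (auto intro: powr_mono2)
    also have "\<dots> \<le> A powr q * K powr (q * \<eta>)" using K1 by (intro mult_left_mono) auto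
    finally show "norm (f t) powr q \<le> A powr q * K powr (q * \<eta>)" .
  qed
  show ?thesis
  proof (cases "\<eta> < 1")
    case True
    have kc: "0 \<le> kernel_const \<eta> q" using True \<eta> q by (auto simp: kernel_const_def)
    have "(\<integral>\<^sup>+ (t, s). ennreal (norm (f t - f s) powr q / \<bar>t - s\<bar> powr (1 + q * \<eta>)) \<partial>(leb01 \<Otimes>\<^sub>M leb01))
      \<le> (\<integral>\<^sup>+ x. ennreal (A powr q) * (case x of (t, s) \<Rightarrow> ennreal (kernel \<eta> q K \<bar>t - s\<bar>)) \<partial>(leb01 \<Otimes>\<^sub>M leb01))"
    proof (rule nn_integral_mono, clarsimp simp: space_pair_measure)
      fix t s :: real assume ts: "0 \<le> t" "t \<le> 1" "0 \<le> s" "s \<le> 1"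
      have "norm (f t - f s) powr q \<le> (A * min 1 (K * \<bar>t - s\<bar>)) powr q"
        using inc[of t s] ts q by (intro powr_mono2) auto
      also have "\<dots> = A powr q * (min 1 (K * \<bar>t - s\<bar>)) powr q"
        using A K by (intro powr_mult)
      finally have "norm (f t - f s) powr q / \<bar>t - s\<bar> powr (1 + q * \<eta>)
        \<le> A powr q * (min 1 (K * \<bar>t - s\<bar>)) powr q / \<bar>t - s\<bar> powr (1 + q * \<eta>)"
        by (rule divide_right_mono) simp
      then show "ennreal (norm (f t - f s) powr q / \<bar>t - s\<bar> powr (1 + q * \<eta>))
        \<le> ennreal (A powr q) * ennreal (kernel \<eta> q K \<bar>t - s\<bar>)"
        by (simp add: ennreal_mult'[symmetric] kernel_def ennreal_leI)
    qed
    also have "\<dots> \<le> ennreal (A powr q) * ennreal (2 * kernel_const \<eta> q * K powr (q * \<eta>))"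
    proof -
      have "(\<integral>\<^sup>+ x. ennreal (A powr q) * (case x of (t, s) \<Rightarrow> ennreal (kernel \<eta> q K \<bar>t - s\<bar>)) \<partial>(leb01 \<Otimes>\<^sub>M leb01))
        = ennreal (A powr q) * (\<integral>\<^sup>+ (t, s). ennreal (kernel \<eta> q K \<bar>t - s\<bar>) \<partial>(leb01 \<Otimes>\<^sub>M leb01))"
        using kernel_pair_measurable by (subst nn_integral_cmult) (simp_all add: case_prod_beta')
      then show ?thesis using kernel_double[of \<eta> q K] True \<eta> q K by (auto intro: mult_left_mono)
    qed
    also have "\<dots> = ennreal (2 * kernel_const \<eta> q * (A powr q * K powr (q * \<eta>)))"
      using kc by (subst ennreal_mult'[symmetric]) (auto simp: mult_ac)
    finally have I2: "(\<integral>\<^sup>+ (t, s). ennreal (norm (f t - f s) powr q / \<bar>t - s\<bar> powr (1 + q * \<eta>)) \<partial>(leb01 \<Otimes>\<^sub>M leb01))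
      \<le> ennreal (2 * kernel_const \<eta> q * (A powr q * K powr (q * \<eta>)))" .
    have "W_energy \<eta> q f \<le> ennreal (A powr q * K powr (q * \<eta>)) + ennreal (2 * kernel_const \<eta> q * (A powr q * K powr (q * \<eta>)))"
      using add_mono[OF I1 I2] True by (simp add: W_energy_def)
    also have "\<dots> = ennreal (energy_const \<eta> q * (A * K powr \<eta>) powr q)"
      unfolding AK using kc True by (subst ennreal_plus[symmetric]) (auto simp: energy_const_def distrib_right)
    finally show ?thesis .
  next
    case False
    then have \<eta>1: "\<eta> = 1" using \<eta> by simp
    have I2: "(\<integral>\<^sup>+ t. ennreal (norm (g t) powr q) \<partial>leb01) \<le> ennreal (A powr q * K powr (q * \<eta>))"
    proof (rule nn_integral_leb01_le_const, rule ennreal_leI)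
      fix t :: real assume "t \<in> {0..1}"
      have "norm (g t) powr q \<le> (A * K) powr q" using der(2)[OF \<eta>1] q by (intro powr_mono2) auto
      then show "norm (g t) powr q \<le> A powr q * K powr (q * \<eta>)" using A K by (simp add: powr_mult \<eta>1)
    qed
    have "W_energy \<eta> q f \<le> ennreal (A powr q * K powr (q * \<eta>)) + ennreal (A powr q * K powr (q * \<eta>))"
      using add_mono[OF I1 I2] W_energy_sobolev[OF der(1)[OF \<eta>1], of q] by (simp add: \<eta>1)
    also have "\<dots> = ennreal (energy_const \<eta> q * (A * K powr \<eta>) powr q)"
      unfolding AK using False by (subst ennreal_plus[symmetric]) (auto simp: energy_const_def)
    finally show ?thesis .
  qed
qed

lemma W_norm_le:
  assumes \<eta>: "0 < \<eta>" "\<eta> \<le> 1" and q: "0 < q" and A: "0 \<le> A"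
    and E: "W_energy \<eta> q f \<le> ennreal (energy_const \<eta> q * (A * K powr \<eta>) powr q)"
  shows "W_norm \<eta> (ereal q) f \<le> energy_const \<eta> q powr (1 / q) * (A * K powr \<eta>)"
proof -
  have c: "0 \<le> energy_const \<eta> q" using energy_const_ge_1[OF \<eta> q] by simp
  have "enn2real (W_energy \<eta> q f) \<le> energy_const \<eta> q * (A * K powr \<eta>) powr q"
    using E c by (intro enn2real_leI) auto
  then have "enn2real (W_energy \<eta> q f) powr (1 / q) \<le> (energy_const \<eta> q * (A * K powr \<eta>) powr q) powr (1 / q)"
    using q by (intro powr_mono2) auto
  also have "\<dots> = energy_const \<eta> q powr (1 / q) * (A * K powr \<eta>)"
    using c A q by (simp add: powr_mult powr_powr)
  finally show ?thesis by (simp add: W_norm_def)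
qed

lemma abs_ramp_le:
  assumes "\<alpha> \<le> \<beta>"
  shows "\<bar>ramp \<alpha> \<beta> t\<bar> \<le> \<beta> - \<alpha>" "\<bar>ramp \<alpha> \<beta> t - ramp \<alpha> \<beta> s\<bar> \<le> min (\<beta> - \<alpha>) \<bar>t - s\<bar>"
  using assms by (auto simp: ramp_def max_def min_def)

lemma hb_bounds:
  assumes N: "0 < N"
  shows "t \<in> {0..1} \<Longrightarrow> norm (hb N b t) \<le> 1 / sqrt (real N)"
    and "t \<in> {0..1} \<Longrightarrow> s \<in> {0..1} \<Longrightarrow> norm (hb N b t - hb N b s) \<le> 1 / sqrt (real N) * min 1 (real N * \<bar>t - s\<bar>)"
    and "norm (hb_deriv N b t) \<le> 1 / sqrt (real N) * real N"
proof -
  let ?\<alpha> = "real (snd b) / real N" and ?\<beta> = "(real (snd b) + 1) / real N"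
  have \<alpha>\<beta>: "?\<alpha> \<le> ?\<beta>" "?\<beta> - ?\<alpha> = 1 / real N" by (auto simp: add_divide_distrib divide_right_mono)
  have sq: "sqrt (real N) * (1 / real N) = 1 / sqrt (real N)" "1 / sqrt (real N) * real N = sqrt (real N)"
    using N by (simp_all add: field_simps)
  show "norm (hb N b t) \<le> 1 / sqrt (real N)" if "t \<in> {0..1}" for t
  proof -
    have "norm (hb N b t) = sqrt (real N) * \<bar>ramp ?\<alpha> ?\<beta> t\<bar>"
      using that by (simp add: hb_eq_ramp[OF N] abs_mult)
    also have "\<dots> \<le> sqrt (real N) * (1 / real N)"
      using abs_ramp_le(1)[OF \<alpha>\<beta>(1)] unfolding \<alpha>\<beta>(2) by (intro mult_left_mono) auto
    finally show ?thesis unfolding sq .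
  qed
  show "norm (hb N b t - hb N b s) \<le> 1 / sqrt (real N) * min 1 (real N * \<bar>t - s\<bar>)"
    if "t \<in> {0..1}" "s \<in> {0..1}" for t s
  proof -
    have "norm (hb N b t - hb N b s) = sqrt (real N) * \<bar>ramp ?\<alpha> ?\<beta> t - ramp ?\<alpha> ?\<beta> s\<bar>"
      using that by (simp add: hb_eq_ramp[OF N] scaleR_left_diff_distrib[symmetric] right_diff_distrib[symmetric] abs_mult)
    also have "\<dots> \<le> sqrt (real N) * min (1 / real N) \<bar>t - s\<bar>"
      using abs_ramp_le(2)[OF \<alpha>\<beta>(1)] unfolding \<alpha>\<beta>(2) by (intro mult_left_mono) auto
    also have "min (1 / real N) \<bar>t - s\<bar> = (1 / real N) * min 1 (real N * \<bar>t - s\<bar>)"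
      using N by (simp add: min_def field_simps)
    finally show ?thesis unfolding mult.assoc[symmetric] sq .
  qed
  show "norm (hb_deriv N b t) \<le> 1 / sqrt (real N) * real N"
    unfolding sq by (simp add: hb_deriv_def indicator_def)
qed

lemma norm_comb_le:
  assumes "\<And>b. b \<in> Aset N \<Longrightarrow> norm (u b) \<le> c"
  shows "norm (\<Sum>b\<in>Aset N. y b *\<^sub>R u b) \<le> (\<Sum>b\<in>Aset N. \<bar>y b\<bar>) * c"
  unfolding sum_distrib_right
  by (intro order.trans[OF norm_sum] sum_mono) (auto intro!: mult_left_mono assms)

lemma comb_bounds:
  fixes y :: "'d::finite \<times> nat \<Rightarrow> real"
  assumes N: "0 < N"
  defines "A \<equiv> (\<Sum>b\<in>Aset N. \<bar>y b\<bar>) * (1 / sqrt (real N))"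
  shows "t \<in> {0..1} \<Longrightarrow> norm (comb N y t) \<le> A"
    and "t \<in> {0..1} \<Longrightarrow> s \<in> {0..1} \<Longrightarrow> norm (comb N y t - comb N y s) \<le> A * min 1 (real N * \<bar>t - s\<bar>)"
    and "norm (comb_deriv N y t) \<le> A * real N"
proof -
  show "norm (comb N y t) \<le> A" if "t \<in> {0..1}" for t
    unfolding comb_def A_def using that by (intro norm_comb_le hb_bounds N)
  show "norm (comb N y t - comb N y s) \<le> A * min 1 (real N * \<bar>t - s\<bar>)" if "t \<in> {0..1}" "s \<in> {0..1}" for t s
  proof -
    have "comb N y t - comb N y s = (\<Sum>b\<in>Aset N. y b *\<^sub>R (hb N b t - hb N b s))"
      by (simp add: comb_def scaleR_right_diff_distrib sum_subtractf)
    then show ?thesis unfolding A_def mult.assoc using that by (simp only:) (intro norm_comb_le hb_bounds N)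
  qed
  show "norm (comb_deriv N y t) \<le> A * real N"
    unfolding comb_deriv_def A_def mult.assoc by (intro norm_comb_le hb_bounds N)
qed

definition norm_const :: "real \<Rightarrow> ereal \<Rightarrow> real" where
  "norm_const \<eta> p = (if p = \<infinity> then 1 else energy_const \<eta> (real_of_ereal p) powr (1 / real_of_ereal p))"

lemma LambdaE:
  assumes "(\<eta>, p) \<in> Lambda"
  obtains "\<eta> = 0" "p = \<infinity>" | q where "p = ereal q" "0 < \<eta>" "\<eta> \<le> 1" "1 < q"
proof (cases "p = \<infinity>")
  case False
  with assms obtain q where q: "p = ereal q" "0 < \<eta>" "\<eta> \<le> 1" "0 < q" "0 < \<eta> - 1/q"
    by (auto simp: Lambda_def)
  then have "1 / q < 1" by linarith
  then have "1 < q" using q by simp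
  with q that(2) show ?thesis by blast
qed (use assms in \<open>auto simp: Lambda_def intro: that\<close>)

lemma norm_const_pos: "(\<eta>, p) \<in> Lambda \<Longrightarrow> 0 < norm_const \<eta> p"
proof (erule LambdaE)
  fix q assume "p = ereal q" "0 < \<eta>" "\<eta> \<le> 1" "1 < q"
  then show "0 < norm_const \<eta> p" using energy_const_ge_1[of \<eta> q] by (simp add: norm_const_def)
qed (simp add: norm_const_def)

lemma W_norm_comb_le:
  fixes y :: "'d::finite \<times> nat \<Rightarrow> real"
  assumes L: "(\<eta>, p) \<in> Lambda" and N: "0 < N"
  shows "W_norm \<eta> p (comb N y) \<le> norm_const \<eta> p * real N powr (\<eta> - 1/2) * (\<Sum>b\<in>Aset N. \<bar>y b\<bar>)"
proof -
  let ?A = "(\<Sum>b\<in>Aset N. \<bar>y b\<bar>) * (1 / sqrt (real N))"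
  have A: "0 \<le> ?A" by (auto intro: sum_nonneg divide_nonneg_nonneg)
  have eq: "?A * real N powr \<eta> = real N powr (\<eta> - 1/2) * (\<Sum>b\<in>Aset N. \<bar>y b\<bar>)"
    using N by (simp add: powr_diff powr_half_sqrt)
  from L show ?thesis
  proof (cases rule: LambdaE)
    case 1
    have "W_norm \<eta> p (comb N y) \<le> ?A"
      unfolding W_norm_def using 1 comb_bounds(1)[OF N, where y=y] by (auto intro!: cSUP_least)
    then show ?thesis using eq N 1 by (simp add: norm_const_def)
  next
    case (2 q)
    have N1: "1 \<le> real N" using N by simp
    have "W_energy \<eta> q (comb N y) \<le> ennreal (energy_const \<eta> q * (?A * real N powr \<eta>) powr q)"
      using 2 N1 A comb_bounds[OF N, where y=y] has_path_deriv_comb[of N y]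
      by (intro W_energy_le[where g = "comb_deriv N y"]) auto
    then have "W_norm \<eta> p (comb N y) \<le> energy_const \<eta> q powr (1 / q) * (?A * real N powr \<eta>)"
      unfolding 2(1) using 2 A by (intro W_norm_le) auto
    then show ?thesis unfolding eq using 2 by (simp add: norm_const_def mult.assoc)
  qed
qed

section \<open>Piecewise affine paths are limits of smooth paths\<close>

lemma has_path_deriv_C1:
  fixes f :: "'d::finite path"
  assumes d: "\<And>t. t \<in> {0..1} \<Longrightarrow> (f has_vector_derivative g t) (at t)"
    and c: "continuous_on {0..1} g"
  shows "has_path_deriv f g"
  unfolding has_path_deriv_def
proof (intro conjI ballI)
  have "g absolutely_integrable_on {0..1}"
    using absolutely_integrable_continuous[of 0 1 g] c by simp
  then show i: "integrable leb01 g"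
    unfolding set_integrable_def by (subst integrable_restrict_space) auto
  fix t :: real assume t: "t \<in> {0..1}"
  have "(g has_integral (f t - f 0)) {0..t}"
    using t by (intro fundamental_theorem_of_calculus)
      (auto intro!: has_vector_derivative_at_within d)
  moreover have "(g has_integral (LINT s|lebesgue_on {0..t}. g s)) {0..t}"
    using integrable_sub_interval[OF i t] by (intro has_integral_integral_lebesgue_on) auto
  ultimately have "f t - f 0 = (LINT s|lebesgue_on {0..t}. g s)" by (rule has_integral_unique)
  then show "f t = f 0 + (LINT s|lebesgue_on {0..t}. g s)" by (simp add: algebra_simps)
qed

text \<open>
  A smooth approximation of the absolute value, uniformly within \<open>\<delta>\<close> and also 1-Lipschitz. Since
  \<open>ramp\<close> is a combination of absolute values (\<open>ramp_eq_abs\<close>), it gives smooth approximations of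
  piecewise affine paths.
\<close>

definition soft_abs :: "real \<Rightarrow> real \<Rightarrow> real" where
  "soft_abs \<delta> x = sqrt (x\<^sup>2 + \<delta>\<^sup>2)"

definition soft_sgn :: "real \<Rightarrow> real \<Rightarrow> real" where
  "soft_sgn \<delta> x = x / sqrt (x\<^sup>2 + \<delta>\<^sup>2)"

definition soft_ramp :: "real \<Rightarrow> real \<Rightarrow> real \<Rightarrow> real \<Rightarrow> real" where
  "soft_ramp \<delta> \<alpha> \<beta> t = (\<beta> - \<alpha> + soft_abs \<delta> (t - \<alpha>) - soft_abs \<delta> (t - \<beta>)) / 2"

definition soft_step :: "real \<Rightarrow> real \<Rightarrow> real \<Rightarrow> real \<Rightarrow> real" where
  "soft_step \<delta> \<alpha> \<beta> t = (soft_sgn \<delta> (t - \<alpha>) - soft_sgn \<delta> (t - \<beta>)) / 2"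

lemma ramp_eq_abs: "\<alpha> \<le> \<beta> \<Longrightarrow> ramp \<alpha> \<beta> t = (\<beta> - \<alpha> + \<bar>t - \<alpha>\<bar> - \<bar>t - \<beta>\<bar>) / 2"
  by (auto simp: ramp_def max_def min_def abs_if)

lemma soft_abs_bounds:
  assumes "0 < \<delta>"
  shows "\<bar>x\<bar> \<le> soft_abs \<delta> x" "soft_abs \<delta> x \<le> \<bar>x\<bar> + \<delta>"
    "\<bar>soft_abs \<delta> x - soft_abs \<delta> y\<bar> \<le> \<bar>x - y\<bar>"
proof -
  show "\<bar>x\<bar> \<le> soft_abs \<delta> x" unfolding soft_abs_def by (rule real_le_rsqrt) simp
  show "soft_abs \<delta> x \<le> \<bar>x\<bar> + \<delta>" using sqrt_sum_squares_le_sum_abs[of x \<delta>] assms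
    by (simp add: soft_abs_def)
  have "soft_abs \<delta> a \<le> soft_abs \<delta> b + \<bar>a - b\<bar>" for a b
    using real_sqrt_sum_squares_triangle_ineq[of b "a - b" \<delta> 0] by (simp add: soft_abs_def)
  from this[of x y] this[of y x] show "\<bar>soft_abs \<delta> x - soft_abs \<delta> y\<bar> \<le> \<bar>x - y\<bar>" by linarith
qed

lemma soft_sgn_bounds:
  assumes "0 < \<delta>"
  shows "\<bar>soft_sgn \<delta> x\<bar> \<le> 1" 
proof -
  have "0 < x\<^sup>2 + \<delta>\<^sup>2" using assms by (simp add: add_nonneg_pos)
  moreover have "\<bar>x\<bar> \<le> sqrt (x\<^sup>2 + \<delta>\<^sup>2)" using soft_abs_bounds(1)[OF assms] by (simp add: soft_abs_def)
  ultimately show ?thesis by (simp add: soft_sgn_def)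
qed

lemma abs_half_difference_le:
  fixes a b c d :: real
  assumes "\<bar>a\<bar> \<le> d" "\<bar>b\<bar> \<le> d" "\<bar>c\<bar> \<le> d"
  shows "\<bar>a - (b / 2 - c / 2)\<bar> \<le> 2 * d"
  using assms by (simp add: abs_le_iff)

lemma soft_ramp_error:
  assumes \<alpha>\<beta>: "\<alpha> \<le> \<beta>" and \<delta>: "0 < \<delta>"
  shows "\<bar>ramp \<alpha> \<beta> t - soft_ramp \<delta> \<alpha> \<beta> t\<bar> \<le> \<delta>"
    and "\<bar>(ramp \<alpha> \<beta> t - soft_ramp \<delta> \<alpha> \<beta> t) - (ramp \<alpha> \<beta> s - soft_ramp \<delta> \<alpha> \<beta> s)\<bar>
       \<le> 2 * \<delta> * min 1 (1 / \<delta> * \<bar>t - s\<bar>)"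
proof -
  show 1: "\<bar>ramp \<alpha> \<beta> t - soft_ramp \<delta> \<alpha> \<beta> t\<bar> \<le> \<delta>" for t
  proof -
    have eq: "ramp \<alpha> \<beta> t - soft_ramp \<delta> \<alpha> \<beta> t =
        ((\<bar>t - \<alpha>\<bar> - soft_abs \<delta> (t - \<alpha>)) - (\<bar>t - \<beta>\<bar> - soft_abs \<delta> (t - \<beta>))) / 2"
      unfolding ramp_eq_abs[OF \<alpha>\<beta>] soft_ramp_def by (simp add: field_simps)
    have "\<bar>(\<bar>t - \<alpha>\<bar> - soft_abs \<delta> (t - \<alpha>)) - (\<bar>t - \<beta>\<bar> - soft_abs \<delta> (t - \<beta>))\<bar> \<le> 2 * \<delta>"
      using soft_abs_bounds(1,2)[OF \<delta>, of "t - \<alpha>"] soft_abs_bounds(1,2)[OF \<delta>, of "t - \<beta>"] \<delta>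
      by (intro abs_leI) linarith+
    then show ?thesis unfolding eq by simp
  qed
  have "\<bar>(ramp \<alpha> \<beta> t - soft_ramp \<delta> \<alpha> \<beta> t) - (ramp \<alpha> \<beta> s - soft_ramp \<delta> \<alpha> \<beta> s)\<bar> \<le> 2 * \<bar>t - s\<bar>"
  proof -
    have eq: "(ramp \<alpha> \<beta> t - soft_ramp \<delta> \<alpha> \<beta> t) - (ramp \<alpha> \<beta> s - soft_ramp \<delta> \<alpha> \<beta> s) =
      (ramp \<alpha> \<beta> t - ramp \<alpha> \<beta> s) - ((soft_abs \<delta> (t - \<alpha>) - soft_abs \<delta> (s - \<alpha>)) / 2
         - (soft_abs \<delta> (t - \<beta>) - soft_abs \<delta> (s - \<beta>)) / 2)"
      unfolding soft_ramp_def by (simp add: field_simps)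
    have "\<bar>ramp \<alpha> \<beta> t - ramp \<alpha> \<beta> s\<bar> \<le> \<bar>t - s\<bar>" using abs_ramp_le(2)[OF \<alpha>\<beta>, of t s] by simp
    moreover have "\<bar>soft_abs \<delta> (t - c) - soft_abs \<delta> (s - c)\<bar> \<le> \<bar>t - s\<bar>" for c
      using soft_abs_bounds(3)[OF \<delta>, of "t - c" "s - c"] by simp
    ultimately show ?thesis unfolding eq by (intro abs_half_difference_le)
  qed
  moreover have "\<bar>(ramp \<alpha> \<beta> t - soft_ramp \<delta> \<alpha> \<beta> t) - (ramp \<alpha> \<beta> s - soft_ramp \<delta> \<alpha> \<beta> s)\<bar> \<le> 2 * \<delta>"
    using 1[of t] 1[of s] by linarith
  moreover have "2 * \<delta> * min 1 (1 / \<delta> * \<bar>t - s\<bar>) = min (2 * \<delta>) (2 * \<bar>t - s\<bar>)"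
    using \<delta> by (simp add: min_def field_simps)
  ultimately show "\<bar>(ramp \<alpha> \<beta> t - soft_ramp \<delta> \<alpha> \<beta> t) - (ramp \<alpha> \<beta> s - soft_ramp \<delta> \<alpha> \<beta> s)\<bar>
       \<le> 2 * \<delta> * min 1 (1 / \<delta> * \<bar>t - s\<bar>)" by simp
qed

lemma soft_ramp_deriv:
  assumes \<delta>: "0 < \<delta>"
  shows "(soft_ramp \<delta> \<alpha> \<beta> has_real_derivative soft_step \<delta> \<alpha> \<beta> t) (at t)"
    and "continuous_on S (soft_step \<delta> \<alpha> \<beta>)"
proof -
  have pos: "0 < x\<^sup>2 + \<delta>\<^sup>2" for x using \<delta> by (simp add: add_nonneg_pos)
  have d: "((\<lambda>t. soft_abs \<delta> (t - c)) has_real_derivative soft_sgn \<delta> (t - c)) (at t)" for c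
    unfolding soft_abs_def soft_sgn_def using pos[of "t - c"] \<delta>
    by (auto intro!: derivative_eq_intros simp: divide_simps)
  show "(soft_ramp \<delta> \<alpha> \<beta> has_real_derivative soft_step \<delta> \<alpha> \<beta> t) (at t)"
    unfolding soft_ramp_def soft_step_def by (auto intro!: derivative_eq_intros d)
  have "sqrt (x\<^sup>2 + \<delta>\<^sup>2) \<noteq> 0" for x using pos[of x] by (metis less_irrefl real_sqrt_eq_zero_cancel_iff)
  then show "continuous_on S (soft_step \<delta> \<alpha> \<beta>)"
    unfolding soft_step_def soft_sgn_def by (intro continuous_intros) auto
qed

lemma soft_step_bounds:
  assumes \<delta>: "0 < \<delta>"
  shows "\<bar>soft_step \<delta> \<alpha> \<beta> t\<bar> \<le> 1"
proof -
  have "\<bar>soft_sgn \<delta> (t - \<alpha>) - soft_sgn \<delta> (t - \<beta>)\<bar> \<le> 2"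
    using soft_sgn_bounds[OF \<delta>, of "t - \<alpha>"] soft_sgn_bounds[OF \<delta>, of "t - \<beta>"] by linarith
  then show ?thesis by (simp add: soft_step_def)
qed

lemma soft_step_tendsto:
  assumes "\<alpha> \<le> \<beta>" "t \<noteq> \<alpha>" "t \<noteq> \<beta>" and \<delta>: "\<delta> \<longlonglongrightarrow> 0"
  shows "(\<lambda>n. soft_step (\<delta> n) \<alpha> \<beta> t) \<longlonglongrightarrow> indicat_real {\<alpha>..<\<beta>} t"
proof -
  have s: "(\<lambda>n. soft_sgn (\<delta> n) x) \<longlonglongrightarrow> sgn x" if "x \<noteq> 0" for x
  proof -
    have "(\<lambda>n. x / sqrt (x\<^sup>2 + (\<delta> n)\<^sup>2)) \<longlonglongrightarrow> x / sqrt (x\<^sup>2 + 0\<^sup>2)"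
      using that by (intro tendsto_intros \<delta>) auto
    moreover have "x / sqrt (x\<^sup>2 + 0\<^sup>2) = sgn x" using that by (auto simp: sgn_if abs_if)
    ultimately show ?thesis by (simp add: soft_sgn_def)
  qed
  have "(\<lambda>n. soft_step (\<delta> n) \<alpha> \<beta> t) \<longlonglongrightarrow> (sgn (t - \<alpha>) - sgn (t - \<beta>)) / 2"
    unfolding soft_step_def using assms by (intro tendsto_intros s) auto
  moreover have "(sgn (t - \<alpha>) - sgn (t - \<beta>)) / 2 = indicat_real {\<alpha>..<\<beta>} t"
    using assms by (auto simp: sgn_if indicator_def)
  ultimately show ?thesis by simp
qed

definition block_left :: "nat \<Rightarrow> 'd \<times> nat \<Rightarrow> real" where "block_left N b = real (snd b) / real N"
definition block_right :: "nat \<Rightarrow> 'd \<times> nat \<Rightarrow> real" where "block_right N b = (real (snd b) + 1) / real N"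

lemma block_left_le_right: "block_left N b \<le> block_right N b"
  by (simp add: block_left_def block_right_def divide_right_mono)

definition soft_comb :: "real \<Rightarrow> nat \<Rightarrow> ('d::finite \<times> nat \<Rightarrow> real) \<Rightarrow> 'd path" where
  "soft_comb \<delta> N y t = (\<Sum>b\<in>Aset N. y b *\<^sub>R ((sqrt (real N) * soft_ramp \<delta> (block_left N b) (block_right N b) t) *\<^sub>R axis (fst b) 1))"

definition soft_comb_deriv :: "real \<Rightarrow> nat \<Rightarrow> ('d::finite \<times> nat \<Rightarrow> real) \<Rightarrow> 'd path" where
  "soft_comb_deriv \<delta> N y t = (\<Sum>b\<in>Aset N. y b *\<^sub>R ((sqrt (real N) * soft_step \<delta> (block_left N b) (block_right N b) t) *\<^sub>R axis (fst b) 1))"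

lemma soft_comb_has_derivative:
  assumes "0 < \<delta>"
  shows "(soft_comb \<delta> N y has_vector_derivative soft_comb_deriv \<delta> N y t) (at t)"
    and "continuous_on S (soft_comb_deriv \<delta> N y)"
proof -
  have "((\<lambda>t. (sqrt (real N) * soft_ramp \<delta> \<alpha> \<beta> t) *\<^sub>R v) has_vector_derivative (sqrt (real N) * soft_step \<delta> \<alpha> \<beta> t) *\<^sub>R v) (at t)"
    for \<alpha> \<beta> and v :: "real^'a"
    by (auto intro!: derivative_eq_intros soft_ramp_deriv(1)[OF assms])
  then show "(soft_comb \<delta> N y has_vector_derivative soft_comb_deriv \<delta> N y t) (at t)"
    unfolding soft_comb_def[abs_def] soft_comb_deriv_def
    by (intro has_vector_derivative_sum bounded_linear.has_vector_derivative[OF bounded_linear_scaleR_right]) auto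
  show "continuous_on S (soft_comb_deriv \<delta> N y)"
    unfolding soft_comb_deriv_def[abs_def] by (intro continuous_intros soft_ramp_deriv(2)[OF assms])
qed

lemma soft_comb_C1: "0 < \<delta> \<Longrightarrow> soft_comb \<delta> N y C1_differentiable_on {0..1}"
  unfolding C1_differentiable_on_def
  using soft_comb_has_derivative by blast

lemma comb_minus_soft_comb:
  assumes N: "0 < N" and t: "t \<in> {0..1}"
  shows "comb N y t - soft_comb \<delta> N y t = (\<Sum>b\<in>Aset N. y b *\<^sub>R
      ((sqrt (real N) * (ramp (block_left N b) (block_right N b) t - soft_ramp \<delta> (block_left N b) (block_right N b) t)) *\<^sub>R axis (fst b) 1))"
  using t unfolding comb_def soft_comb_def sum_subtractf[symmetric]
  by (intro sum.cong refl) (simp add: hb_eq_ramp[OF N] block_left_def block_right_def algebra_simps)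

lemma has_path_deriv_comb_minus_soft:
  assumes "0 < \<delta>"
  shows "has_path_deriv (\<lambda>t. comb N y t - soft_comb \<delta> N y t) (\<lambda>t. comb_deriv N y t - soft_comb_deriv \<delta> N y t)"
proof -
  have "has_path_deriv (\<lambda>t. comb N y t + (-1) *\<^sub>R soft_comb \<delta> N y t)
     (\<lambda>t. comb_deriv N y t + (-1) *\<^sub>R soft_comb_deriv \<delta> N y t)"
    using soft_comb_has_derivative[OF assms]
    by (intro has_path_deriv_add has_path_deriv_comb has_path_deriv_scaleR has_path_deriv_C1)
  then show ?thesis by simp
qed

lemma comb_error_bounds:
  fixes y :: "'d::finite \<times> nat \<Rightarrow> real"
  assumes N: "0 < N" and \<delta>: "0 < \<delta>"
  defines "A \<equiv> (\<Sum>b\<in>Aset N. \<bar>y b\<bar>) * (sqrt (real N) * (2 * \<delta>))"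
  shows "t \<in> {0..1} \<Longrightarrow> norm (comb N y t - soft_comb \<delta> N y t) \<le> A"
    and "t \<in> {0..1} \<Longrightarrow> s \<in> {0..1} \<Longrightarrow>
      norm ((comb N y t - soft_comb \<delta> N y t) - (comb N y s - soft_comb \<delta> N y s)) \<le> A * min 1 (1 / \<delta> * \<bar>t - s\<bar>)"
    and "norm (comb_deriv N y t - soft_comb_deriv \<delta> N y t) \<le> A * (1 / \<delta>)"
proof -
  let ?e = "\<lambda>b t. ramp (block_left N b) (block_right N b) t - soft_ramp \<delta> (block_left N b) (block_right N b) t"
  show "norm (comb N y t - soft_comb \<delta> N y t) \<le> A" if t: "t \<in> {0..1}" for t
    unfolding comb_minus_soft_comb[OF N t] A_def
  proof (rule norm_comb_le)
    fix b :: "'d \<times> nat"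
    have "sqrt (real N) * \<bar>?e b t\<bar> \<le> sqrt (real N) * (2 * \<delta>)"
      using soft_ramp_error(1)[OF block_left_le_right \<delta>, of N b t] \<delta> by (intro mult_left_mono) auto
    then show "norm ((sqrt (real N) * ?e b t) *\<^sub>R axis (fst b) 1 :: real^'d) \<le> sqrt (real N) * (2 * \<delta>)"
      by (simp add: abs_mult)
  qed
  show "norm ((comb N y t - soft_comb \<delta> N y t) - (comb N y s - soft_comb \<delta> N y s)) \<le> A * min 1 (1 / \<delta> * \<bar>t - s\<bar>)"
    if t: "t \<in> {0..1}" and s: "s \<in> {0..1}" for t s
  proof -
    have eq: "(comb N y t - soft_comb \<delta> N y t) - (comb N y s - soft_comb \<delta> N y s)
      = (\<Sum>b\<in>Aset N. y b *\<^sub>R ((sqrt (real N) * (?e b t - ?e b s)) *\<^sub>R axis (fst b) 1))"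
      unfolding comb_minus_soft_comb[OF N t] comb_minus_soft_comb[OF N s] sum_subtractf[symmetric]
      by (intro sum.cong refl) (simp add: algebra_simps)
    show ?thesis unfolding eq A_def mult.assoc
    proof (rule norm_comb_le)
      fix b :: "'d \<times> nat"
      have "sqrt (real N) * \<bar>?e b t - ?e b s\<bar> \<le> sqrt (real N) * (2 * \<delta> * min 1 (1 / \<delta> * \<bar>t - s\<bar>))"
        using soft_ramp_error(2)[OF block_left_le_right \<delta>, of N b t s] by (intro mult_left_mono) auto
      then show "norm ((sqrt (real N) * (?e b t - ?e b s)) *\<^sub>R axis (fst b) 1 :: real^'d)
         \<le> sqrt (real N) * (2 * (\<delta> * min 1 (1 / \<delta> * \<bar>t - s\<bar>)))"
        by (simp add: abs_mult mult.assoc)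
    qed
  qed
  have eq: "comb_deriv N y t - soft_comb_deriv \<delta> N y t = (\<Sum>b\<in>Aset N. y b *\<^sub>R
     ((sqrt (real N) * (indicat_real (block N (snd b)) t - soft_step \<delta> (block_left N b) (block_right N b) t)) *\<^sub>R axis (fst b) 1))"
    unfolding comb_deriv_def soft_comb_deriv_def sum_subtractf[symmetric]
    by (intro sum.cong refl) (simp add: hb_deriv_def algebra_simps)
  have A\<delta>: "A * (1 / \<delta>) = (\<Sum>b\<in>Aset N. \<bar>y b\<bar>) * (sqrt (real N) * 2)" using \<delta> by (simp add: A_def)
  show "norm (comb_deriv N y t - soft_comb_deriv \<delta> N y t) \<le> A * (1 / \<delta>)"
    unfolding eq A\<delta>
  proof (rule norm_comb_le)
    fix b :: "'d \<times> nat"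
    have "\<bar>indicat_real (block N (snd b)) t\<bar> \<le> 1" by (simp add: indicator_def)
    then have "\<bar>indicat_real (block N (snd b)) t - soft_step \<delta> (block_left N b) (block_right N b) t\<bar> \<le> 2"
      using soft_step_bounds[OF \<delta>, of "block_left N b" "block_right N b" t] by linarith
    then have "sqrt (real N) * \<bar>indicat_real (block N (snd b)) t - soft_step \<delta> (block_left N b) (block_right N b) t\<bar> \<le> sqrt (real N) * 2"
      by (intro mult_left_mono) auto
    then show "norm ((sqrt (real N) * (indicat_real (block N (snd b)) t - soft_step \<delta> (block_left N b) (block_right N b) t)) *\<^sub>R axis (fst b) 1 :: real^'d)
       \<le> sqrt (real N) * 2" by (simp add: abs_mult)
  qed
qed

lemma continuous_on_comb:
  assumes "0 < N" shows "continuous_on {0..1} (comb N y)"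
proof -
  have "continuous_on {0..1} (\<lambda>t. \<Sum>b\<in>Aset N. y b *\<^sub>R ((sqrt (real N) * ramp (block_left N b) (block_right N b) t) *\<^sub>R axis (fst b) (1::real)))"
    unfolding ramp_def by (intro continuous_intros)
  then show ?thesis
    by (rule continuous_on_eq) (simp add: comb_def hb_eq_ramp[OF assms] block_left_def block_right_def)
qed

definition approx_step :: "nat \<Rightarrow> real" where "approx_step n = 1 / real (Suc n)"

lemma approx_step: "0 < approx_step n" "approx_step n \<le> 1" "approx_step \<longlonglongrightarrow> 0"
  unfolding approx_step_def using LIMSEQ_inverse_real_of_nat by (simp_all add: inverse_eq_divide)

lemma comb_deriv_tendsto:
  assumes N: "0 < N"
  shows "AE t in leb01. (\<lambda>n. soft_comb_deriv (approx_step n) N y t) \<longlonglongrightarrow> comb_deriv N y t"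
proof -
  define F where "F = block_left N ` (Aset N :: ('a \<times> nat) set) \<union> block_right N ` (Aset N :: ('a \<times> nat) set)"
  have "finite F" by (simp add: F_def)
  then have "F \<in> null_sets lborel" by (intro finite_imp_null_set_lborel)
  then have "AE t in lborel. t \<notin> F" by (rule AE_not_in)
  then have "AE t in lebesgue. t \<notin> F" by (rule AE_completion)
  then have "AE t in leb01. t \<notin> F" by (subst AE_restrict_space_iff) (auto elim: eventually_mono)
  then show ?thesis
  proof (rule eventually_mono)
    fix t assume t: "t \<notin> F"
    have "(\<lambda>n. soft_step (approx_step n) (block_left N b) (block_right N b) t) \<longlonglongrightarrow> indicat_real (block N (snd b)) t"
      if "b \<in> Aset N" for b :: "'a \<times> nat"
      using soft_step_tendsto[OF block_left_le_right _ _ approx_step(3), of t N b] t that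
      by (auto simp: F_def block_def block_left_def block_right_def)
    then show "(\<lambda>n. soft_comb_deriv (approx_step n) N y t) \<longlonglongrightarrow> comb_deriv N y t"
      unfolding soft_comb_deriv_def comb_deriv_def hb_deriv_def
      by (intro tendsto_intros) auto
  qed
qed

text \<open>
  For \<open>\<eta> < 1\<close> the error has amplitude of order \<open>\<delta>\<close> at scale \<open>\<delta>\<close>, so its norm is of order
  \<open>\<delta>\<^sup>1\<^sup>-\<^sup>\<eta>\<close>. For \<open>\<eta> = 1\<close> this gives nothing, but the derivatives are bounded and converge almost
  everywhere, so dominated convergence applies.
\<close>

lemma comb_energy_error_tendsto:
  fixes y :: "'d::finite \<times> nat \<Rightarrow> real"
  assumes \<eta>: "0 < \<eta>" "\<eta> \<le> 1" and q: "1 < q" and N: "0 < N"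
  shows "(\<lambda>n. W_energy \<eta> q (\<lambda>t. comb N y t - soft_comb (approx_step n) N y t)) \<longlonglongrightarrow> 0"
proof (cases "\<eta> < 1")
  case True
  let ?A = "\<lambda>n. (\<Sum>b\<in>Aset N. \<bar>y b\<bar>) * (sqrt (real N) * (2 * approx_step n))"
  let ?K = "\<lambda>n. 1 / approx_step n"
  have A: "0 \<le> ?A n" for n
    using approx_step(1)[of n] by (intro mult_nonneg_nonneg sum_nonneg) auto
  have K: "1 \<le> ?K n" for n using approx_step(1,2)[of n] by simp
  have le: "W_energy \<eta> q (\<lambda>t. comb N y t - soft_comb (approx_step n) N y t)
    \<le> ennreal (energy_const \<eta> q * (?A n * ?K n powr \<eta>) powr q)" for n
    using comb_error_bounds[OF N approx_step(1)[of n], where y=y] q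
      has_path_deriv_comb_minus_soft[OF approx_step(1)[of n], of N y]
    by (intro W_energy_le[OF \<eta> _ K A]) auto
  have "(\<lambda>n. (\<Sum>b\<in>Aset N. \<bar>y b\<bar>) * (sqrt (real N) * 2) * approx_step n powr (1 - \<eta>)) \<longlonglongrightarrow>
     (\<Sum>b\<in>Aset N. \<bar>y b\<bar>) * (sqrt (real N) * 2) * 0"
    using True approx_step(1)
    by (intro tendsto_mult tendsto_const tendsto_zero_powrI[OF approx_step(3) tendsto_const])
       (auto intro!: always_eventually less_imp_le)
  moreover have "?A n * ?K n powr \<eta> = (\<Sum>b\<in>Aset N. \<bar>y b\<bar>) * (sqrt (real N) * 2) * approx_step n powr (1 - \<eta>)" for n
    using approx_step(1)[of n] by (simp add: powr_divide powr_diff)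
  ultimately have "(\<lambda>n. ?A n * ?K n powr \<eta>) \<longlonglongrightarrow> 0" by (simp only: mult_zero_right)
  then have "(\<lambda>n. (?A n * ?K n powr \<eta>) powr q) \<longlonglongrightarrow> 0"
    using q A by (intro tendsto_zero_powrI[OF _ tendsto_const]) (auto intro!: always_eventually mult_nonneg_nonneg)
  then have "(\<lambda>n. energy_const \<eta> q * (?A n * ?K n powr \<eta>) powr q) \<longlonglongrightarrow> energy_const \<eta> q * 0"
    by (intro tendsto_mult tendsto_const)
  then have "(\<lambda>n. ennreal (energy_const \<eta> q * (?A n * ?K n powr \<eta>) powr q)) \<longlonglongrightarrow> ennreal 0"
    by (intro tendsto_ennrealI) (simp only: mult_zero_right)
  then have "(\<lambda>n. ennreal (energy_const \<eta> q * (?A n * ?K n powr \<eta>) powr q)) \<longlonglongrightarrow> 0"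
    by (simp only: ennreal_0)
  then show ?thesis
    by (rule tendsto_sandwich[OF always_eventually[OF allI[OF zero_le]] always_eventually[OF allI[OF le]] tendsto_const])
next
  case False
  then have \<eta>1: "\<eta> = 1" using \<eta> by simp
  define Y where "Y = (\<Sum>b\<in>Aset N. \<bar>y b\<bar>) * (sqrt (real N) * 2)"
  have Y: "0 \<le> Y" by (auto simp: Y_def intro!: mult_nonneg_nonneg sum_nonneg)
  let ?D = "\<lambda>n t. comb N y t - soft_comb (approx_step n) N y t"
  let ?d = "\<lambda>n t. comb_deriv N y t - soft_comb_deriv (approx_step n) N y t"
  have bD: "norm (?D n t) \<le> Y * approx_step n" if "t \<in> {0..1}" for n t
    using comb_error_bounds(1)[OF N approx_step(1), OF that] by (simp add: Y_def mult_ac)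
  have bd: "norm (?d n t) \<le> Y" for n t
    using comb_error_bounds(3)[OF N approx_step(1)[of n], of y t] approx_step(1)[of n] by (simp add: Y_def)
  have E: "W_energy \<eta> q (?D n) = (\<integral>\<^sup>+ t. ennreal (norm (?D n t) powr q) \<partial>leb01) +
     (\<integral>\<^sup>+ t. ennreal (norm (?d n t) powr q) \<partial>leb01)" for n
    unfolding \<eta>1 by (rule W_energy_sobolev[OF has_path_deriv_comb_minus_soft[OF approx_step(1)]])
  have "(\<lambda>n. (Y * approx_step n) powr q) \<longlonglongrightarrow> 0"
  proof (rule tendsto_zero_powrI[OF _ tendsto_const])
    show "(\<lambda>n. Y * approx_step n) \<longlonglongrightarrow> 0" using tendsto_mult[OF tendsto_const approx_step(3), of Y] by simp
  qed (use q Y approx_step(1) in \<open>auto intro!: always_eventually mult_nonneg_nonneg intro: less_imp_le\<close>)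
  then have "(\<lambda>n. ennreal ((Y * approx_step n) powr q)) \<longlonglongrightarrow> ennreal 0"
    by (rule tendsto_ennrealI)
  then have lim: "(\<lambda>n. ennreal ((Y * approx_step n) powr q)) \<longlonglongrightarrow> 0" by (simp only: ennreal_0)
  have le: "(\<integral>\<^sup>+ t. ennreal (norm (?D n t) powr q) \<partial>leb01) \<le> ennreal ((Y * approx_step n) powr q)" for n
    using bD q by (intro nn_integral_leb01_le_const ennreal_leI powr_mono2) auto
  have 1: "(\<lambda>n. \<integral>\<^sup>+ t. ennreal (norm (?D n t) powr q) \<partial>leb01) \<longlonglongrightarrow> 0"
    by (rule tendsto_sandwich[OF always_eventually[OF allI[OF zero_le]] always_eventually[OF allI[OF le]] tendsto_const lim])
  have [measurable]: "comb_deriv N y \<in> borel_measurable leb01"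
    "soft_comb_deriv (approx_step n) N y \<in> borel_measurable leb01" for n
    using has_path_derivD(1)[OF has_path_deriv_comb[of N y]]
      has_path_derivD(1)[OF has_path_deriv_C1[OF soft_comb_has_derivative[OF approx_step(1)[of n]], of N y]]
    by auto
  have "(\<lambda>n. \<integral>\<^sup>+ t. ennreal (norm (?d n t) powr q) \<partial>leb01) \<longlonglongrightarrow> (\<integral>\<^sup>+ t. 0 \<partial>leb01)"
  proof (rule nn_integral_dominated_convergence)
    show "AE t in leb01. ennreal (norm (?d n t) powr q) \<le> ennreal (Y powr q)" for n
      using bd q by (intro always_eventually allI ennreal_leI powr_mono2) auto
    show "(\<integral>\<^sup>+ t. ennreal (Y powr q) \<partial>leb01) < \<infinity>" by simp
    show "AE t in leb01. (\<lambda>n. ennreal (norm (?d n t) powr q)) \<longlonglongrightarrow> 0"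
      using comb_deriv_tendsto[OF N, of y]
    proof (rule eventually_mono)
      fix t assume "(\<lambda>n. soft_comb_deriv (approx_step n) N y t) \<longlonglongrightarrow> comb_deriv N y t"
      then have "(\<lambda>n. norm (?d n t)) \<longlonglongrightarrow> norm (comb_deriv N y t - comb_deriv N y t)"
        by (intro tendsto_intros)
      then have "(\<lambda>n. norm (?d n t) powr q) \<longlonglongrightarrow> 0"
        using q by (intro tendsto_zero_powrI[OF _ tendsto_const]) auto
      then have "(\<lambda>n. ennreal (norm (?d n t) powr q)) \<longlonglongrightarrow> ennreal 0" by (rule tendsto_ennrealI)
      then show "(\<lambda>n. ennreal (norm (?d n t) powr q)) \<longlonglongrightarrow> 0" by simp
    qed
  qed measurable
  then have 2: "(\<lambda>n. \<integral>\<^sup>+ t. ennreal (norm (?d n t) powr q) \<partial>leb01) \<longlonglongrightarrow> 0" by simp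
  show ?thesis unfolding E using tendsto_add[OF 1 2] by simp
qed

lemma comb_in_Wspace:
  assumes L: "(\<eta>, p) \<in> Lambda" and N: "0 < N"
  shows "comb N y \<in> Wspace \<eta> p"
  using L
proof (cases rule: LambdaE)
  case 1
  then show ?thesis using continuous_on_comb[OF N] by (simp add: Wspace_def)
next
  case (2 q)
  have "comb N y \<in> borel_measurable leb01"
    by (rule continuous_imp_measurable_on_sets_lebesgue[OF continuous_on_comb[OF N]]) simp
  moreover have "\<exists>g. g C1_differentiable_on {0..1} \<and> W_energy \<eta> q (\<lambda>t. comb N y t - g t) < ennreal e" if "0 < e" for e
  proof -
    have "eventually (\<lambda>n. W_energy \<eta> q (\<lambda>t. comb N y t - soft_comb (approx_step n) N y t) < ennreal e) sequentially"
      using that by (intro order_tendstoD(2)[OF comb_energy_error_tendsto[OF 2(2,3,4) N]]) simp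
    then obtain n where "W_energy \<eta> q (\<lambda>t. comb N y t - soft_comb (approx_step n) N y t) < ennreal e"
      by (auto dest: eventually_happens)
    then show ?thesis using soft_comb_C1[OF approx_step(1)] by blast
  qed
  ultimately show ?thesis using 2 by (simp add: Wspace_def)
qed

section \<open>Derivatives of the semigroup\<close>

text \<open>
  The function is the pointwise limit of its values at the points obtained by rounding all
  coordinates down to multiples of \<open>1/(n + 1)\<close>. Each of these approximations factors through a
  countable set.
\<close>

lemma Lipschitz_measurable_Gauss:
  fixes f :: "('i \<Rightarrow> real) \<Rightarrow> real"
  assumes A: "finite A"
    and lip: "\<And>x y. \<bar>f x - f y\<bar> \<le> L * l1 A (\<lambda>i. x i - y i)"
  shows "f \<in> borel_measurable (Gauss A)"
proof (rule borel_measurable_LIMSEQ_real)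
  define grid where "grid n z = (\<lambda>i\<in>A. \<lfloor>real (Suc n) * z i\<rfloor>)" for n and z :: "'i \<Rightarrow> real"
  define h where "h n k = f (\<lambda>i. real_of_int (k i) / real (Suc n))" for n and k :: "'i \<Rightarrow> int"
  let ?Z = "PiE A (\<lambda>_. UNIV :: int set)"
  have cZ: "countable ?Z" using A by (rule countable_PiE) simp
  show "(\<lambda>z. h n (grid n z)) \<in> borel_measurable (Gauss A)" for n
  proof (rule measurable_compose_countable'[where f = "\<lambda>k z. h n k" and I = ?Z])
    show "grid n \<in> measurable (Gauss A) (count_space ?Z)"
      unfolding measurable_count_space_eq_countable[OF cZ]
    proof (intro conjI ballI)
      show "grid n \<in> space (Gauss A) \<rightarrow> ?Z" by (auto simp: grid_def)
      fix k assume k: "k \<in> ?Z"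
      have "grid n -` {k} \<inter> space (Gauss A) = {z \<in> space (Gauss A). \<forall>i\<in>A. \<lfloor>real (Suc n) * z i\<rfloor> = k i}"
        using k by (auto simp: grid_def fun_eq_iff PiE_iff extensional_def)
      also have "\<dots> \<in> sets (Gauss A)" using A by measurable
      finally show "grid n -` {k} \<inter> space (Gauss A) \<in> sets (Gauss A)" .
    qed
  qed (use cZ in auto)
  fix z
  have bound: "\<bar>h n (grid n z) - f z\<bar> \<le> \<bar>L\<bar> * (real (card A) * (1 / real (Suc n)))" for n
  proof -
    have "l1 A (\<lambda>i. real_of_int (grid n z i) / real (Suc n) - z i) \<le> (\<Sum>i\<in>A. 1 / real (Suc n))"
      unfolding l1_def
    proof (rule sum_mono)
      fix i assume "i \<in> A"
      have "\<bar>real_of_int \<lfloor>real (Suc n) * z i\<rfloor> - real (Suc n) * z i\<bar> \<le> 1" by linarith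
      then have "\<bar>(real_of_int \<lfloor>real (Suc n) * z i\<rfloor> - real (Suc n) * z i) / real (Suc n)\<bar> \<le> 1 / real (Suc n)"
        unfolding abs_divide abs_of_nat by (rule divide_right_mono) simp
      then show "\<bar>real_of_int (grid n z i) / real (Suc n) - z i\<bar> \<le> 1 / real (Suc n)"
        using \<open>i \<in> A\<close> by (simp add: grid_def diff_divide_distrib)
    qed
    also have "\<dots> = real (card A) * (1 / real (Suc n))" by simp
    finally have le: "l1 A (\<lambda>i. real_of_int (grid n z i) / real (Suc n) - z i) \<le> real (card A) * (1 / real (Suc n))" .
    have "\<bar>h n (grid n z) - f z\<bar> \<le> L * l1 A (\<lambda>i. real_of_int (grid n z i) / real (Suc n) - z i)"
      unfolding h_def by (rule lip)
    also have "\<dots> \<le> \<bar>L\<bar> * l1 A (\<lambda>i. real_of_int (grid n z i) / real (Suc n) - z i)"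
      by (intro mult_right_mono) auto
    also have "\<dots> \<le> \<bar>L\<bar> * (real (card A) * (1 / real (Suc n)))" by (intro mult_left_mono le) auto
    finally show ?thesis .
  qed
  have lim: "(\<lambda>n. \<bar>L\<bar> * (real (card A) * (1 / real (Suc n)))) \<longlonglongrightarrow> \<bar>L\<bar> * (real (card A) * 0)"
    using LIMSEQ_inverse_real_of_nat by (intro tendsto_intros) (simp add: inverse_eq_divide)
  have "(\<lambda>n. h n (grid n z) - f z) \<longlonglongrightarrow> 0"
  proof (rule Lim_null_comparison)
    show "(\<lambda>n. \<bar>L\<bar> * (real (card A) * (1 / real (Suc n)))) \<longlonglongrightarrow> 0" using lim by (simp only: mult_zero_right)
    show "\<forall>\<^sub>F n in sequentially. norm (h n (grid n z) - f z) \<le> \<bar>L\<bar> * (real (card A) * (1 / real (Suc n)))"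
      unfolding real_norm_def by (rule always_eventually, rule allI, rule bound)
  qed
  then show "(\<lambda>n. h n (grid n z)) \<longlonglongrightarrow> f z" by (rule LIM_zero_cancel)
qed

lemma l1_le_l2:
  assumes A: "finite A"
  shows "l1 A u \<le> real (card A) * sqrt (\<Sum>i\<in>A. (u i)\<^sup>2)"
proof -
  have "\<bar>u i\<bar> \<le> sqrt (\<Sum>i\<in>A. (u i)\<^sup>2)" if "i \<in> A" for i
    using member_le_sum[OF that, of "\<lambda>i. (u i)\<^sup>2"] A by (intro real_le_rsqrt) auto
  then show ?thesis unfolding l1_def using sum_mono[of A "\<lambda>i. \<bar>u i\<bar>" "\<lambda>_. sqrt (\<Sum>i\<in>A. (u i)\<^sup>2)"] by simp
qed

lemma l2_le_l1:
  assumes A: "finite A"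
  shows "sqrt (\<Sum>i\<in>A. (u i)\<^sup>2) \<le> l1 A u"
  unfolding l1_def using L2_set_le_sum_abs[of u A] by (simp add: L2_set_def)

text \<open>
  Transfers a quadratic remainder in the \<open>l1\<close> norm to the epsilon-delta form of differentiability in
  the Euclidean norm, after rescaling the argument by \<open>\<kappa>\<close>.
\<close>

lemma little_o_l2:
  assumes A: "finite A" and \<kappa>: "0 < \<kappa>" and K: "0 \<le> K"
    and R: "\<And>u. l1 A u \<le> 1 \<Longrightarrow> \<bar>R u\<bar> \<le> K * (l1 A u)\<^sup>2" and e: "0 < (e::real)"
  shows "\<exists>\<delta>>0. \<forall>u. sqrt (\<Sum>i\<in>A. (u i)\<^sup>2) < \<delta> \<longrightarrow> \<bar>R (\<lambda>i. \<kappa> * u i)\<bar> \<le> e * sqrt (\<Sum>i\<in>A. (u i)\<^sup>2)"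
proof -
  define c where "c = \<kappa> * (real (card A) + 1)"
  define \<delta> where "\<delta> = min (1 / c) (e / (K * c\<^sup>2 + 1))"
  have c: "0 < c" using \<kappa> by (simp add: c_def)
  have d: "0 < K * c\<^sup>2 + 1" using K by (simp add: add_nonneg_pos)
  show ?thesis
  proof (intro exI[of _ \<delta>] conjI allI impI)
    show "0 < \<delta>" using c d e by (simp add: \<delta>_def)
    fix u assume u: "sqrt (\<Sum>i\<in>A. (u i)\<^sup>2) < \<delta>"
    define r where "r = sqrt (\<Sum>i\<in>A. (u i)\<^sup>2)"
    have r: "0 \<le> r" "r < 1 / c" "r < e / (K * c\<^sup>2 + 1)" using u by (auto simp: r_def \<delta>_def sum_nonneg)
    have "l1 A (\<lambda>i. \<kappa> * u i) = \<kappa> * l1 A u" using \<kappa> by (simp add: l1_scale)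
    also have "\<dots> \<le> \<kappa> * (real (card A) * r)" using l1_le_l2[OF A, of u] \<kappa> by (simp add: r_def)
    also have "\<dots> \<le> c * r" using \<kappa> r(1) by (simp add: c_def algebra_simps)
    finally have l: "l1 A (\<lambda>i. \<kappa> * u i) \<le> c * r" .
    also have "c * r \<le> 1" using r(2) c by (simp add: field_simps)
    finally have "\<bar>R (\<lambda>i. \<kappa> * u i)\<bar> \<le> K * (l1 A (\<lambda>i. \<kappa> * u i))\<^sup>2" by (rule R)
    also have "\<dots> \<le> K * (c * r)\<^sup>2" using l K by (intro mult_left_mono power_mono) auto
    also have "\<dots> = (K * c\<^sup>2 * r) * r" by (simp add: power2_eq_square)
    also have "\<dots> \<le> e * r"
    proof (rule mult_right_mono)
      have "K * c\<^sup>2 * r \<le> (K * c\<^sup>2 + 1) * r" using r(1) by (intro mult_right_mono) auto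
      also have "\<dots> \<le> e" using r(3) d by (simp add: field_simps)
      finally show "K * c\<^sup>2 * r \<le> e" .
    qed (rule r(1))
    finally show "\<bar>R (\<lambda>i. \<kappa> * u i)\<bar> \<le> e * sqrt (\<Sum>i\<in>A. (u i)\<^sup>2)" by (simp add: r_def)
  qed
qed

definition coeffs :: "nat \<Rightarrow> 'd::finite path \<Rightarrow> 'd \<times> nat \<Rightarrow> real" where
  "coeffs m w a = ip w (hb m a)"

lemma coeffs_comb: "0 < m \<Longrightarrow> a \<in> Aset m \<Longrightarrow> coeffs m (comb m u) a = u a"
  by (simp add: coeffs_def comb_kron[symmetric] ip_comb_same kron_def if_distrib[of "\<lambda>c. _ * c"] cong: if_cong)

text \<open>
  The function \<open>g\<close> stands for \<open>F \<circ> proj N\<close>. Only its values on \<open>Vspan m\<close> matter, and only their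
  Lipschitz bound in the \<open>l1\<close> norm of the coordinates is used to differentiate.
\<close>

locale lipschitz_heat_flow = brownian_motion M B
  for M :: "'a measure" and B :: "real \<Rightarrow> 'a \<Rightarrow> real^'d::finite" +
  fixes m :: nat and \<tau> :: real and g :: "'d path \<Rightarrow> real" and L :: real
  assumes m: "0 < m" and \<tau>: "0 < \<tau>" and L: "0 \<le> L"
    and lip: "\<And>x y. \<bar>g (comb m x) - g (comb m y)\<bar> \<le> L * l1 (Aset m) (\<lambda>a. x a - y a)"
begin

definition psi :: "('d \<times> nat \<Rightarrow> real) \<Rightarrow> real" where
  "psi z = g (comb m (\<lambda>a. beta \<tau> * z a))"

definition \<kappa> :: real where "\<kappa> = exp (- \<tau>) / beta \<tau>"

lemma beta_pos: "0 < beta \<tau>"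
  using \<tau> by (simp add: beta_def)

lemma \<kappa>_pos: "0 < \<kappa>"
  using beta_pos by (simp add: \<kappa>_def)

lemma psi_lip: "\<bar>psi x - psi y\<bar> \<le> (L * beta \<tau>) * l1 (Aset m) (\<lambda>a. x a - y a)"
proof -
  have "\<bar>psi x - psi y\<bar> \<le> L * l1 (Aset m) (\<lambda>a. beta \<tau> * x a - beta \<tau> * y a)"
    unfolding psi_def by (rule lip)
  also have "(\<lambda>a. beta \<tau> * x a - beta \<tau> * y a) = (\<lambda>a. beta \<tau> * (x a - y a))" by (simp add: right_diff_distrib)
  finally show ?thesis using beta_pos by (simp only: l1_scale)
qed

sublocale exp_growth "Aset m" psi "\<bar>psi (\<lambda>_. 0)\<bar> + L * beta \<tau>" 1
proof
  show "psi \<in> borel_measurable (Gauss (Aset m))"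
    by (rule Lipschitz_measurable_Gauss[OF _ psi_lip]) simp
  show "psi (restrict z (Aset m)) = psi z" for z
    unfolding psi_def by (intro arg_cong[where f = g] comb_cong) simp
  show "\<bar>psi z\<bar> \<le> (\<bar>psi (\<lambda>_. 0)\<bar> + L * beta \<tau>) * exp (1 * l1 (Aset m) z)" for z
  proof -
    have Lb: "0 \<le> L * beta \<tau>" using L beta_pos by simp
    have 1: "1 \<le> exp (l1 (Aset m) z)" by simp
    have 2: "l1 (Aset m) z \<le> exp (l1 (Aset m) z)" using exp_ge_add_one_self[of "l1 (Aset m) z"] by linarith
    have "\<bar>psi z\<bar> \<le> \<bar>psi (\<lambda>_. 0)\<bar> * 1 + (L * beta \<tau>) * l1 (Aset m) z"
      using psi_lip[of z "\<lambda>_. 0"] by simp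
    also have "\<dots> \<le> \<bar>psi (\<lambda>_. 0)\<bar> * exp (l1 (Aset m) z) + (L * beta \<tau>) * exp (l1 (Aset m) z)"
      using 1 2 Lb by (intro add_mono mult_left_mono) auto
    finally show ?thesis by (simp add: distrib_right)
  qed
qed auto

lemma Pm_comb: "Pm M B m \<tau> g (comb m x) = smooth (\<lambda>_. 1) (\<lambda>a. \<kappa> * x a)"
proof -
  let ?A = "Aset m :: ('d \<times> nat) set"
  let ?Z = "\<lambda>\<omega>. \<lambda>a\<in>?A. coord m a \<omega>"
  have bk: "beta \<tau> * (\<kappa> * r) = exp (- \<tau>) * r" for r using beta_pos by (simp add: \<kappa>_def)
  have Z: "?Z \<in> measurable M (Gauss ?A)" by measurable
  have "g (\<lambda>t. exp (- \<tau>) *\<^sub>R comb m x t + beta \<tau> *\<^sub>R Bm B m \<omega> t) = psi (\<lambda>a. ?Z \<omega> a + \<kappa> * x a)" for \<omega>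
  proof -
    have "Bm B m \<omega> = comb m (\<lambda>a. coord m a \<omega>)"
      by (simp add: Bm_def comb_def coord_def fun_eq_iff)
    then have "(\<lambda>t. exp (- \<tau>) *\<^sub>R comb m x t + beta \<tau> *\<^sub>R Bm B m \<omega> t)
      = comb m (\<lambda>a. exp (- \<tau>) * x a + beta \<tau> * coord m a \<omega>)"
      by (simp only: comb_scale comb_add)
    also have "\<dots> = comb m (\<lambda>a. beta \<tau> * (?Z \<omega> a + \<kappa> * x a))"
      by (rule comb_cong) (simp add: distrib_left bk)
    finally show ?thesis by (simp only: psi_def)
  qed
  then have "Pm M B m \<tau> g (comb m x) = (\<integral>\<omega>. psi (\<lambda>a. ?Z \<omega> a + \<kappa> * x a) \<partial>M)"
    by (simp only: Pm_def)
  also have "\<dots> = (\<integral>z. psi (\<lambda>a. z a + \<kappa> * x a) \<partial>distr M (Gauss ?A) ?Z)"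
    by (rule integral_distr[OF Z meas_shift, symmetric])
  also have "\<dots> = smooth (\<lambda>_. 1) (\<lambda>a. \<kappa> * x a)"
    unfolding distr_coords[OF m] smooth_def by simp
  finally show ?thesis .
qed

definition grad_vec :: "('d \<times> nat \<Rightarrow> real) \<Rightarrow> 'd path" where
  "grad_vec x = comb m (\<lambda>i. \<kappa> * grad i (\<lambda>a. \<kappa> * x a))"

definition hess_map :: "('d \<times> nat \<Rightarrow> real) \<Rightarrow> 'd path \<Rightarrow> 'd path" where
  "hess_map x w = comb m (\<lambda>i. \<Sum>j\<in>Aset m. \<kappa>\<^sup>2 * hess i j (\<lambda>a. \<kappa> * x a) * coeffs m w j)"

lemma has_gradient_Pm: "has_gradient m (Pm M B m \<tau> g) (comb m x) (grad_vec x)"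
  unfolding has_gradient_def
proof (intro conjI allI impI)
  show "grad_vec x \<in> Vspan m" by (simp add: grad_vec_def Vspan_eq)
  fix e :: real assume e: "0 < e"
  let ?kx = "\<lambda>a. \<kappa> * x a"
  let ?R = "\<lambda>u. smooth (\<lambda>_. 1) (\<lambda>a. ?kx a + u a) - smooth (\<lambda>_. 1) ?kx - (\<Sum>j\<in>Aset m. u j * grad j ?kx)"
  obtain K where K: "0 \<le> K" "\<And>u. l1 (Aset m) u \<le> 1 \<Longrightarrow> \<bar>?R u\<bar> \<le> K * (l1 (Aset m) u)\<^sup>2"
    using smooth_one_expansion[of ?kx] by blast
  obtain \<delta> where \<delta>: "\<delta> > 0" "\<And>u. sqrt (\<Sum>i\<in>Aset m. (u i)\<^sup>2) < \<delta> \<Longrightarrow>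
     \<bar>?R (\<lambda>i. \<kappa> * u i)\<bar> \<le> e * sqrt (\<Sum>i\<in>Aset m. (u i)\<^sup>2)"
    using little_o_l2[OF fin \<kappa>_pos K e] by blast
  show "\<exists>\<delta>>0. \<forall>w\<in>Vspan m. I_norm w < \<delta> \<longrightarrow>
    \<bar>Pm M B m \<tau> g (\<lambda>t. comb m x t + w t) - Pm M B m \<tau> g (comb m x) - ip (grad_vec x) w\<bar> \<le> e * I_norm w"
  proof (intro exI[of _ \<delta>] conjI ballI impI)
    show "0 < \<delta>" by (rule \<delta>(1))
    fix w :: "'d path" assume w: "w \<in> Vspan m" "I_norm w < \<delta>"
    then obtain u where u: "w = comb m u" by (auto simp: Vspan_eq)
    have "ip (grad_vec x) w = (\<Sum>j\<in>Aset m. (\<kappa> * u j) * grad j ?kx)"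
      unfolding u grad_vec_def ip_comb_same[OF m] by (simp add: mult_ac)
    moreover have "(\<lambda>t. comb m x t + w t) = comb m (\<lambda>a. x a + u a)" unfolding u comb_add ..
    ultimately show "\<bar>Pm M B m \<tau> g (\<lambda>t. comb m x t + w t) - Pm M B m \<tau> g (comb m x) - ip (grad_vec x) w\<bar> \<le> e * I_norm w"
      using \<delta>(2)[of u] w(2) unfolding u I_norm_comb[OF m] by (simp add: Pm_comb distrib_left)
  qed
qed

lemma linear_hess_map: "linear_on_Vspan m (hess_map x)"
  unfolding linear_on_Vspan_def
proof (intro conjI ballI allI)
  show "hess_map x y \<in> Vspan m" for y by (simp add: hess_map_def Vspan_eq)
  have eq: "hess_map x (comb m u) = comb m (\<lambda>i. \<Sum>j\<in>Aset m. \<kappa>\<^sup>2 * hess i j (\<lambda>a. \<kappa> * x a) * u j)" for u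
    unfolding hess_map_def by (simp add: coeffs_comb[OF m])
  fix y :: "'d path" assume "y \<in> Vspan m"
  then obtain u where u: "y = comb m u" by (auto simp: Vspan_eq)
  show "hess_map x (\<lambda>t. c *\<^sub>R y t) = (\<lambda>t. c *\<^sub>R hess_map x y t)" for c
    unfolding u comb_scale eq by (simp add: sum_distrib_left mult_ac)
  fix z :: "'d path" assume "z \<in> Vspan m"
  then obtain v where v: "z = comb m v" by (auto simp: Vspan_eq)
  show "hess_map x (\<lambda>t. y t + z t) = (\<lambda>t. hess_map x y t + hess_map x z t)"
    unfolding u v comb_add eq by (simp add: distrib_left sum.distrib)
qed

lemma has_hessian_Pm: "has_hessian m (Pm M B m \<tau> g) (comb m x) (hess_map x)"
  unfolding has_hessian_def
proof (intro conjI linear_hess_map exI[of _ "\<lambda>w. grad_vec (\<lambda>a. x a + coeffs m w a)"] allI impI)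
  show "\<exists>r>0. \<forall>w\<in>Vspan m. I_norm w < r \<longrightarrow>
     has_gradient m (Pm M B m \<tau> g) (\<lambda>t. comb m x t + w t) (grad_vec (\<lambda>a. x a + coeffs m w a))"
  proof (intro exI[of _ 1] conjI ballI impI)
    fix w :: "'d path" assume "w \<in> Vspan m"
    then obtain u where u: "w = comb m u" by (auto simp: Vspan_eq)
    have "(\<lambda>t. comb m x t + w t) = comb m (\<lambda>a. x a + u a)" unfolding u comb_add ..
    also have "\<dots> = comb m (\<lambda>a. x a + coeffs m w a)" by (rule comb_cong) (simp add: u coeffs_comb[OF m])
    finally show "has_gradient m (Pm M B m \<tau> g) (\<lambda>t. comb m x t + w t) (grad_vec (\<lambda>a. x a + coeffs m w a))"
      using has_gradient_Pm[of "\<lambda>a. x a + coeffs m w a"] by simp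
  qed simp
  fix e :: real assume e: "0 < e"
  let ?kx = "\<lambda>a. \<kappa> * x a"
  let ?R = "\<lambda>i u. grad i (\<lambda>a. ?kx a + u a) - grad i ?kx - (\<Sum>j\<in>Aset m. u j * hess i j ?kx)"
  have "\<forall>i\<in>Aset m. \<exists>K\<ge>0. \<forall>u. l1 (Aset m) u \<le> 1 \<longrightarrow> \<bar>?R i u\<bar> \<le> K * (l1 (Aset m) u)\<^sup>2"
    by (intro ballI grad_expansion)
  from bchoice[OF this] obtain K where K: "\<And>i. i \<in> Aset m \<Longrightarrow> 0 \<le> K i"
    "\<And>i u. i \<in> Aset m \<Longrightarrow> l1 (Aset m) u \<le> 1 \<Longrightarrow> \<bar>?R i u\<bar> \<le> K i * (l1 (Aset m) u)\<^sup>2"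
    by blast
  have "0 \<le> (\<Sum>i\<in>Aset m. K i)" using K(1) by (rule sum_nonneg)
  moreover have "\<bar>l1 (Aset m) (\<lambda>i. ?R i u)\<bar> \<le> (\<Sum>i\<in>Aset m. K i) * (l1 (Aset m) u)\<^sup>2" if "l1 (Aset m) u \<le> 1" for u
    unfolding abs_of_nonneg[OF l1_nonneg] unfolding l1_def[of _ "\<lambda>i. ?R i u"] sum_distrib_right
    by (intro sum_mono K(2) that)
  moreover have "0 < e / \<kappa>" using e \<kappa>_pos by simp
  ultimately obtain \<delta> where \<delta>: "\<delta> > 0" "\<And>u. sqrt (\<Sum>i\<in>Aset m. (u i)\<^sup>2) < \<delta> \<Longrightarrow>
     \<bar>l1 (Aset m) (\<lambda>i. ?R i (\<lambda>i. \<kappa> * u i))\<bar> \<le> e / \<kappa> * sqrt (\<Sum>i\<in>Aset m. (u i)\<^sup>2)"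
    using little_o_l2[OF fin \<kappa>_pos, of "\<Sum>i\<in>Aset m. K i" "\<lambda>u. l1 (Aset m) (\<lambda>i. ?R i u)" "e / \<kappa>"] by blast
  show "\<exists>\<delta>>0. \<forall>w\<in>Vspan m. I_norm w < \<delta> \<longrightarrow>
    I_norm (\<lambda>t. grad_vec (\<lambda>a. x a + coeffs m w a) t - grad_vec (\<lambda>a. x a + coeffs m (\<lambda>_. 0) a) t - hess_map x w t)
      \<le> e * I_norm w"
  proof (intro exI[of _ \<delta>] conjI ballI impI)
    show "0 < \<delta>" by (rule \<delta>(1))
    fix w :: "'d path" assume w: "w \<in> Vspan m" "I_norm w < \<delta>"
    then obtain u where u: "w = comb m u" by (auto simp: Vspan_eq)
    have z: "(\<lambda>_. 0) = comb m (\<lambda>_. 0)" by (simp add: comb_def fun_eq_iff)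
    have g1: "grad_vec (\<lambda>a. x a + coeffs m w a) = comb m (\<lambda>i. \<kappa> * grad i (\<lambda>a. ?kx a + \<kappa> * u a))"
      unfolding grad_vec_def
      by (intro comb_cong arg_cong2[where f="(*)"] refl)
         (auto simp: grad_def u coeffs_comb[OF m] distrib_left intro: smooth_cong_point)
    have g2: "grad_vec (\<lambda>a. x a + coeffs m (\<lambda>_. 0) a) = comb m (\<lambda>i. \<kappa> * grad i ?kx)"
      unfolding grad_vec_def z
      by (intro comb_cong arg_cong2[where f="(*)"] refl)
         (auto simp: grad_def coeffs_comb[OF m] intro: smooth_cong_point)
    have h: "hess_map x w = comb m (\<lambda>i. \<kappa> * (\<Sum>j\<in>Aset m. (\<kappa> * u j) * hess i j ?kx))"
      unfolding hess_map_def u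
      by (intro comb_cong) (simp add: coeffs_comb[OF m] sum_distrib_left power2_eq_square mult_ac)
    have "(\<lambda>t. grad_vec (\<lambda>a. x a + coeffs m w a) t - grad_vec (\<lambda>a. x a + coeffs m (\<lambda>_. 0) a) t - hess_map x w t)
      = comb m (\<lambda>i. \<kappa> * ?R i (\<lambda>i. \<kappa> * u i))"
      unfolding g1 g2 h comb_diff by (simp only: right_diff_distrib)
    then have "I_norm (\<lambda>t. grad_vec (\<lambda>a. x a + coeffs m w a) t - grad_vec (\<lambda>a. x a + coeffs m (\<lambda>_. 0) a) t - hess_map x w t)
      = sqrt (\<Sum>i\<in>Aset m. (\<kappa> * ?R i (\<lambda>i. \<kappa> * u i))\<^sup>2)"
      by (simp only: I_norm_comb[OF m])
    also have "\<dots> \<le> l1 (Aset m) (\<lambda>i. \<kappa> * ?R i (\<lambda>i. \<kappa> * u i))" by (rule l2_le_l1) simp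
    also have "\<dots> = \<kappa> * \<bar>l1 (Aset m) (\<lambda>i. ?R i (\<lambda>i. \<kappa> * u i))\<bar>"
      unfolding l1_scale using \<kappa>_pos by simp
    also have "\<dots> \<le> \<kappa> * (e / \<kappa> * sqrt (\<Sum>i\<in>Aset m. (u i)\<^sup>2))"
      using \<delta>(2)[of u] w(2) \<kappa>_pos unfolding u I_norm_comb[OF m] by (intro mult_left_mono) auto
    also have "\<dots> = e * I_norm w" using \<kappa>_pos by (simp add: u I_norm_comb[OF m])
    finally show "I_norm (\<lambda>t. grad_vec (\<lambda>a. x a + coeffs m w a) t - grad_vec (\<lambda>a. x a + coeffs m (\<lambda>_. 0) a) t - hess_map x w t)
      \<le> e * I_norm w" .
  qed
qed

lemma hess_map_diagonal:
  assumes a: "a \<in> Aset m"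
  shows "ip (hess_map x (hb m a)) (hb m a) =
     \<kappa>\<^sup>2 * (\<Sum>i\<in>Aset m. \<Sum>j\<in>Aset m. kron a i * kron a j * hess i j (\<lambda>a. \<kappa> * x a))"
proof -
  have "ip (hess_map x (hb m a)) (hb m a) = (\<Sum>i\<in>Aset m. (\<Sum>j\<in>Aset m. \<kappa>\<^sup>2 * hess i j (\<lambda>a. \<kappa> * x a) * kron a j) * kron a i)"
    unfolding hess_map_def comb_kron[OF a, symmetric] ip_comb_same[OF m] by (simp add: coeffs_comb[OF m])
  then show ?thesis by (simp add: sum_distrib_left sum_distrib_right mult_ac)
qed

text \<open>
  Two derivatives contribute \<open>\<kappa>\<^sup>2\<close>, and the shift of \<open>\<psi>\<close> by \<open>\<kappa> \<epsilon>\<close> contributes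
  \<open>\<beta> \<kappa> = e\<^sup>-\<^sup>\<tau>\<close>, which together give \<open>e\<^sup>-\<^sup>3\<^sup>\<tau> / \<beta>\<^sup>2\<close>.
\<close>

lemma hess_diagonal_increment_le:
  assumes a: "a \<in> Aset m"
    and inv: "\<And>z t. g (comb m (\<lambda>i. z i + t * kron a i)) = g (comb m (\<lambda>i. z i + t * w i))"
  shows "\<bar>ip (hess_map (\<lambda>b. x b + \<epsilon> * kron a b) (hb m a)) (hb m a) - ip (hess_map x (hb m a)) (hb m a)\<bar>
     \<le> exp (- 3 * \<tau>) / (beta \<tau>)\<^sup>2 * \<bar>\<epsilon>\<bar> * L * (2 * (\<Sum>i\<in>Aset m. (w i)\<^sup>2))"
proof -
  let ?S = "\<lambda>y. \<Sum>i\<in>Aset m. \<Sum>j\<in>Aset m. kron a i * kron a j * hess i j y"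
  have inv': "psi (\<lambda>i. z i + t * kron a i) = psi (\<lambda>i. z i + t * w i)" for z t
    unfolding psi_def using inv[of "\<lambda>i. beta \<tau> * z i" "beta \<tau> * t"] by (simp add: distrib_left mult.assoc)
  have k1: "l1 (Aset m) (kron a) = 1"
    using a by (simp add: l1_def kron_def if_distrib[of abs] cong: if_cong)
  have lip': "\<bar>psi (\<lambda>i. z i + (\<kappa> * \<epsilon>) * kron a i) - psi z\<bar> \<le> exp (- \<tau>) * \<bar>\<epsilon>\<bar> * L" for z
  proof -
    have "\<bar>psi (\<lambda>i. z i + (\<kappa> * \<epsilon>) * kron a i) - psi z\<bar> \<le> (L * beta \<tau>) * l1 (Aset m) (\<lambda>i. (\<kappa> * \<epsilon>) * kron a i)"
      using psi_lip[of "\<lambda>i. z i + (\<kappa> * \<epsilon>) * kron a i" z] by simp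
    also have "\<dots> = (beta \<tau> * \<kappa>) * \<bar>\<epsilon>\<bar> * L" unfolding l1_scale k1 using \<kappa>_pos by (simp add: abs_mult)
    also have "beta \<tau> * \<kappa> = exp (- \<tau>)" using beta_pos by (simp add: \<kappa>_def)
    finally show ?thesis .
  qed
  have "ip (hess_map (\<lambda>b. x b + \<epsilon> * kron a b) (hb m a)) (hb m a) - ip (hess_map x (hb m a)) (hb m a)
     = \<kappa>\<^sup>2 * (?S (\<lambda>i. \<kappa> * x i + (\<kappa> * \<epsilon>) * kron a i) - ?S (\<lambda>i. \<kappa> * x i))"
    unfolding hess_map_diagonal[OF a] by (simp add: right_diff_distrib distrib_left mult.assoc)
  then have "\<bar>ip (hess_map (\<lambda>b. x b + \<epsilon> * kron a b) (hb m a)) (hb m a) - ip (hess_map x (hb m a)) (hb m a)\<bar>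
     = \<kappa>\<^sup>2 * \<bar>?S (\<lambda>i. \<kappa> * x i + (\<kappa> * \<epsilon>) * kron a i) - ?S (\<lambda>i. \<kappa> * x i)\<bar>"
    by (simp only: abs_mult abs_power2)
  also have "\<dots> \<le> \<kappa>\<^sup>2 * ((exp (- \<tau>) * \<bar>\<epsilon>\<bar> * L) * (2 * (\<Sum>i\<in>Aset m. (w i)\<^sup>2)))"
    by (intro mult_left_mono hess_increment_le inv' lip') auto
  also have "\<kappa>\<^sup>2 * ((exp (- \<tau>) * \<bar>\<epsilon>\<bar> * L) * (2 * (\<Sum>i\<in>Aset m. (w i)\<^sup>2)))
     = (\<kappa>\<^sup>2 * exp (- \<tau>)) * \<bar>\<epsilon>\<bar> * L * (2 * (\<Sum>i\<in>Aset m. (w i)\<^sup>2))" by (simp only: mult_ac)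
  also have "\<kappa>\<^sup>2 * exp (- \<tau>) = exp (- 3 * \<tau>) / (beta \<tau>)\<^sup>2"
    by (simp add: \<kappa>_def power_divide power2_eq_square mult_exp_exp)
  finally show ?thesis .
qed

end

text \<open>
  In a single coordinate direction of \<open>\<V>\<^sup>m\<close> the projection already gains the factor \<open>\<surd>(N/m)\<close>, and
  the triangle inequality turns this into a Lipschitz bound in the \<open>l1\<close> norm.
\<close>

lemma proj_lipschitz:
  assumes \<Lambda>: "(\<eta>, p) \<in> Lambda" and N: "0 < N" and m: "0 < m" and F: "F \<in> Lip1 \<eta> p"
  shows "\<bar>(F \<circ> proj N) (comb m x) - (F \<circ> proj N) (comb m y)\<bar>
    \<le> (norm_const \<eta> p * real N powr (\<eta> - 1/2) * sqrt (real N / real m)) * l1 (Aset m) (\<lambda>a. x a - y a)"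
proof -
  let ?T = "\<lambda>x b. \<Sum>a\<in>Aset m. x a * gram m a N b"
  have Td: "?T x b - ?T y b = ?T (\<lambda>a. x a - y a) b" for b
    by (simp add: left_diff_distrib sum_subtractf)
  have "\<bar>(F \<circ> proj N) (comb m x) - (F \<circ> proj N) (comb m y)\<bar> \<le> W_norm \<eta> p (\<lambda>t. comb N (?T x) t - comb N (?T y) t)"
    using F comb_in_Wspace[OF \<Lambda> N] unfolding Lip1_def o_def proj_comb[OF N] by blast
  also have "(\<lambda>t. comb N (?T x) t - comb N (?T y) t) = comb N (?T (\<lambda>a. x a - y a))"
    unfolding comb_diff Td ..
  also have "W_norm \<eta> p (comb N (?T (\<lambda>a. x a - y a))) \<le> norm_const \<eta> p * real N powr (\<eta> - 1/2) * (\<Sum>b\<in>Aset N. \<bar>?T (\<lambda>a. x a - y a) b\<bar>)"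
    by (rule W_norm_comb_le[OF \<Lambda> N])
  also have "\<dots> \<le> norm_const \<eta> p * real N powr (\<eta> - 1/2) * (sqrt (real N / real m) * l1 (Aset m) (\<lambda>a. x a - y a))"
  proof (rule mult_left_mono)
    have "(\<Sum>b\<in>Aset N. \<bar>?T (\<lambda>a. x a - y a) b\<bar>) \<le> (\<Sum>b\<in>Aset N. \<Sum>a\<in>Aset m. \<bar>x a - y a\<bar> * gram m a N b)"
      by (intro sum_mono order.trans[OF sum_abs]) (simp add: abs_mult gram_nonneg)
    also have "\<dots> = (\<Sum>a\<in>Aset m. \<bar>x a - y a\<bar> * (\<Sum>b\<in>Aset N. gram m a N b))"
      by (subst sum.swap) (simp add: sum_distrib_left)
    also have "\<dots> \<le> (\<Sum>a\<in>Aset m. \<bar>x a - y a\<bar> * sqrt (real N / real m))"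
      by (intro sum_mono mult_left_mono sum_gram_le m N) auto
    finally show "(\<Sum>b\<in>Aset N. \<bar>?T (\<lambda>a. x a - y a) b\<bar>) \<le> sqrt (real N / real m) * l1 (Aset m) (\<lambda>a. x a - y a)"
      by (simp add: l1_def sum_distrib_left mult.commute)
  qed (use norm_const_pos[OF \<Lambda>] in simp)
  finally show ?thesis by (simp only: mult.assoc)
qed

lemma time_factor_le:
  assumes "0 < \<tau>"
  shows "exp (- 3 * \<tau>) / (beta \<tau>)\<^sup>2 \<le> exp (- 5 * \<tau> / 2) / (beta (\<tau> / 2))\<^sup>2"
proof -
  have b: "(beta t)\<^sup>2 = 1 - exp (- 2 * t)" if "0 < t" for t
    using that by (simp add: beta_def)
  have "(beta (\<tau> / 2))\<^sup>2 \<le> (beta \<tau>)\<^sup>2" "0 < (beta (\<tau> / 2))\<^sup>2"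
    using assms by (simp_all add: b)
  then show ?thesis using assms by (intro frac_le) auto
qed

theorem theorem4p4:
  fixes \<eta> :: real and p :: ereal
  assumes "(\<eta>, p) \<in> Lambda"
  shows "\<exists>c>0. \<forall>(M :: 'a measure) (B :: real \<Rightarrow> 'a \<Rightarrow> real^'d::finite). brownian_motion M B \<longrightarrow>
    (\<forall>(N::nat) (m::nat) (\<tau>::real) v a (\<epsilon>::real) F.
    0 < N \<longrightarrow> N < m \<longrightarrow> 0 < \<tau> \<longrightarrow> v \<in> Vspan m \<longrightarrow> a \<in> Aset m \<longrightarrow> F \<in> Lip1 \<eta> p \<longrightarrow>
    (\<exists>H H'.
       has_hessian m (Pm M B m \<tau> (F \<circ> proj N)) (\<lambda>t. v t + \<epsilon> *\<^sub>R hb m a t) H \<and>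
       has_hessian m (Pm M B m \<tau> (F \<circ> proj N)) v H' \<and>
       \<bar>ip (H (hb m a)) (hb m a) - ip (H' (hb m a)) (hb m a)\<bar>
         \<le> c * (exp (- 5 * \<tau> / 2) / (beta (\<tau> / 2))\<^sup>2) * \<bar>\<epsilon>\<bar>
             * real N powr (\<eta> - 1/2) * sqrt (real N ^ 3 / real m ^ 3)))"
proof (intro exI[of _ "6 * norm_const \<eta> p"] conjI allI impI)
  show "0 < 6 * norm_const \<eta> p" using norm_const_pos[OF assms] by simp
next
  fix M :: "'a measure" and B :: "real \<Rightarrow> 'a \<Rightarrow> real^'d::finite"
    and N m :: nat and \<tau> :: real and v :: "'d path" and a :: "'d \<times> nat" and \<epsilon> :: real and F :: "'d path \<Rightarrow> real"
  assume BM: "brownian_motion M B" and N: "0 < N" and Nm: "N < m" and \<tau>: "0 < \<tau>"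
    and v: "v \<in> Vspan m" and a: "a \<in> Aset m" and F: "F \<in> Lip1 \<eta> p"
  have m: "0 < m" using N Nm by simp
  define r where "r = real N / real m"
  have r: "0 \<le> r" by (simp add: r_def)
  define L where "L = norm_const \<eta> p * real N powr (\<eta> - 1/2) * sqrt r"
  have L: "0 \<le> L" using norm_const_pos[OF assms] r by (simp add: L_def)
  interpret BM: brownian_motion M B by (rule BM)
  interpret lipschitz_heat_flow M B m \<tau> "F \<circ> proj N" L
    using m \<tau> L proj_lipschitz[OF assms N m F] by unfold_locales (simp_all only: L_def r_def)
  obtain x where x: "v = comb m x" using v by (auto simp: Vspan_eq)
  let ?x' = "\<lambda>b. x b + \<epsilon> * kron a b"
  have vx': "(\<lambda>t. v t + \<epsilon> *\<^sub>R hb m a t) = comb m ?x'"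
    unfolding x comb_kron[OF a, symmetric] comb_scale comb_add ..
  obtain w where w: "\<And>b. b \<in> Aset N \<Longrightarrow> (\<Sum>a'\<in>Aset m. w a' * gram m a' N b) = gram m a N b"
    and w2: "(\<Sum>a'\<in>Aset m. (w a')\<^sup>2) \<le> 3 * r"
    using exchange_direction[OF N Nm a] unfolding r_def by blast
  have inv: "(F \<circ> proj N) (comb m (\<lambda>i. z i + t * kron a i)) = (F \<circ> proj N) (comb m (\<lambda>i. z i + t * w i))" for z t
  proof -
    have "(\<Sum>i\<in>Aset m. (z i + t * kron a i) * gram m i N b) = (\<Sum>i\<in>Aset m. (z i + t * w i) * gram m i N b)"
      if "b \<in> Aset N" for b
    proof -
      have "(\<Sum>i\<in>Aset m. kron a i * gram m i N b) = gram m a N b"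
        using a by (simp add: kron_def if_distrib[of "\<lambda>c. c * _"] cong: if_cong)
      then have "(\<Sum>i\<in>Aset m. kron a i * gram m i N b) = (\<Sum>i\<in>Aset m. w i * gram m i N b)"
        by (simp add: w[OF that])
      then show ?thesis by (simp add: distrib_right sum.distrib mult.assoc sum_distrib_left[symmetric])
    qed
    then show ?thesis unfolding o_def proj_comb[OF N] by (intro arg_cong[where f = F] comb_cong)
  qed
  have "\<bar>ip (hess_map ?x' (hb m a)) (hb m a) - ip (hess_map x (hb m a)) (hb m a)\<bar>
     \<le> exp (- 3 * \<tau>) / (beta \<tau>)\<^sup>2 * \<bar>\<epsilon>\<bar> * L * (2 * (\<Sum>i\<in>Aset m. (w i)\<^sup>2))"
    by (rule hess_diagonal_increment_le[OF a inv])
  also have "\<dots> \<le> (exp (- 5 * \<tau> / 2) / (beta (\<tau> / 2))\<^sup>2) * \<bar>\<epsilon>\<bar> * L * (2 * (3 * r))"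
    using w2 L time_factor_le[OF \<tau>]
    by (intro mult_mono mult_left_mono) (auto intro!: mult_nonneg_nonneg divide_nonneg_nonneg sum_nonneg)
  also have "\<dots> = 6 * norm_const \<eta> p * (exp (- 5 * \<tau> / 2) / (beta (\<tau> / 2))\<^sup>2) * \<bar>\<epsilon>\<bar>
             * real N powr (\<eta> - 1/2) * (sqrt r * r)" by (simp add: L_def)
  also have "sqrt r * r = sqrt (real N ^ 3 / real m ^ 3)"
  proof -
    have "real N ^ 3 / real m ^ 3 = r * r\<^sup>2" by (simp add: r_def power_divide power2_eq_square power3_eq_cube)
    then show ?thesis using r by (simp add: real_sqrt_mult)
  qed
  finally show "\<exists>H H'.
       has_hessian m (Pm M B m \<tau> (F \<circ> proj N)) (\<lambda>t. v t + \<epsilon> *\<^sub>R hb m a t) H \<and>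
       has_hessian m (Pm M B m \<tau> (F \<circ> proj N)) v H' \<and>
       \<bar>ip (H (hb m a)) (hb m a) - ip (H' (hb m a)) (hb m a)\<bar>
         \<le> 6 * norm_const \<eta> p * (exp (- 5 * \<tau> / 2) / (beta (\<tau> / 2))\<^sup>2) * \<bar>\<epsilon>\<bar>
             * real N powr (\<eta> - 1/2) * sqrt (real N ^ 3 / real m ^ 3)"
    unfolding vx' unfolding x using has_hessian_Pm by blast
qed

end
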